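(* Let $n\ge1$ and let $\chi_n\in \mathrm{H}^1(\mathbb{K},\mathbb{Z}/p^n)$ be a radical character of order $p^n$. For $i=1,\dots,n$ set $\chi_i:=\chi_n^{p^{n-i}}$, $\delta_i:=\delta_{\chi_i}$ and $\omega_i:=\omega_{\chi_i}$ (all $\chi_i$ being assumed radical, so that the $\omega_i$ are defined). Let $\mathcal{C}:\Omega^1_\kappa\to\Omega^1_\kappa$ be the Cartier operator. Then: (i) $\mathcal{C}(\omega_1)=0$. (ii) For every $1<i\le n$ one has $\delta_i\ge p\,\delta_{i-1}$. Moreover: (a) if $\delta_i=p\,\delta_{i-1}$ then $\mathcal{C}(\omega_i)=\omega_{i-1}$; (b) if $\delta_i>p\,\delta_{i-1}$ then $\mathcal{C}(\omega_i)=0$.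
   Context: $k$ is an algebraically closed field of characteristic $p>0$; $K$ is a complete discretely valued field of characteristic $p$ with residue field $k$, uniformizer $\pi$ and valuation $\nu$ with $\nu(\pi)=1$, extended to finite extensions of $K$ (taking values in $\mathbb{Q}$). $K$ is replaced by a finite extension whenever necessary, keeping this normalization and with fixed compatible choices of $\pi^s$, $s\in\mathbb{Q}$. $\mathbb{K}=K(X)$ carries the Gauss valuation $\nu_0$ extending $\nu$ with $\nu_0(X)=0$; its residue field is $\kappa=k(x)$. By Artin–Schreier–Witt theory $\mathrm{H}^1_{p^n}(\mathbb{K})=\mathrm{H}^1(\mathbb{K},\mathbb{Z}/p^n)\cong W_n(\mathbb{K})/\wp(W_n(\mathbb{K}))$, $\wp=F-\mathrm{id}$; the group of characters is written multiplicatively. If $\chi$ is the class of $(a^1,\dots,a^n)$, then $\chi^{p^{n-i}}$, viewed in $\mathrm{H}^1_{p^i}(\mathbb{K})$, is the class of $(a^1,\dots,a^i)$. After a finite extension of $K$, every character considered is weakly unramified at $\nu_0$: every extension of $\nu_0$ to the function field of the corresponding cover has ramification index $1$. Swan conductor (Kato): for $\chi\in\mathrm{H}^1_{p^n}(\mathbb{K})$, $\mathrm{sw}(\chi)$ is the smallest $s\ge 0$ such that $\chi$, over the completion of $\mathbb{K}$ at $\nu_0$, is represented by a Witt vector $(a^1,\dots,a^n)$ with $p^{n-i}\nu_0(a^i)\ge -s$ for all $i$; a representative achieving this is called best. The depth is $\delta_\chi=\mathrm{sw}(\chi)/p$. $\chi$ is radical if $\delta_\chi>0$. In that case the differential conductor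 $\omega_\chi\in\Omega^1_\kappa$ is the differential form with $\mathrm{rsw}(\chi)=\pi^{-\mathrm{sw}(\chi)}\otimes\omega_\chi$, where $\mathrm{rsw}$ is Kato's refined Swan conductor; concretely, for a best representative, $\omega_\chi$ is the (nonzero) reduction of $\pi^{\mathrm{sw}(\chi)}\sum_{i=1}^n (a^i)^{p^{n-i}-1}da^i$. Cartier operator: writing $\omega=(f_0^p+f_1^px+\dots+f_{p-1}^px^{p-1})dx$ with $f_j\in\kappa$, $\mathcal{C}(\omega)=f_{p-1}dx$. *)

theory Defs
  imports
    "HOL-Library.Poly_Mapping"
    "HOL-Computational_Algebra.Computational_Algebra"
    "HOL-Algebra.Algebraic_Closure_Type"
    "HOL-Algebra.Multiplicative_Group"
begin

section \<open>Rational-valued valuations on fields\<close>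

text \<open>
  A valuation is a function into \<^typ>\<open>rat\<close> whose value at \<open>0\<close> carries no information;
  the convention \<open>v 0 = \<infinity>\<close> is built into \<open>val_ge\<close> and \<open>val_pos\<close>.
  The set \<open>L\<close> in \<open>valuation_on\<close> is meant to be a subfield.
\<close>

definition valuation_on :: "'b::field set \<Rightarrow> ('b \<Rightarrow> rat) \<Rightarrow> bool" where
  "valuation_on L v \<longleftrightarrow>
     (\<forall>x\<in>L. \<forall>y\<in>L. x \<noteq> 0 \<longrightarrow> y \<noteq> 0 \<longrightarrow> v (x * y) = v x + v y) \<and>
     (\<forall>x\<in>L. \<forall>y\<in>L. x \<noteq> 0 \<longrightarrow> y \<noteq> 0 \<longrightarrow> x + y \<noteq> 0 \<longrightarrow> min (v x) (v y) \<le> v (x + y))"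

definition val_ge :: "('b::field \<Rightarrow> rat) \<Rightarrow> 'b \<Rightarrow> rat \<Rightarrow> bool" where
  "val_ge v x s \<longleftrightarrow> x = 0 \<or> s \<le> v x"

definition val_pos :: "('b::field \<Rightarrow> rat) \<Rightarrow> 'b \<Rightarrow> bool" where
  "val_pos v x \<longleftrightarrow> x = 0 \<or> 0 < v x"

definition value_group :: "('b::field \<Rightarrow> rat) \<Rightarrow> rat set" where
  "value_group v = v ` {x. x \<noteq> 0}"

definition val_lim :: "('b::field \<Rightarrow> rat) \<Rightarrow> (nat \<Rightarrow> 'b) \<Rightarrow> 'b \<Rightarrow> bool" where
  "val_lim v u l \<longleftrightarrow> (\<forall>s. \<exists>M. \<forall>n\<ge>M. val_ge v (u n - l) s)"

definition val_Cauchy :: "('b::field \<Rightarrow> rat) \<Rightarrow> (nat \<Rightarrow> 'b) \<Rightarrow> bool" where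
  "val_Cauchy v u \<longleftrightarrow> (\<forall>s. \<exists>M. \<forall>m\<ge>M. \<forall>n\<ge>M. val_ge v (u m - u n) s)"

definition val_complete :: "('b::field \<Rightarrow> rat) \<Rightarrow> bool" where
  "val_complete v \<longleftrightarrow> (\<forall>u. val_Cauchy v u \<longrightarrow> (\<exists>l. val_lim v u l))"

text \<open>
  The value group is \<open>(1/e)\<int>\<close> rather than \<open>\<int>\<close>: the normalization \<open>\<nu> \<pi> = 1\<close> refers to the
  uniformizer \<open>\<pi>\<close> of the original field and is kept when that field is replaced by a finite
  extension, of ramification index \<open>e\<close>.
\<close>

definition complete_dvf :: "('b::field \<Rightarrow> rat) \<Rightarrow> bool" where
  "complete_dvf \<nu> \<longleftrightarrow> valuation_on UNIV \<nu> \<and>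
     (\<exists>e::nat. 0 < e \<and> value_group \<nu> = {of_int m / of_nat e | m::int. True}) \<and>
     val_complete \<nu>"

text \<open>
  The map \<open>red\<close> exhibits \<open>'k\<close> as the residue field of \<open>\<nu>\<close>; its values outside the valuation
  ring are irrelevant.
\<close>

definition residue_map :: "('b::field \<Rightarrow> rat) \<Rightarrow> ('b \<Rightarrow> 'k::field) \<Rightarrow> bool" where
  "residue_map \<nu> red \<longleftrightarrow>
     red 1 = 1 \<and>
     (\<forall>x y. val_ge \<nu> x 0 \<longrightarrow> val_ge \<nu> y 0 \<longrightarrow>
        red (x + y) = red x + red y \<and> red (x * y) = red x * red y) \<and>
     (\<forall>x. val_ge \<nu> x 0 \<longrightarrow> (red x = 0 \<longleftrightarrow> val_pos \<nu> x)) \<and>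
     (\<forall>c. \<exists>x. val_ge \<nu> x 0 \<and> red x = c)"

text \<open>
  Compatible choices \<open>pw s\<close> of \<open>\<pi>\<^sup>s\<close>, for those \<open>s\<close> that are valuations of elements of the
  field; in particular \<open>\<pi> = pw 1\<close>.
\<close>

definition compatible_powers :: "('b::field \<Rightarrow> rat) \<Rightarrow> (rat \<Rightarrow> 'b) \<Rightarrow> bool" where
  "compatible_powers \<nu> pw \<longleftrightarrow>
     (\<forall>s\<in>value_group \<nu>. pw s \<noteq> 0 \<and> \<nu> (pw s) = s) \<and>
     (\<forall>s\<in>value_group \<nu>. \<forall>t\<in>value_group \<nu>. pw (s + t) = pw s * pw t)"


section \<open>The rational function field: Gauss valuation, completion, reduction\<close>

text \<open>\<open>K(X)\<close> is the type \<^typ>\<open>'a poly fract\<close>.\<close>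

definition gauss_poly :: "('a::field \<Rightarrow> rat) \<Rightarrow> 'a poly \<Rightarrow> rat" where
  "gauss_poly \<nu> f = Min (\<nu> ` (set (Polynomial.coeffs f) - {0}))"

definition gauss_val :: "('a::field \<Rightarrow> rat) \<Rightarrow> 'a poly fract \<Rightarrow> rat" where
  "gauss_val \<nu> f = (THE r. \<exists>a b. a \<noteq> 0 \<and> b \<noteq> 0 \<and> f = Fract a b \<and>
                               r = gauss_poly \<nu> a - gauss_poly \<nu> b)"

text \<open>
  A completion of \<open>K(X)\<close> at the Gauss valuation: a complete field \<open>'c\<close> with an isometric embedding
  \<open>\<iota>\<close> of \<open>K(X)\<close> with dense image.
\<close>

definition gauss_completion ::
  "('a::field \<Rightarrow> rat) \<Rightarrow> ('a poly fract \<Rightarrow> 'c::field) \<Rightarrow> ('c \<Rightarrow> rat) \<Rightarrow> bool" where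
  "gauss_completion \<nu> \<iota> v \<longleftrightarrow>
     \<iota> 1 = 1 \<and> (\<forall>f g. \<iota> (f + g) = \<iota> f + \<iota> g) \<and> (\<forall>f g. \<iota> (f * g) = \<iota> f * \<iota> g) \<and>
     valuation_on UNIV v \<and> (\<forall>f. f \<noteq> 0 \<longrightarrow> v (\<iota> f) = gauss_val \<nu> f) \<and>
     val_complete v \<and>
     (\<forall>x s. \<exists>f. val_ge v (x - \<iota> f) s)"

text \<open>
  Reduction of the valuation ring of the completion onto \<open>k(x)\<close>: an element is congruent, modulo
  the maximal ideal, to a quotient \<open>a / b\<close> of integral polynomials with nonzero reduction of \<open>b\<close>,
  and \<open>X\<close> reduces to \<open>x\<close>.
\<close>

definition gauss_red ::
  "('a::field \<Rightarrow> rat) \<Rightarrow> ('a \<Rightarrow> 'k::field) \<Rightarrow> ('a poly fract \<Rightarrow> 'c::field) \<Rightarrow> ('c \<Rightarrow> rat)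
     \<Rightarrow> 'c \<Rightarrow> 'k poly fract" where
  "gauss_red \<nu> red \<iota> v f = (THE r. \<exists>a b.
     (\<forall>i. val_ge \<nu> (poly.coeff a i) 0) \<and> (\<forall>i. val_ge \<nu> (poly.coeff b i) 0) \<and>
     map_poly red b \<noteq> 0 \<and> val_pos v (f - \<iota> (Fract a b)) \<and>
     r = Fract (map_poly red a) (map_poly red b))"

text \<open>The derivation \<open>d/dX\<close> of \<open>K(X)\<close> and its continuous extension to the completion.\<close>

definition fract_deriv :: "'a::field poly fract \<Rightarrow> 'a poly fract" where
  "fract_deriv f = (THE r. \<exists>a b. b \<noteq> 0 \<and> f = Fract a b \<and>
                              r = Fract (pderiv a * b - a * pderiv b) (b * b))"

definition compl_deriv ::
  "('a::field poly fract \<Rightarrow> 'c::field) \<Rightarrow> ('c \<Rightarrow> rat) \<Rightarrow> 'c \<Rightarrow> 'c" where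
  "compl_deriv \<iota> v f = (THE l. \<forall>u. val_lim v (\<lambda>n. \<iota> (u n)) f \<longrightarrow>
                                   val_lim v (\<lambda>n. \<iota> (fract_deriv (u n))) l)"


section \<open>Witt vectors of finite length\<close>

text \<open>
  Integral polynomials in variables from \<open>'v\<close>: finitely supported maps from monomials to
  coefficients.
\<close>

type_synonym 'v zpoly = "('v \<Rightarrow>\<^sub>0 nat) \<Rightarrow>\<^sub>0 int"

definition zvar :: "'v \<Rightarrow> 'v zpoly" where
  "zvar i = Poly_Mapping.single (Poly_Mapping.single i 1) 1"

definition zpoly_eval :: "('v \<Rightarrow> 'r::comm_ring_1) \<Rightarrow> 'v zpoly \<Rightarrow> 'r" where
  "zpoly_eval f P = (\<Sum>m\<in>Poly_Mapping.keys P. of_int (Poly_Mapping.lookup P m) *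
                       (\<Prod>i\<in>Poly_Mapping.keys m. f i ^ Poly_Mapping.lookup m i))"

definition ghost :: "nat \<Rightarrow> nat \<Rightarrow> (nat \<Rightarrow> 'r::comm_ring_1) \<Rightarrow> 'r" where
  "ghost p n x = (\<Sum>i\<le>n. of_nat p ^ i * x i ^ (p ^ (n - i)))"

text \<open>
  The universal addition polynomials \<open>S\<^sub>0, S\<^sub>1, \<dots>\<close> of the \<open>p\<close>-typical Witt vectors; the variables
  \<open>Inl i\<close> and \<open>Inr i\<close> are the \<open>i\<close>-th components of the two summands.
\<close>

definition witt_sum_poly :: "nat \<Rightarrow> nat \<Rightarrow> (nat + nat) zpoly" where
  "witt_sum_poly p = (THE S. \<forall>n. ghost p n S =
     ghost p n (\<lambda>i. zvar (Inl i)) + ghost p n (\<lambda>i. zvar (Inr i)))"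

text \<open>
  A Witt vector \<open>(a\<^sup>1, \<dots>, a\<^sup>n)\<close> is a list of length \<open>n\<close>, so \<open>a\<^sup>i\<close> is \<open>a ! (i - 1)\<close>.
\<close>

definition witt_add :: "nat \<Rightarrow> 'r::comm_ring_1 list \<Rightarrow> 'r list \<Rightarrow> 'r list" where
  "witt_add p a b =
     map (\<lambda>i. zpoly_eval (case_sum (\<lambda>j. a ! j) (\<lambda>j. b ! j)) (witt_sum_poly p i)) [0..<length a]"

definition witt :: "nat \<Rightarrow> nat \<Rightarrow> 'r::comm_ring_1 list monoid" where
  "witt p n = \<lparr>carrier = {a. length a = n}, monoid.mult = witt_add p, monoid.one = replicate n 0\<rparr>"

text \<open>
  The Frobenius of the Witt vectors of a ring of characteristic \<open>p\<close>, and \<open>\<wp> = F - id\<close>.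
\<close>

definition witt_frob :: "nat \<Rightarrow> 'r::comm_ring_1 list \<Rightarrow> 'r list" where
  "witt_frob p a = map (\<lambda>x. x ^ p) a"

definition witt_wp :: "nat \<Rightarrow> 'r::comm_ring_1 list \<Rightarrow> 'r list" where
  "witt_wp p a = witt_frob p a \<otimes>\<^bsub>witt p (length a)\<^esub> inv\<^bsub>witt p (length a)\<^esub> a"


section \<open>Characters of order dividing a power of p\<close>

text \<open>
  \<open>H\<^sup>1(\<K>, \<int>/p\<^sup>n)\<close> via Artin-Schreier-Witt theory, as \<open>W\<^sub>n(\<K>) / \<wp>(W\<^sub>n(\<K>))\<close>.
  A character is thus a coset of Witt vectors, and its elements are its representatives.
\<close>

definition H1 :: "nat \<Rightarrow> nat \<Rightarrow> 'r::field list set monoid" where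
  "H1 p n = witt p n Mod (witt_wp p ` carrier (witt p n))"

text \<open>
  The inclusion of \<open>H\<^sup>1(\<K>, \<int>/p\<^sup>i)\<close> into \<open>H\<^sup>1(\<K>, \<int>/p\<^sup>n)\<close> for \<open>i \<le> n\<close>, which views characters of
  order dividing \<open>p\<^sup>i\<close> as characters of order dividing \<open>p\<^sup>n\<close>. It is induced by multiplication by
  \<open>p\<^sup>n\<^sup>-\<^sup>i\<close> from \<open>\<int>/p\<^sup>i = W\<^sub>i(\<bbbF>\<^sub>p)\<close> to \<open>\<int>/p\<^sup>n = W\<^sub>n(\<bbbF>\<^sub>p)\<close>, that is by the iterated Verschiebung
  \<open>V\<^sup>n\<^sup>-\<^sup>i\<close>.
\<close>

definition H1_incl :: "nat \<Rightarrow> nat \<Rightarrow> nat \<Rightarrow> 'r::field list set \<Rightarrow> 'r list set" where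
  "H1_incl p i n \<chi> =
     (\<Union>a\<in>\<chi>. (witt_wp p ` carrier (witt p n)) #>\<^bsub>witt p n\<^esub> (replicate (n - i) 0 @ a))"

text \<open>
  The function field \<open>\<K>(y)\<close> of the cover given by \<open>\<wp>(y) = a\<close>, inside an algebraic closure of \<open>\<K>\<close>.
\<close>

definition is_subfield :: "'b::field set \<Rightarrow> bool" where
  "is_subfield L \<longleftrightarrow> 1 \<in> L \<and> (\<forall>x\<in>L. \<forall>y\<in>L. x - y \<in> L \<and> x * y \<in> L) \<and> (\<forall>x\<in>L. inverse x \<in> L)"

definition adjoin :: "'b::field alg_closure set \<Rightarrow> 'b alg_closure set" where
  "adjoin Y = \<Inter>{L. is_subfield L \<and> range to_ac \<subseteq> L \<and> Y \<subseteq> L}"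

definition weakly_unramified ::
  "nat \<Rightarrow> ('a::field \<Rightarrow> rat) \<Rightarrow> nat \<Rightarrow> 'a poly fract list set \<Rightarrow> bool" where
  "weakly_unramified p \<nu> n \<chi> \<longleftrightarrow>
     (\<forall>a\<in>\<chi>. \<forall>y w. length y = n \<longrightarrow> witt_wp p y = map to_ac a \<longrightarrow>
        valuation_on (adjoin (set y)) w \<longrightarrow> (\<forall>f. f \<noteq> 0 \<longrightarrow> w (to_ac f) = gauss_val \<nu> f) \<longrightarrow>
        w ` (adjoin (set y) - {0}) = value_group (gauss_val \<nu>))"


section \<open>Swan conductor, depth and differential conductor\<close>

text \<open>
  \<open>represents\<close>: the Witt vector \<open>a\<close> over the completion lies in the image of the class \<open>\<chi>\<close>.
\<close>

definition represents ::
  "nat \<Rightarrow> ('a::field poly fract \<Rightarrow> 'c::field) \<Rightarrow> nat \<Rightarrow> 'c list \<Rightarrow> 'a poly fract list set \<Rightarrow> bool" where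
  "represents p \<iota> n a \<chi> \<longleftrightarrow>
     (\<exists>b\<in>\<chi>. a \<in> (witt_wp p ` carrier (witt p n)) #>\<^bsub>witt p n\<^esub> map \<iota> b)"

definition pole_bounded :: "nat \<Rightarrow> ('c::field \<Rightarrow> rat) \<Rightarrow> nat \<Rightarrow> rat \<Rightarrow> 'c list \<Rightarrow> bool" where
  "pole_bounded p v n s a \<longleftrightarrow>
     (\<forall>i\<in>{1..n}. a ! (i - 1) = 0 \<or> of_nat (p ^ (n - i)) * v (a ! (i - 1)) \<ge> - s)"

definition swan ::
  "nat \<Rightarrow> ('a::field poly fract \<Rightarrow> 'c::field) \<Rightarrow> ('c \<Rightarrow> rat) \<Rightarrow> nat \<Rightarrow> 'a poly fract list set \<Rightarrow> rat"
  where
  "swan p \<iota> v n \<chi> = (LEAST s. 0 \<le> s \<and> (\<exists>a. represents p \<iota> n a \<chi> \<and> pole_bounded p v n s a))"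

definition best_rep ::
  "nat \<Rightarrow> ('a::field poly fract \<Rightarrow> 'c::field) \<Rightarrow> ('c \<Rightarrow> rat) \<Rightarrow> nat \<Rightarrow> 'c list
     \<Rightarrow> 'a poly fract list set \<Rightarrow> bool" where
  "best_rep p \<iota> v n a \<chi> \<longleftrightarrow> represents p \<iota> n a \<chi> \<and> pole_bounded p v n (swan p \<iota> v n \<chi>) a"

definition depth ::
  "nat \<Rightarrow> ('a::field poly fract \<Rightarrow> 'c::field) \<Rightarrow> ('c \<Rightarrow> rat) \<Rightarrow> nat \<Rightarrow> 'a poly fract list set \<Rightarrow> rat"
  where
  "depth p \<iota> v n \<chi> = swan p \<iota> v n \<chi> / of_nat p"

definition is_radical ::
  "nat \<Rightarrow> ('a::field poly fract \<Rightarrow> 'c::field) \<Rightarrow> ('c \<Rightarrow> rat) \<Rightarrow> nat \<Rightarrow> 'a poly fract list set \<Rightarrow> bool"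
  where
  "is_radical p \<iota> v n \<chi> \<longleftrightarrow> 0 < depth p \<iota> v n \<chi>"

text \<open>
  Differential forms are identified with their coefficients with respect to \<open>dX\<close> and \<open>dx\<close>:
  the form \<open>f dx\<close> of \<open>k(x)\<close> is represented by \<open>f\<close>, and \<open>da\<close> by the derivative of \<open>a\<close>.
  So the expression being reduced is the coefficient of
  \<open>\<pi>\<^sup>s \<Sum>\<^sub>i (a\<^sup>i)\<^sup>m da\<^sup>i\<close> with \<open>s = sw(\<chi>)\<close> and \<open>m = p\<^sup>n\<^sup>-\<^sup>i - 1\<close>, for a best representative \<open>a\<close>.
\<close>

definition diff_conductor ::
  "nat \<Rightarrow> ('a::field \<Rightarrow> rat) \<Rightarrow> ('a \<Rightarrow> 'k::field) \<Rightarrow> (rat \<Rightarrow> 'a)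
     \<Rightarrow> ('a poly fract \<Rightarrow> 'c::field) \<Rightarrow> ('c \<Rightarrow> rat) \<Rightarrow> nat \<Rightarrow> 'a poly fract list set
     \<Rightarrow> 'k poly fract" where
  "diff_conductor p \<nu> red pw \<iota> v n \<chi> = (THE \<omega>. \<exists>a. best_rep p \<iota> v n a \<chi> \<and>
     \<omega> = gauss_red \<nu> red \<iota> v
           (\<iota> (to_fract [:pw (swan p \<iota> v n \<chi>):]) *
            (\<Sum>i = 1..n. (a ! (i - 1)) ^ (p ^ (n - i) - 1) * compl_deriv \<iota> v (a ! (i - 1)))))"

text \<open>
  The Cartier operator \<open>(\<Sum>\<^sub>j f\<^sub>j\<^sup>p x\<^sup>j) dx \<mapsto> f\<^bsub>p-1\<^esub> dx\<close>, again on coefficients with respect to \<open>dx\<close>.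
\<close>

definition cartier :: "nat \<Rightarrow> 'k::field poly fract \<Rightarrow> 'k poly fract" where
  "cartier p \<omega> = (THE g. \<exists>f. \<omega> = (\<Sum>j<p. f j ^ p * to_fract [:0, 1:] ^ j) \<and> g = f (p - 1))"

end

theory Submission
  imports Defs
begin

text \<open>
  Over the completion, let \<open>fil\<^sub>s W\<^sub>n\<close> be the Witt vectors of pole order at most \<open>s\<close>, a subgroup because
  the addition polynomials are isobaric. From \<open>F c = \<wp> c + c\<close> one sees that \<open>\<wp> c \<in> fil\<^sub>s\<close> forces
  \<open>c \<in> fil\<^bsub>s/p\<^esub>\<close>. As \<open>F\<^sup>n\<^sup>-\<^sup>1d\<close> is additive and kills \<open>F c\<close>, the reduction defining \<open>\<omega>\<close> does not depend
  on the best representative \<open>a\<close>.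

  Truncating \<open>a\<close> to its first \<open>i - 1\<close> components represents \<open>\<chi>\<^bsub>i-1\<^esub>\<close> with pole order at most \<open>sw(\<chi>\<^sub>i)/p\<close>,
  whence \<open>\<delta>\<^sub>i \<ge> p \<delta>\<^bsub>i-1\<^esub>\<close>. A component of maximal pole contributes \<open>u\<^sup>m\<^sup>-\<^sup>1du\<close> to \<open>\<omega>\<^sub>i\<close> for a residue \<open>u\<close>,
  where \<open>m\<close> is a power of \<open>p\<close>, and the Cartier operator replaces \<open>m\<close> by \<open>m/p\<close>, killing the exact term \<open>m = 1\<close>
  of the last component. In case of equality the truncation is best and gives \<open>\<omega>\<^bsub>i-1\<^esub>\<close>. Otherwise
  the truncation may be replaced by a best representative of \<open>\<chi>\<^bsub>i-1\<^esub>\<close> without leaving \<open>fil\<^sub>s\<close>, and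
  only the exact last term survives.
\<close>

section \<open>Integral polynomials and their evaluation\<close>

text \<open>In characteristic p the ghost map loses almost all information and p^n cannot be
  cancelled, so neither the laws of Witt addition nor the additivity of the form can be read off in
  the field itself. Both are proved over integral polynomials and carried down by evaluation. The
  addition polynomials are given only as the solution of the ghost equations, so their existence and
  uniqueness come first.

  The estimates rest on one factor p. From one length to the next every weight p^(n-i) gains a
  factor p, and F multiplies poles by the same p. Hence neighbouring Swan conductors are compared
  after division by p, and a change of representative by \<wp> c costs only a form with poles of
  order s/p, invisible after scaling by pi^s.

  The rule for the Cartier operator comes from u^(m-1) du = u^m (du/u): for a power m > 1 of p, u^m
  is a p-th power, and the logarithmic form du/u is fixed. Fixedness is multiplicative in u, and as
  k is algebraically closed it need only be checked for constants and for u = x - c.\<close>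

locale unital_hom =
  fixes h :: "'r::comm_ring_1 \<Rightarrow> 's::comm_ring_1"
  assumes hom_one: "h 1 = 1"
    and hom_add: "h (x + y) = h x + h y"
    and hom_mult: "h (x * y) = h x * h y"
begin

lemma hom_zero: "h 0 = 0"
  using hom_add[of 0 0] by simp

lemma hom_minus: "h (- x) = - h x"
  using hom_add[of x "- x"] by (simp add: hom_zero eq_neg_iff_add_eq_0 add.commute)

lemma hom_diff: "h (x - y) = h x - h y"
  using hom_add[of x "- y"] by (simp add: hom_minus)

lemma hom_of_nat: "h (of_nat k) = of_nat k"
  by (induction k) (simp_all add: hom_zero hom_add hom_one)

lemma hom_of_int: "h (of_int k) = of_int k"
  by (cases k) (simp_all add: hom_of_nat hom_minus hom_one hom_diff)

lemma hom_power: "h (x ^ k) = h x ^ k"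
  by (induction k) (simp_all add: hom_one hom_mult)

lemma hom_sum: "h (sum f A) = (\<Sum>x\<in>A. h (f x))"
  by (induction A rule: infinite_finite_induct) (simp_all add: hom_zero hom_add)

lemma hom_prod: "h (prod f A) = (\<Prod>x\<in>A. h (f x))"
  by (induction A rule: infinite_finite_induct) (simp_all add: hom_one hom_mult)

lemma hom_ghost: "h (ghost p n x) = ghost p n (h \<circ> x)"
  by (simp add: ghost_def hom_sum hom_mult hom_power hom_of_nat)

lemma hom_zpoly_eval: "h (zpoly_eval f P) = zpoly_eval (h \<circ> f) P"
  by (simp add: zpoly_eval_def hom_sum hom_prod hom_mult hom_power hom_of_int)

end

section \<open>Generators of the ring of integral polynomials, and evaluation\<close>

lemma poly_mapping_sum_singles: "P = (\<Sum>m\<in>Poly_Mapping.keys P. Poly_Mapping.single m (Poly_Mapping.lookup P m))"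
  by (rule poly_mapping_eqI)
    (auto simp: lookup_sum lookup_single when_def in_keys_iff)

lemma prod_single_one:
  "(\<Prod>i\<in>K. Poly_Mapping.single (g i) (1::int)) = Poly_Mapping.single (\<Sum>i\<in>K. g i) 1"
  by (induction K rule: infinite_finite_induct) (simp_all add: mult_single)

lemma zvar_power: "zvar i ^ k = Poly_Mapping.single (Poly_Mapping.single i k) 1"
  by (induction k) (simp_all add: zvar_def mult_single flip: single_add)

lemma single_eq_monomial:
  "Poly_Mapping.single m c = of_int c * (\<Prod>i\<in>Poly_Mapping.keys m. zvar i ^ Poly_Mapping.lookup m i)"
proof -
  have "(\<Prod>i\<in>Poly_Mapping.keys m. zvar i ^ Poly_Mapping.lookup m i) = Poly_Mapping.single m 1"
    unfolding zvar_power prod_single_one by (simp flip: poly_mapping_sum_singles)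
  moreover have "of_int c = (Poly_Mapping.single 0 c :: 'a zpoly)"
    by (metis of_int_eq_id id_apply single_of_int)
  ultimately show ?thesis by (simp add: mult_single)
qed

text \<open>Every polynomial is a finite sum of constants times products of variables. The rule
  serves for statements compatible with sums and products, such as the Frobenius congruence and the
  lifting of derivations.\<close>

lemma zpoly_induct [case_names const var add mult]:
  assumes "\<And>c. Q (of_int c)" and "\<And>i. Q (zvar i)"
    and add: "\<And>P P'. Q P \<Longrightarrow> Q P' \<Longrightarrow> Q (P + P')"
    and mult: "\<And>P P'. Q P \<Longrightarrow> Q P' \<Longrightarrow> Q (P * P')"
  shows "Q P"
proof -
  have one: "Q 1" and zero: "Q 0" using assms(1)[of 1] assms(1)[of 0] by simp_all
  have pow: "Q (P ^ k)" if "Q P" for P k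
    by (induction k) (simp_all add: one mult that)
  have pr: "Q (prod g A)" if "\<And>i. Q (g i)" for A and g :: "'a \<Rightarrow> _"
    by (induction A rule: infinite_finite_induct) (simp_all add: one mult that)
  have sm: "Q (sum g A)" if "\<And>i. Q (g i)" for A and g :: "('a \<Rightarrow>\<^sub>0 nat) \<Rightarrow> _"
    by (induction A rule: infinite_finite_induct) (simp_all add: zero add that)
  have "Q (\<Sum>m\<in>Poly_Mapping.keys P. Poly_Mapping.single m (Poly_Mapping.lookup P m))"
    unfolding single_eq_monomial by (intro sm mult pr pow assms(1,2))
  then show ?thesis by (simp flip: poly_mapping_sum_singles)
qed

lemma zpoly_eval_superset:
  assumes "finite S" "Poly_Mapping.keys P \<subseteq> S"
  shows "zpoly_eval f P = (\<Sum>m\<in>S. of_int (Poly_Mapping.lookup P m) *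
           (\<Prod>i\<in>Poly_Mapping.keys m. f i ^ Poly_Mapping.lookup m i))"
  unfolding zpoly_eval_def
  by (rule sum.mono_neutral_left) (use assms in \<open>auto simp: in_keys_iff\<close>)

lemma monomial_eval_add:
  fixes f :: "'v \<Rightarrow> 'r::comm_ring_1"
  shows "(\<Prod>i\<in>Poly_Mapping.keys (m + m'). f i ^ Poly_Mapping.lookup (m + m') i) =
    (\<Prod>i\<in>Poly_Mapping.keys m. f i ^ Poly_Mapping.lookup m i) *
    (\<Prod>i\<in>Poly_Mapping.keys m'. f i ^ Poly_Mapping.lookup m' i)"
proof -
  let ?K = "Poly_Mapping.keys m \<union> Poly_Mapping.keys m'"
  have *: "(\<Prod>i\<in>Poly_Mapping.keys k. f i ^ Poly_Mapping.lookup k i) = (\<Prod>i\<in>?K. f i ^ Poly_Mapping.lookup k i)"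
    if "Poly_Mapping.keys k \<subseteq> ?K" for k
    by (rule prod.mono_neutral_left) (use that in \<open>auto simp: in_keys_iff\<close>)
  show ?thesis
    by (subst (1 2 3) *) (auto simp: keys_add lookup_add power_add prod.distrib
        dest: subsetD[OF keys_add])
qed

lemma zpoly_eval_add: "zpoly_eval f (P + Q) = zpoly_eval f P + zpoly_eval f Q"
proof -
  let ?S = "Poly_Mapping.keys P \<union> Poly_Mapping.keys Q"
  have "Poly_Mapping.keys (P + Q) \<subseteq> ?S" by (rule keys_add)
  then show ?thesis
    by (simp add: zpoly_eval_superset[of ?S] lookup_add algebra_simps sum.distrib)
qed

lemma zpoly_eval_single:
  "zpoly_eval f (Poly_Mapping.single m c) =
     of_int c * (\<Prod>i\<in>Poly_Mapping.keys m. f i ^ Poly_Mapping.lookup m i)"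
  by (subst zpoly_eval_superset[of "{m}"]) auto

lemma zpoly_eval_zero: "zpoly_eval f 0 = 0"
  by (simp add: zpoly_eval_def)

lemma zpoly_eval_sum: "zpoly_eval f (sum g A) = (\<Sum>x\<in>A. zpoly_eval f (g x))"
  by (induction A rule: infinite_finite_induct) (simp_all add: zpoly_eval_add zpoly_eval_zero)

lemma zpoly_eval_mult: "zpoly_eval f (P * Q) = zpoly_eval f P * zpoly_eval f Q"
proof -
  have "zpoly_eval f (P * Q) = zpoly_eval f
     (\<Sum>m\<in>Poly_Mapping.keys P. \<Sum>m'\<in>Poly_Mapping.keys Q.
        Poly_Mapping.single (m + m') (Poly_Mapping.lookup P m * Poly_Mapping.lookup Q m'))"
    by (subst (1) poly_mapping_sum_singles[of P], subst (1) poly_mapping_sum_singles[of Q])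
      (simp add: sum_product mult_single)
  also have "\<dots> = zpoly_eval f P * zpoly_eval f Q"
    unfolding zpoly_eval_sum zpoly_eval_single monomial_eval_add
    by (simp add: zpoly_eval_def sum_product mult_ac)
  finally show ?thesis .
qed

lemma zpoly_eval_var: "zpoly_eval f (zvar i) = f i"
  by (simp add: zvar_def zpoly_eval_single)

lemma zpoly_eval_one: "zpoly_eval f 1 = 1"
  using zpoly_eval_single[of f 0 1] by simp

interpretation zpoly_eval: unital_hom "zpoly_eval f"
  by standard (simp_all add: zpoly_eval_one zpoly_eval_add zpoly_eval_mult)

lemma zpoly_eval_zvar: "zpoly_eval zvar P = P"
  by (induction P rule: zpoly_induct)
    (simp_all add: zpoly_eval_var zpoly_eval_add zpoly_eval_mult zpoly_eval.hom_of_int)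

lemma lookup_of_nat_mult:
  "Poly_Mapping.lookup (of_nat k * P) m = int k * Poly_Mapping.lookup (P :: 'v zpoly) m"
  by (induction k) (simp_all add: lookup_add algebra_simps)

text \<open>The coefficients are torsion-free. This permits division by p^n after comparing ghost
  components, which is impossible in characteristic p.\<close>

lemma of_nat_zpoly_cancel:
  fixes P :: "'v zpoly"
  assumes "of_nat k * P = of_nat k * Q" "k > 0"
  shows "P = Q"
proof (rule poly_mapping_eqI)
  show "Poly_Mapping.lookup P m = Poly_Mapping.lookup Q m" for m
    using assms lookup_of_nat_mult[of k P m] lookup_of_nat_mult[of k Q m] by simp
qed

text \<open>
  The derivation of the polynomial ring with prescribed values \<open>d\<close> on the variables is the
  coefficient of \<open>\<epsilon>\<close> in \<open>P(X + \<epsilon> d)\<close>, which makes the Leibniz rule automatic.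
\<close>

definition zpoly_deriv :: "('v \<Rightarrow> 'v zpoly) \<Rightarrow> 'v zpoly \<Rightarrow> 'v zpoly" where
  "zpoly_deriv d P = poly.coeff (zpoly_eval (\<lambda>i. [:zvar i, d i:]) P) 1"

locale derivation =
  fixes D :: "'r::comm_ring_1 \<Rightarrow> 'r"
  assumes deriv_add: "D (x + y) = D x + D y"
    and deriv_mult: "D (x * y) = x * D y + D x * y"
begin

lemma deriv_zero: "D 0 = 0"
  using deriv_add[of 0 0] by simp

lemma deriv_one: "D 1 = 0"
  using deriv_mult[of 1 1] by simp

lemma deriv_minus: "D (- x) = - D x"
  using deriv_add[of x "- x"] by (simp add: deriv_zero eq_neg_iff_add_eq_0 add.commute)

lemma deriv_diff: "D (x - y) = D x - D y"
  using deriv_add[of x "- y"] by (simp add: deriv_minus)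

lemma deriv_of_nat: "D (of_nat k) = 0"
  by (induction k) (simp_all add: deriv_zero deriv_one deriv_add)

lemma deriv_of_int: "D (of_int k) = 0"
  by (cases k) (simp_all add: deriv_of_nat deriv_minus deriv_one deriv_diff)

lemma deriv_power: "D (x ^ k) = of_nat k * x ^ (k - 1) * D x"
proof (induction k)
  case (Suc k)
  then show ?case by (cases k) (simp_all add: deriv_mult algebra_simps deriv_one)
qed (simp add: deriv_one)

lemma deriv_sum: "D (sum f A) = (\<Sum>x\<in>A. D (f x))"
  by (induction A rule: infinite_finite_induct) (simp_all add: deriv_zero deriv_add)

lemma deriv_of_nat_mult: "D (of_nat k * x) = of_nat k * D x"
  by (simp add: deriv_mult deriv_of_nat)

end

lemma derivation_zpoly_deriv: "derivation (zpoly_deriv d)"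
proof
  fix P Q
  show "zpoly_deriv d (P + Q) = zpoly_deriv d P + zpoly_deriv d Q"
    by (simp add: zpoly_deriv_def zpoly_eval_add)
  \<comment> \<open>Setting \<epsilon> = 0 is a ring homomorphism, so the constant coefficient of
    P(X + \<epsilon> d) is P. Coefficient 1 of a product involves only coefficients 0 and 1 of the
    factors.\<close>
  have h: "unital_hom (\<lambda>q. poly.coeff q 0)" by standard (simp_all add: coeff_mult)
  have 0: "poly.coeff (zpoly_eval (\<lambda>i. [:zvar i, d i:]) P) 0 = P" for P
    using unital_hom.hom_zpoly_eval[OF h, of "\<lambda>i. [:zvar i, d i:]" P]
    by (simp add: o_def zpoly_eval_zvar)
  show "zpoly_deriv d (P * Q) = P * zpoly_deriv d Q + zpoly_deriv d P * Q"
    by (simp add: zpoly_deriv_def zpoly_eval_mult coeff_mult 0)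
qed

lemma zpoly_deriv_var: "zpoly_deriv d (zvar i) = d i"
  by (simp add: zpoly_deriv_def zpoly_eval_var)

text \<open>
  Every ring is the quotient of \<open>\<int>[X\<^sub>r | r \<in> R]\<close>, and a derivation of \<open>R\<close> lifts to it.
  Identities between Witt vectors are proved there, where the ghost map is injective.
\<close>

lemma zpoly_eval_deriv:
  assumes "derivation D"
  shows "zpoly_eval (\<lambda>r. r) (zpoly_deriv (\<lambda>r. zvar (D r)) P) = D (zpoly_eval (\<lambda>r. r) P)"
proof -
  interpret D: derivation D by fact
  interpret D': derivation "zpoly_deriv (\<lambda>r. zvar (D r))" by (rule derivation_zpoly_deriv)
  show ?thesis
    by (induction P rule: zpoly_induct)
      (simp_all add: zpoly_eval_add zpoly_eval_mult zpoly_eval_var zpoly_deriv_var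
        D'.deriv_of_int D.deriv_of_int zpoly_eval.hom_of_int D'.deriv_add D.deriv_add D'.deriv_mult
        D.deriv_mult zpoly_eval_zero)
qed

section \<open>Dwork's lemma and the Witt addition polynomials\<close>

text \<open>Addition of infinite sequences keeps length conditions out of the identities.
  \<open>witt_add_wlist\<close> cuts it down to lists, which is sound because component i of a sum
  depends only on components up to i.\<close>

definition wadd :: "nat \<Rightarrow> (nat \<Rightarrow> 'r::comm_ring_1) \<Rightarrow> (nat \<Rightarrow> 'r) \<Rightarrow> nat \<Rightarrow> 'r" where
  "wadd p x y i = zpoly_eval (case_sum x y) (witt_sum_poly p i)"

text \<open>The grading that gives both i-th variables weight p^i. It makes the n-th ghost component
  homogeneous of weight p^n.\<close>

definition witt_weight :: "nat \<Rightarrow> (nat + nat \<Rightarrow>\<^sub>0 nat) \<Rightarrow> nat" where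
  "witt_weight p m = (\<Sum>i\<in>Poly_Mapping.keys m. Poly_Mapping.lookup m i * p ^ case_sum id id i)"

definition isobaric :: "nat \<Rightarrow> nat \<Rightarrow> (nat + nat) zpoly \<Rightarrow> bool" where
  "isobaric p d P \<longleftrightarrow> (\<forall>m\<in>Poly_Mapping.keys P. witt_weight p m = d)"

lemma witt_weight_add: "witt_weight p (m + m') = witt_weight p m + witt_weight p m'"
proof -
  let ?K = "Poly_Mapping.keys m \<union> Poly_Mapping.keys m'"
  have *: "witt_weight p k = (\<Sum>i\<in>?K. Poly_Mapping.lookup k i * p ^ case_sum id id i)"
    if "Poly_Mapping.keys k \<subseteq> ?K" for k
    unfolding witt_weight_def
    by (rule sum.mono_neutral_left) (use that in \<open>auto simp: in_keys_iff\<close>)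
  show ?thesis
    by (subst (1 2 3) *) (auto simp: lookup_add algebra_simps sum.distrib dest: subsetD[OF keys_add])
qed

lemma isobaric_add: "isobaric p d P \<Longrightarrow> isobaric p d Q \<Longrightarrow> isobaric p d (P + Q)"
  unfolding isobaric_def using keys_add[of P Q] by blast

lemma isobaric_diff: "isobaric p d P \<Longrightarrow> isobaric p d Q \<Longrightarrow> isobaric p d (P - Q)"
  unfolding isobaric_def using keys_diff[of P Q] by blast

lemma isobaric_mult: "isobaric p d P \<Longrightarrow> isobaric p e Q \<Longrightarrow> isobaric p (d + e) (P * Q)"
  unfolding isobaric_def using keys_mult[of P Q] by (fastforce simp: witt_weight_add)

lemma isobaric_of_nat: "isobaric p 0 (of_nat k)"
  by (auto simp: isobaric_def witt_weight_def simp flip: single_of_nat split: if_splits)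

lemma isobaric_power: "isobaric p d P \<Longrightarrow> isobaric p (d * k) (P ^ k)"
proof (induction k)
  case 0
  then show ?case using isobaric_of_nat[of p 1] by simp
qed (simp add: isobaric_mult)

lemma isobaric_zero: "isobaric p d 0"
  by (simp add: isobaric_def)

lemma isobaric_sum: "(\<And>i. i \<in> A \<Longrightarrow> isobaric p d (g i)) \<Longrightarrow> isobaric p d (sum g A)"
  by (induction A rule: infinite_finite_induct) (simp_all add: isobaric_zero isobaric_add)

lemma isobaric_var: "isobaric p (p ^ case_sum id id i) (zvar i)"
  by (simp add: isobaric_def zvar_def witt_weight_def)

lemma isobaric_of_nat_mult:
  assumes "isobaric p d (of_nat k * P)" "k > 0" shows "isobaric p d P"
  using assms by (auto simp: isobaric_def in_keys_iff lookup_of_nat_mult)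

lemma ghost_split: "ghost p n x = (\<Sum>i<n. of_nat p ^ i * x i ^ (p ^ (n - i))) + of_nat p ^ n * x n"
  by (simp add: ghost_def flip: lessThan_Suc_atMost)

text \<open>Since p^(n+1-i) = p * p^(n-i), one p-th power can be moved onto the entries. Dwork's
  congruence condition is modelled on this recursion.\<close>

lemma ghost_Suc_lower:
  "(\<Sum>i<Suc n. of_nat p ^ i * x i ^ (p ^ (Suc n - i))) = ghost p n (\<lambda>i. x i ^ p)"
proof -
  have "(\<Sum>i<Suc n. of_nat p ^ i * x i ^ (p ^ (Suc n - i))) =
        (\<Sum>i<Suc n. of_nat p ^ i * (x i ^ p) ^ (p ^ (n - i)))"
    by (intro sum.cong refl) (simp add: Suc_diff_le flip: power_mult)
  then show ?thesis by (simp add: ghost_def flip: lessThan_Suc_atMost)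
qed

lemma ghost_Suc: "ghost p (Suc n) x = ghost p n (\<lambda>i. x i ^ p) + of_nat p ^ Suc n * x (Suc n)"
  unfolding ghost_split[of p "Suc n"] ghost_Suc_lower ..

lemma ghost_isobaric:
  assumes "\<And>i. i \<le> n \<Longrightarrow> isobaric p (p ^ i) (x i)" shows "isobaric p (p ^ n) (ghost p n x)"
  unfolding ghost_def
proof (intro isobaric_sum)
  fix i assume "i \<in> {..n}"
  then have "p ^ n = 0 + p ^ i * p ^ (n - i)" by (simp flip: power_add)
  then show "isobaric p (p ^ n) (of_nat p ^ i * x i ^ (p ^ (n - i)))"
    using isobaric_mult[OF isobaric_of_nat[of p "p ^ i"] isobaric_power[OF assms, of i "p ^ (n - i)"]] \<open>i \<in> {..n}\<close>
    by simp
qed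

section \<open>Congruences modulo powers of p, and Dwork's lemma\<close>

locale witt_prime =
  fixes p :: nat
  assumes prime_p: "Factorial_Ring.prime p"
begin

lemma p_pos: "0 < p" and p_gt_1: "1 < p"
  using prime_p by (simp_all add: prime_gt_0_nat prime_gt_Suc_0_nat)

text \<open>In x^p - y^p = (x - y) * sum, the sum has p terms, each congruent to y^(p-1) modulo p
  because k >= 1 gives x = y modulo p. So it contributes one more factor p.\<close>

lemma dvd_diff_power_p:
  fixes x y :: "'r::comm_ring_1"
  assumes "of_nat p ^ k dvd x - y" "k \<ge> 1"
  shows "of_nat p ^ Suc k dvd x ^ p - y ^ p"
proof -
  have "of_nat p dvd x - y" using assms
    by (intro dvd_trans[OF dvd_power[of k "of_nat p"] assms(1)]) simp
  then obtain z where z: "x = y + of_nat p * z" by (auto simp: dvd_def algebra_simps)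
  have pw: "of_nat p dvd x ^ i - y ^ i" for i
    by (subst power_diff_sumr2, intro dvd_mult2) (simp add: z)
  have "of_nat p dvd (\<Sum>i<p. y ^ (p - Suc i) * x ^ i)"
  proof -
    have "(\<Sum>i<p. y ^ (p - Suc i) * x ^ i) =
      (\<Sum>i<p. y ^ (p - Suc i) * (x ^ i - y ^ i)) + (\<Sum>i<p. y ^ (p - Suc i) * y ^ i)"
      by (simp add: algebra_simps flip: sum.distrib)
    also have "(\<Sum>i<p. y ^ (p - Suc i) * y ^ i) = of_nat p * y ^ (p - 1)"
      by (simp flip: power_add)
    finally show ?thesis by (simp only: dvd_add[OF dvd_sum[OF dvd_mult[OF pw]] dvd_triv_left])
  qed
  then have "of_nat p ^ k * of_nat p dvd (x - y) * (\<Sum>i<p. y ^ (p - Suc i) * x ^ i)"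
    using assms(1) by (rule mult_dvd_mono[rotated])
  then show ?thesis by (simp add: power_diff_sumr2[of x p y] mult.commute)
qed

lemma dvd_diff_power_p_power:
  fixes x y :: "'r::comm_ring_1"
  assumes "of_nat p dvd x - y"
  shows "of_nat p ^ Suc k dvd x ^ (p ^ k) - y ^ (p ^ k)"
proof (induction k)
  case (Suc k)
  from dvd_diff_power_p[OF this] show ?case
    by (simp add: mult.commute flip: power_mult)
qed (use assms in simp)

text \<open>Taking p^(n-i)-th powers lifts a congruence modulo p to one modulo p^(n-i+1), and the
  coefficient p^i supplies the rest of p^(n+1).\<close>

lemma ghost_cong_mod:
  fixes x y :: "nat \<Rightarrow> 'r::comm_ring_1"
  assumes "\<And>i. i \<le> n \<Longrightarrow> of_nat p dvd x i - y i"
  shows "of_nat p ^ Suc n dvd ghost p n x - ghost p n y"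
proof -
  have "ghost p n x - ghost p n y =
      (\<Sum>i\<le>n. of_nat p ^ i * (x i ^ (p ^ (n - i)) - y i ^ (p ^ (n - i))))"
    by (simp add: ghost_def algebra_simps sum_subtractf)
  also have "of_nat p ^ Suc n dvd \<dots>"
  proof (intro dvd_sum)
    fix i assume i: "i \<in> {..n}"
    then have "of_nat p ^ i * of_nat p ^ Suc (n - i) dvd
        of_nat p ^ i * (x i ^ (p ^ (n - i)) - y i ^ (p ^ (n - i)))"
      by (intro mult_dvd_mono dvd_refl dvd_diff_power_p_power assms) auto
    moreover have "(of_nat p :: 'r) ^ i * of_nat p ^ Suc (n - i) = of_nat p ^ Suc n"
      unfolding power_add[symmetric] using i by simp
    ultimately show "of_nat p ^ Suc n dvd of_nat p ^ i * (x i ^ (p ^ (n - i)) - y i ^ (p ^ (n - i)))"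
      by simp
  qed
  finally show ?thesis .
qed

lemma dvd_add_power_p: "(of_nat p :: 'r::comm_ring_1) dvd (x + y) ^ p - x ^ p - y ^ p"
proof -
  have "{..p} = insert 0 (insert p {1..<p})" using p_pos by auto
  then have "(x + y) ^ p - x ^ p - y ^ p = (\<Sum>k\<in>{1..<p}. of_nat (p choose k) * x ^ k * y ^ (p - k))"
    using p_pos by (simp add: binomial_ring)
  also have "of_nat p dvd \<dots>"
  proof (intro dvd_sum)
    fix k assume "k \<in> {1..<p}"
    then have "p dvd p choose k" by (intro dvd_choose_prime prime_p) auto
    then have "(of_nat p :: 'r) dvd of_nat (p choose k)" by (metis dvd_def of_nat_mult)
    then show "of_nat p dvd of_nat (p choose k) * x ^ k * y ^ (p - k)" by simp
  qed
  finally show ?thesis .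
qed

text \<open>The lift of Frobenius to characteristic 0 on which Dwork's lemma depends.\<close>

abbreviation zpoly_frob :: "'v zpoly \<Rightarrow> 'v zpoly" where
  "zpoly_frob \<equiv> zpoly_eval (\<lambda>i. zvar i ^ p)"

lemma zpoly_frob_cong: "of_nat p dvd zpoly_frob P - P ^ p"
proof (induction P rule: zpoly_induct)
  case (const c)
  have add: "of_nat p dvd (a + b) - (a + b) ^ p" if "of_nat p dvd a - a ^ p" "of_nat p dvd b - b ^ p"
    for a b :: "'a zpoly"
  proof -
    have "(a + b) - (a + b) ^ p = (a - a ^ p) + (b - b ^ p) - ((a + b) ^ p - a ^ p - b ^ p)"
      by simp
    then show ?thesis using that dvd_add_power_p[of a b] by (metis dvd_add dvd_diff)
  qed
  have nat: "of_nat p dvd (of_nat k :: 'a zpoly) - of_nat k ^ p" for k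
    by (induction k) (use p_pos add[of 1] in \<open>simp_all add: power_0_left\<close>)
  have "of_nat p dvd (of_int c :: 'a zpoly) - of_int c ^ p"
  proof (cases c)
    case (neg k)
    define a :: "'a zpoly" where "a = of_nat (Suc k)"
    have 1: "of_int c = - a" unfolding a_def neg by simp
    \<comment> \<open>Expanding (a + (-a))^p = 0 modulo p gives this without separating p = 2 from
      odd p.\<close>
    have "of_nat p dvd a ^ p + (- a) ^ p"
      using dvd_add_power_p[of a "- a"] p_pos dvd_minus_iff[of "of_nat p" "a ^ p + (- a) ^ p"]
      by (simp add: power_0_left)
    moreover have "- a - (- a) ^ p = - (a - a ^ p) - (a ^ p + (- a) ^ p)" by simp
    ultimately show ?thesis using nat[of "Suc k"] unfolding 1 a_def by (metis dvd_diff dvd_minus_iff)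
  qed (simp add: nat)
  then show ?case by (simp add: zpoly_eval.hom_of_int)
next
  case (add P P')
  have "zpoly_frob (P + P') - (P + P') ^ p =
     (zpoly_frob P - P ^ p) + (zpoly_frob P' - P' ^ p) - ((P + P') ^ p - P ^ p - P' ^ p)"
    by (simp add: zpoly_eval_add)
  then show ?case using add dvd_add_power_p[of P P'] by (metis dvd_add dvd_diff)
next
  case (mult P P')
  have "zpoly_frob (P * P') - (P * P') ^ p =
     (zpoly_frob P - P ^ p) * zpoly_frob P' + P ^ p * (zpoly_frob P' - P' ^ p)"
    by (simp add: zpoly_eval_mult algebra_simps)
  then show ?case using mult by simp
qed (simp add: zpoly_eval_var)

text \<open>Dwork's lemma, solved one component at a time. For n = m + 1 the terms already fixed add
  up to the m-th ghost component of the p-th powers of f, congruent modulo p^n to that of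
  \<open>zpoly_frob\<close> of f, which is \<open>zpoly_frob (w m)\<close>. By hypothesis
  \<open>w n\<close> is congruent to it too, so what remains is divisible by p^n.\<close>

lemma ghost_surj:
  fixes w :: "nat \<Rightarrow> 'v zpoly"
  assumes "\<And>n. of_nat p ^ Suc n dvd w (Suc n) - zpoly_frob (w n)"
  shows "\<exists>S. \<forall>n. ghost p n S = w n"
proof -
  have "\<exists>S. \<forall>n. (\<Sum>i<n. of_nat p ^ i * S i ^ (p ^ (n - i))) + of_nat p ^ n * S n = w n"
  proof (rule dependent_wellorder_choice)
    fix n and f :: "nat \<Rightarrow> 'v zpoly"
    assume *: "\<And>m. m < n \<Longrightarrow>
        (\<Sum>i<m. of_nat p ^ i * f i ^ (p ^ (m - i))) + of_nat p ^ m * f m = w m"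
    show "\<exists>r. (\<Sum>i<n. of_nat p ^ i * f i ^ (p ^ (n - i))) + of_nat p ^ n * r = w n"
    proof (cases n)
      case (Suc m)
      have "ghost p m f = w m" using *[of m] by (simp add: Suc ghost_split)
      then have "zpoly_frob (w m) = ghost p m (zpoly_frob \<circ> f)" by (simp flip: zpoly_eval.hom_ghost)
      moreover have "of_nat p ^ Suc m dvd ghost p m (zpoly_frob \<circ> f) - ghost p m (\<lambda>i. f i ^ p)"
        by (intro ghost_cong_mod) (simp add: zpoly_frob_cong)
      ultimately have "of_nat p ^ Suc m dvd
          (w (Suc m) - zpoly_frob (w m)) + (ghost p m (zpoly_frob \<circ> f) - ghost p m (\<lambda>i. f i ^ p))"
        using assms[of m] by (intro dvd_add) auto
      then obtain r where r: "w n - ghost p m (\<lambda>i. f i ^ p) = of_nat p ^ n * r"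
        using \<open>zpoly_frob (w m) = _\<close> by (auto simp: Suc dvd_def)
      have "(\<Sum>i<n. of_nat p ^ i * f i ^ (p ^ (n - i))) = ghost p m (\<lambda>i. f i ^ p)"
        unfolding Suc by (rule ghost_Suc_lower)
      with r show ?thesis by (auto simp: algebra_simps)
    qed auto
  qed simp
  then show ?thesis by (simp add: ghost_split)
qed

lemma ghost_inj:
  fixes x y :: "nat \<Rightarrow> 'v zpoly"
  assumes "\<And>n. n < N \<Longrightarrow> ghost p n x = ghost p n y" "i < N"
  shows "x i = y i"
  using assms(2)
proof (induction i rule: less_induct)
  case (less i)
  have "(\<Sum>j<i. of_nat p ^ j * x j ^ (p ^ (i - j))) = (\<Sum>j<i. of_nat p ^ j * y j ^ (p ^ (i - j)))"
    by (intro sum.cong refl) (use less in auto)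
  with assms(1)[OF less.prems] have "of_nat (p ^ i) * x i = of_nat (p ^ i) * y i"
    by (simp add: ghost_split)
  then show ?case by (rule of_nat_zpoly_cancel) (use p_pos in simp)
qed

lemma ghost_eqI:
  fixes x y :: "nat \<Rightarrow> 'v zpoly"
  assumes "\<And>n. ghost p n x = ghost p n y" shows "x = y"
  using ghost_inj[of "Suc _" x y] assms by (intro ext) blast

text \<open>Converse of \<open>ghost_cong_mod\<close>. By induction the lower terms already agree
  modulo p^(i+1), which leaves p^i (x_i - y_i) divisible by p^(i+1). It will give p = VF modulo
  p.\<close>

lemma ghost_cong_modD:
  fixes x y :: "nat \<Rightarrow> 'v zpoly"
  assumes "\<And>n. of_nat p ^ Suc n dvd ghost p n x - ghost p n y"
  shows "of_nat p dvd x i - y i"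
proof (induction i rule: less_induct)
  case (less i)
  let ?s = "\<lambda>x. \<Sum>j<i. of_nat p ^ j * x j ^ (p ^ (i - j))"
  have "of_nat p ^ Suc i dvd ?s x - ?s y"
  proof (cases i)
    case (Suc k)
    have "?s x = ghost p k (\<lambda>i. x i ^ p)" for x :: "nat \<Rightarrow> 'v zpoly"
      unfolding Suc by (rule ghost_Suc_lower)
    have "?s x - ?s y = (\<Sum>j<i. of_nat p ^ j * (x j ^ (p ^ (i - j)) - y j ^ (p ^ (i - j))))"
      by (simp add: algebra_simps sum_subtractf)
    also have "of_nat p ^ Suc i dvd \<dots>"
    proof (intro dvd_sum)
      fix j assume j: "j \<in> {..<i}"
      then have "of_nat p ^ j * of_nat p ^ Suc (i - j) dvd
          of_nat p ^ j * (x j ^ (p ^ (i - j)) - y j ^ (p ^ (i - j)))"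
        by (intro mult_dvd_mono dvd_refl dvd_diff_power_p_power less) auto
      moreover have "(of_nat p :: 'v zpoly) ^ j * of_nat p ^ Suc (i - j) = of_nat p ^ Suc i"
        unfolding power_add[symmetric] using j by simp
      ultimately show "of_nat p ^ Suc i dvd of_nat p ^ j * (x j ^ (p ^ (i - j)) - y j ^ (p ^ (i - j)))"
        by simp
    qed
    finally show ?thesis .
  qed simp
  moreover have "ghost p i x - ghost p i y = (?s x - ?s y) + of_nat p ^ i * (x i - y i)"
    by (simp add: ghost_split algebra_simps)
  ultimately have "of_nat p ^ Suc i dvd of_nat p ^ i * (x i - y i)"
    using assms[of i] dvd_add_right_iff[of "of_nat p ^ Suc i" "?s x - ?s y"] by (simp del: power_Suc)
  then obtain z where "of_nat p ^ i * (x i - y i) = of_nat p ^ Suc i * z" by (auto simp: dvd_def)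
  then have "of_nat (p ^ i) * (x i - y i) = of_nat (p ^ i) * (of_nat p * z)"
    by (simp add: mult_ac)
  then have "x i - y i = of_nat p * z" by (rule of_nat_zpoly_cancel) (use p_pos in simp)
  then show ?case by simp
qed

text \<open>\<open>zpoly_frob\<close> raises the variables to p-th powers, so by the ghost recursion
  the difference in Dwork's condition is p^(n+1) times a sum of two variables. Injectivity of the
  ghost map settles the definite description.\<close>

lemma ghost_witt_sum_poly:
  "ghost p n (witt_sum_poly p) = ghost p n (\<lambda>i. zvar (Inl i)) + ghost p n (\<lambda>i. zvar (Inr i))"
proof -
  let ?w = "\<lambda>n. ghost p n (\<lambda>i. zvar (Inl i)) + ghost p n (\<lambda>i. zvar (Inr i)) :: (nat + nat) zpoly"
  have "of_nat p ^ Suc n dvd ?w (Suc n) - zpoly_frob (?w n)" for n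
    by (simp add: ghost_Suc zpoly_eval_add zpoly_eval.hom_ghost o_def zpoly_eval_var)
  then obtain S where S: "\<forall>n. ghost p n S = ?w n" using ghost_surj[of ?w] by blast
  show ?thesis
    unfolding witt_sum_poly_def by (rule theI2[where a = S, THEN spec]) (use S in \<open>auto intro!: ghost_eqI\<close>)
qed

text \<open>p^n S_n is a combination of polynomials of weight p^n, because S_i has weight p^i and
  enters to the power p^(n-i). The factor p^n does not change the support.\<close>

lemma isobaric_witt_sum_poly: "isobaric p (p ^ n) (witt_sum_poly p n)"
proof (induction n rule: less_induct)
  case (less n)
  have "of_nat (p ^ n) * witt_sum_poly p n = ghost p n (\<lambda>i. zvar (Inl i)) + ghost p n (\<lambda>i. zvar (Inr i)) -
      (\<Sum>i<n. of_nat p ^ i * witt_sum_poly p i ^ (p ^ (n - i)))"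
    unfolding ghost_witt_sum_poly[symmetric] by (simp add: ghost_split)
  also have "isobaric p (p ^ n) \<dots>"
  proof (intro isobaric_diff isobaric_add ghost_isobaric isobaric_sum)
    fix i assume i: "i \<in> {..<n}"
    then have "p ^ n = 0 + p ^ i * p ^ (n - i)" by (simp flip: power_add)
    then show "isobaric p (p ^ n) (of_nat p ^ i * witt_sum_poly p i ^ (p ^ (n - i)))"
      using isobaric_mult[OF isobaric_of_nat[of p "p ^ i"] isobaric_power[OF less, of i "p ^ (n - i)"]] i
      by simp
  qed (use isobaric_var[of p "Inl _"] isobaric_var[of p "Inr _"] in simp_all)
  finally show ?case by (rule isobaric_of_nat_mult) (use p_pos in simp)
qed

lemma ghost_wadd: "ghost p n (wadd p x y) = ghost p n x + ghost p n y"
proof -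
  have 1: "wadd p x y = zpoly_eval (case_sum x y) \<circ> witt_sum_poly p"
    by (auto simp: wadd_def)
  have "x = zpoly_eval (case_sum x y) \<circ> (\<lambda>i. zvar (Inl i))"
    "y = zpoly_eval (case_sum x y) \<circ> (\<lambda>i. zvar (Inr i))"
    by (auto simp: zpoly_eval_var)
  then show ?thesis
    unfolding 1 zpoly_eval.hom_ghost[symmetric] ghost_witt_sum_poly zpoly_eval_add
    by (simp add: zpoly_eval.hom_ghost)
qed

text \<open>A variable of index above n would alone exceed the total weight p^n. This is what makes
  truncation compatible with addition.\<close>

lemma witt_sum_poly_index:
  assumes "m \<in> Poly_Mapping.keys (witt_sum_poly p n)" "i \<in> Poly_Mapping.keys m"
  shows "case_sum id id i \<le> n"
proof -
  have "p ^ case_sum id id i \<le> Poly_Mapping.lookup m i * p ^ case_sum id id i"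
    using assms(2) by (simp add: in_keys_iff)
  also have "\<dots> \<le> witt_weight p m"
    unfolding witt_weight_def by (rule member_le_sum) (use assms in auto)
  also have "\<dots> = p ^ n" using isobaric_witt_sum_poly[of n] assms by (simp add: isobaric_def)
  finally show ?thesis using p_gt_1 by (meson power_le_imp_le_exp)
qed

lemma wadd_cong:
  assumes "\<And>j. j \<le> i \<Longrightarrow> x j = x' j" "\<And>j. j \<le> i \<Longrightarrow> y j = y' j"
  shows "wadd p x y i = wadd p x' y' i"
proof -
  have "case_sum x y k = case_sum x' y' k" if "case_sum id id k \<le> i" for k
    using that assms by (cases k) auto
  then show ?thesis
    unfolding wadd_def zpoly_eval_def
    by (intro sum.cong prod.cong refl arg_cong2[where f = "(*)"] arg_cong2[where f = "(^)"])
      (use witt_sum_poly_index in blast)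
qed

end

lemma (in unital_hom) hom_wadd: "h (wadd p x y i) = wadd p (h \<circ> x) (h \<circ> y) i"
proof -
  have "h \<circ> case_sum x y = case_sum (h \<circ> x) (h \<circ> y)" by (rule ext) (simp split: sum.split)
  then show ?thesis by (simp add: wadd_def hom_zpoly_eval)
qed

section \<open>Witt vectors\<close>

text \<open>The Verschiebung V.\<close>

definition wshift :: "(nat \<Rightarrow> 'r::comm_ring_1) \<Rightarrow> nat \<Rightarrow> 'r" where
  "wshift x i = (if i = 0 then 0 else x (i - 1))"

primrec wmul :: "nat \<Rightarrow> nat \<Rightarrow> (nat \<Rightarrow> 'r::comm_ring_1) \<Rightarrow> nat \<Rightarrow> 'r" where
  "wmul p 0 x = (\<lambda>i. 0)"
| "wmul p (Suc k) x = wadd p (wmul p k x) x"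

text \<open>The coefficient of \<open>F\<^sup>n d x\<close>; its \<open>p\<^sup>n\<close>-fold is \<open>D\<close> of
  the \<open>n\<close>-th ghost component, hence it is additive on Witt vectors.\<close>

definition wtheta :: "nat \<Rightarrow> ('r \<Rightarrow> 'r) \<Rightarrow> nat \<Rightarrow> (nat \<Rightarrow> 'r::comm_ring_1) \<Rightarrow> 'r" where
  "wtheta p D n x = (\<Sum>i\<le>n. x i ^ (p ^ (n - i) - 1) * D (x i))"

definition wlist :: "nat \<Rightarrow> (nat \<Rightarrow> 'r) \<Rightarrow> 'r list" where
  "wlist n x = map x [0..<n]"

lemma (in unital_hom) hom_comp_wadd: "h \<circ> wadd p x y = wadd p (h \<circ> x) (h \<circ> y)"
  by (simp add: fun_eq_iff hom_wadd)

lemma (in unital_hom) hom_comp_zero: "h \<circ> (\<lambda>i. 0) = (\<lambda>i. 0)"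
  by (simp add: fun_eq_iff hom_zero)

lemma (in unital_hom) hom_comp_wmul: "h \<circ> wmul p k x = wmul p k (h \<circ> x)"
  by (induction k) (simp_all only: wmul.simps hom_comp_wadd hom_comp_zero)

lemma (in unital_hom) hom_comp_wshift: "h \<circ> wshift x = wshift (h \<circ> x)"
  by (simp add: fun_eq_iff wshift_def hom_zero)

lemma zpoly_lift: "zpoly_eval (\<lambda>r. r) \<circ> (\<lambda>i. zvar (x i)) = x"
  by (simp add: fun_eq_iff zpoly_eval_var)

lemma length_wlist [simp]: "length (wlist n x) = n"
  by (simp add: wlist_def)

lemma nth_wlist [simp]: "i < n \<Longrightarrow> wlist n x ! i = x i"
  by (simp add: wlist_def)

lemma wlist_nth: "length a = n \<Longrightarrow> wlist n ((!) a) = a"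
  using map_nth[of a] by (simp add: wlist_def)

lemma wlist_eq_iff: "wlist n x = wlist n y \<longleftrightarrow> (\<forall>i<n. x i = y i)"
  by (auto simp: wlist_def)

lemma ghost_zero: "p > 0 \<Longrightarrow> ghost p n (\<lambda>i. 0) = 0"
  by (simp add: ghost_def power_0_left)

context witt_prime
begin

lemma wadd_assoc: "wadd p (wadd p x y) z = wadd p x (wadd p y z)"
proof -
  have *: "wadd p (wadd p x y) z = wadd p x (wadd p y z)" for x y z :: "nat \<Rightarrow> 'v zpoly"
    by (rule ghost_eqI) (simp add: ghost_wadd)
  have "zpoly_eval (\<lambda>r. r) \<circ> wadd p (wadd p (\<lambda>i. zvar (x i)) (\<lambda>i. zvar (y i))) (\<lambda>i. zvar (z i)) =
    zpoly_eval (\<lambda>r. r) \<circ> wadd p (\<lambda>i. zvar (x i)) (wadd p (\<lambda>i. zvar (y i)) (\<lambda>i. zvar (z i)))"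
    unfolding * ..
  then show ?thesis unfolding zpoly_eval.hom_comp_wadd zpoly_lift .
qed

lemma wadd_commute: "wadd p x y = wadd p y x"
proof -
  have *: "wadd p x y = wadd p y x" for x y :: "nat \<Rightarrow> 'v zpoly"
    by (rule ghost_eqI) (simp add: ghost_wadd)
  have "zpoly_eval (\<lambda>r. r) \<circ> wadd p (\<lambda>i. zvar (x i)) (\<lambda>i. zvar (y i)) =
    zpoly_eval (\<lambda>r. r) \<circ> wadd p (\<lambda>i. zvar (y i)) (\<lambda>i. zvar (x i))"
    by (subst *) (rule refl)
  then show ?thesis unfolding zpoly_eval.hom_comp_wadd zpoly_lift .
qed

text \<open>In every ghost component (x_i + y_i)^k = x_i^k + y_i^k for k >= 1, as one of the two
  entries vanishes.\<close>

lemma wadd_disjoint: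
  assumes "\<And>i. x i = 0 \<or> y i = 0"
  shows "wadd p x y = (\<lambda>i. x i + y i)"
proof -
  \<comment> \<open>The variable attached to the element 0 is a nonzero polynomial. Sending 0 to 0
    instead keeps the supports disjoint after lifting.\<close>
  let ?l = "\<lambda>r. if r = 0 then 0 else zvar r"
  let ?X = "\<lambda>i. ?l (x i)" and ?Y = "\<lambda>i. ?l (y i)"
  have l: "zpoly_eval (\<lambda>r. r) \<circ> (\<lambda>i. ?l (z i)) = z" for z :: "nat \<Rightarrow> 'a"
    by (simp add: fun_eq_iff zpoly_eval_var zpoly_eval_zero)
  have "wadd p ?X ?Y = (\<lambda>i. ?X i + ?Y i)"
  proof (rule ghost_eqI)
    fix n
    have "(?X i + ?Y i) ^ (p ^ (n - i)) = ?X i ^ (p ^ (n - i)) + ?Y i ^ (p ^ (n - i))" for i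
      using assms[of i] p_pos by (auto simp: power_0_left)
    then show "ghost p n (wadd p ?X ?Y) = ghost p n (\<lambda>i. ?X i + ?Y i)"
      unfolding ghost_wadd by (simp only: ghost_def sum.distrib distrib_left)
  qed
  then have "zpoly_eval (\<lambda>r. r) \<circ> wadd p ?X ?Y = zpoly_eval (\<lambda>r. r) \<circ> (\<lambda>i. ?X i + ?Y i)" by simp
  then show ?thesis
    unfolding zpoly_eval.hom_comp_wadd l
    by (simp add: fun_eq_iff zpoly_eval_add) (simp add: zpoly_eval_var zpoly_eval_zero)
qed

lemma wadd_zero: "wadd p (\<lambda>i. 0) x = x"
  by (subst wadd_disjoint) auto

lemma ghost_wmul: "ghost p n (wmul p k x) = of_nat k * ghost p n x"
  by (induction k) (simp_all add: ghost_zero p_pos ghost_wadd algebra_simps)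

lemma ghost_wshift: "ghost p n (wshift x) = (if n = 0 then 0 else of_nat p * ghost p (n - 1) x)"
proof (cases n)
  case (Suc m)
  have "ghost p (Suc m) (wshift x) = (\<Sum>i\<le>Suc m. of_nat p ^ i * wshift x i ^ (p ^ (Suc m - i)))"
    by (simp add: ghost_def)
  also have "\<dots> = of_nat p * ghost p m x"
    unfolding sum.atMost_Suc_shift
    using p_pos by (simp add: wshift_def power_0_left ghost_def sum_distrib_left mult_ac)
  finally show ?thesis by (simp add: Suc)
qed (simp add: ghost_def wshift_def)

lemma wshift_wadd: "wshift (wadd p x y) = wadd p (wshift x) (wshift y)"
proof -
  have *: "wshift (wadd p x y) = wadd p (wshift x) (wshift y)" for x y :: "nat \<Rightarrow> 'v zpoly"
    by (rule ghost_eqI) (simp add: ghost_wadd ghost_wshift algebra_simps)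
  have "zpoly_eval (\<lambda>r. r) \<circ> wshift (wadd p (\<lambda>i. zvar (x i)) (\<lambda>i. zvar (y i))) =
    zpoly_eval (\<lambda>r. r) \<circ> wadd p (wshift (\<lambda>i. zvar (x i))) (wshift (\<lambda>i. zvar (y i)))"
    by (subst *) (rule refl)
  then show ?thesis unfolding zpoly_eval.hom_comp_wadd zpoly_eval.hom_comp_wshift zpoly_lift .
qed

lemma wmul_mult: "wmul p (k * l) x = wmul p k (wmul p l x)"
proof -
  have *: "wmul p (k * l) x = wmul p k (wmul p l x)" for x :: "nat \<Rightarrow> 'v zpoly"
    by (rule ghost_eqI) (simp add: ghost_wmul mult.assoc)
  have "zpoly_eval (\<lambda>r. r) \<circ> wmul p (k * l) (\<lambda>i. zvar (x i)) =
    zpoly_eval (\<lambda>r. r) \<circ> wmul p k (wmul p l (\<lambda>i. zvar (x i)))"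
    by (subst *) (rule refl)
  then show ?thesis unfolding zpoly_eval.hom_comp_wmul zpoly_lift .
qed

text \<open>Over \<open>\<int>[X\<^sub>r]\<close>, the \<open>n\<close>-th ghost components of \<open>p x\<close> and \<open>VFx\<close> differ by \<open>p\<^sup>n\<^sup>+\<^sup>1 x\<^sub>n\<close>.\<close>

lemma wmul_p:
  fixes x :: "nat \<Rightarrow> 'r::comm_ring_1"
  assumes "CHAR('r) = p"
  shows "wmul p p x = wshift (\<lambda>i. x i ^ p)"
proof
  fix i
  let ?X = "\<lambda>i. zvar (x i)" and ?\<phi> = "zpoly_eval (\<lambda>r. r)"
  have "of_nat p dvd wmul p p ?X i - wshift (\<lambda>i. ?X i ^ p) i"
  proof (rule ghost_cong_modD)
    fix n
    show "of_nat p ^ Suc n dvd ghost p n (wmul p p ?X) - ghost p n (wshift (\<lambda>i. ?X i ^ p))"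
    proof (cases n)
      case (Suc m)
      have "ghost p n (wmul p p ?X) - ghost p n (wshift (\<lambda>i. ?X i ^ p)) = of_nat p ^ Suc n * ?X n"
        unfolding ghost_wmul ghost_wshift by (simp add: ghost_Suc Suc algebra_simps)
      then show ?thesis by simp
    qed (simp add: ghost_wmul ghost_wshift)
  qed
  then obtain z where "wmul p p ?X i - wshift (\<lambda>i. ?X i ^ p) i = of_nat p * z" by (auto simp: dvd_def)
  then have "?\<phi> (wmul p p ?X i) - ?\<phi> (wshift (\<lambda>i. ?X i ^ p) i) = of_nat p * ?\<phi> z"
    by (metis zpoly_eval.hom_diff zpoly_eval.hom_mult zpoly_eval.hom_of_nat)
  moreover have "of_nat p * ?\<phi> z = 0" using of_nat_CHAR[where ?'a = 'r] assms by simp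
  moreover have "?\<phi> (wmul p p ?X i) = wmul p p x i"
    using zpoly_eval.hom_comp_wmul[of "\<lambda>r. r" p p ?X] by (simp add: zpoly_lift fun_eq_iff)
  moreover have "?\<phi> (wshift (\<lambda>i. ?X i ^ p) i) = wshift (\<lambda>i. x i ^ p) i"
    by (simp add: wshift_def zpoly_eval.hom_power zpoly_eval_var zpoly_eval_zero)
  ultimately show "wmul p p x i = wshift (\<lambda>i. x i ^ p) i" by simp
qed

text \<open>p^k = V^k F^k, by iterating p = VF. For k = n it shows that p^n kills the vectors of
  length n, which is the source of inverses.\<close>

lemma wmul_p_power:
  fixes x :: "nat \<Rightarrow> 'r::comm_ring_1"
  assumes "CHAR('r) = p"
  shows "wmul p (p ^ k) x = (\<lambda>i. if i < k then 0 else x (i - k) ^ (p ^ k))"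
proof (induction k)
  case 0
  show ?case by (simp add: wadd_zero)
next
  case (Suc k)
  then show ?case using p_pos
    by (auto simp: wmul_mult wmul_p[OF assms] wshift_def fun_eq_iff power_0_left mult.commute
        simp flip: power_mult)
qed

lemma wtheta_ghost:
  assumes "derivation D"
  shows "of_nat (p ^ n) * wtheta p D n x = D (ghost p n x)"
proof -
  interpret derivation D by fact
  have "D (of_nat p ^ i * x i ^ (p ^ (n - i))) = of_nat (p ^ n) * (x i ^ (p ^ (n - i) - 1) * D (x i))"
    if "i \<le> n" for i
  proof -
    have "D (of_nat p ^ i * x i ^ (p ^ (n - i))) = of_nat (p ^ i) * D (x i ^ (p ^ (n - i)))"
      using deriv_of_nat_mult[of "p ^ i"] by simp
    also have "\<dots> = of_nat (p ^ i * p ^ (n - i)) * (x i ^ (p ^ (n - i) - 1) * D (x i))"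
      by (simp add: deriv_power mult_ac)
    also have "p ^ i * p ^ (n - i) = p ^ n" using that by (simp flip: power_add)
    finally show ?thesis .
  qed
  then show ?thesis unfolding wtheta_def ghost_def deriv_sum sum_distrib_left by simp
qed

lemma wtheta_wadd:
  fixes D :: "'r::comm_ring_1 \<Rightarrow> 'r"
  assumes "derivation D"
  shows "wtheta p D n (wadd p x y) = wtheta p D n x + wtheta p D n y"
proof -
  \<comment> \<open>In the ring itself p^n may be 0, so D is lifted to the polynomial ring before
    p^n is cancelled.\<close>
  let ?D = "zpoly_deriv (\<lambda>r. zvar (D r))" and ?\<phi> = "zpoly_eval (\<lambda>r. r)"
  let ?X = "\<lambda>i. zvar (x i)" and ?Y = "\<lambda>i. zvar (y i)"
  interpret D': derivation ?D by (rule derivation_zpoly_deriv)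
  note th = wtheta_ghost[OF D'.derivation_axioms]
  have "of_nat (p ^ n) * wtheta p ?D n (wadd p ?X ?Y) = of_nat (p ^ n) * (wtheta p ?D n ?X + wtheta p ?D n ?Y)"
    by (simp only: th ghost_wadd distrib_left D'.deriv_add)
  then have "wtheta p ?D n (wadd p ?X ?Y) = wtheta p ?D n ?X + wtheta p ?D n ?Y"
    by (rule of_nat_zpoly_cancel) (use p_pos in simp)
  moreover have "?\<phi> (wtheta p ?D n Z) = wtheta p D n (?\<phi> \<circ> Z)" for Z
    by (simp add: wtheta_def zpoly_eval.hom_sum zpoly_eval_mult zpoly_eval.hom_power
        zpoly_eval_deriv[OF assms])
  ultimately show ?thesis
    using zpoly_eval_add[of "\<lambda>r. r" "wtheta p ?D n ?X" "wtheta p ?D n ?Y"]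
    by (metis zpoly_eval.hom_comp_wadd zpoly_lift)
qed

section \<open>Witt vectors of length n as a group, and homomorphisms between such groups\<close>

lemma mult_witt [simp]: "monoid.mult (witt p n) = witt_add p"
  and one_witt [simp]: "monoid.one (witt p n) = wlist n (\<lambda>i. 0)"
  and carrier_witt [simp]: "a \<in> carrier (witt p n) \<longleftrightarrow> length a = n"
  by (auto simp: witt_def wlist_def map_replicate_const)

lemma witt_add_wlist: "witt_add p (wlist n x) (wlist n y) = wlist n (wadd p x y)"
  by (auto simp: witt_add_def list_eq_iff_nth_eq simp flip: wadd_def intro!: wadd_cong)

lemma wlistE: assumes "length a = n" obtains x where "a = wlist n x"
  using wlist_nth[OF assms] by metis

lemma pow_wlist: "wlist n x [^]\<^bsub>witt p n\<^esub> k = wlist n (wmul p k x)"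
  by (induction k) (simp_all add: nat_pow_def witt_add_wlist)

lemma comm_group_witt:
  assumes "CHAR('r) = p"
  shows "comm_group (witt p n :: 'r::comm_ring_1 list monoid)"
proof (rule comm_groupI; unfold carrier_witt mult_witt one_witt)
  fix a :: "'r list" assume "length a = n"
  then obtain x where x: "a = wlist n x" by (rule wlistE)
  show "witt_add p (wlist n (\<lambda>i. 0)) a = a" by (simp add: x witt_add_wlist wadd_zero)
  \<comment> \<open>The inverse is the (p^n - 1)-fold sum, so negation needs no polynomials of its
    own.\<close>
  have "wadd p (wmul p (p ^ n - 1) x) x = wmul p (p ^ n) x"
    using p_pos by (metis Suc_diff_1 wmul.simps(2) zero_less_power)
  then have "witt_add p (wlist n (wmul p (p ^ n - 1) x)) a = wlist n (\<lambda>i. 0)"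
    by (simp add: x witt_add_wlist wmul_p_power[OF assms] wlist_eq_iff)
  then show "\<exists>b\<in>carrier (witt p n). witt_add p b a = wlist n (\<lambda>i. 0)" by (metis carrier_witt length_wlist)
  fix b :: "'r list" assume "length b = n"
  then obtain y where y: "b = wlist n y" by (rule wlistE)
  show "length (witt_add p a b) = n" by (simp add: x y witt_add_wlist)
  show "witt_add p a b = witt_add p b a" by (simp add: x y witt_add_wlist wadd_commute)
  fix c :: "'r list" assume "length c = n"
  then obtain z where z: "c = wlist n z" by (rule wlistE)
  show "witt_add p (witt_add p a b) c = witt_add p a (witt_add p b c)"
    by (simp add: x y z witt_add_wlist wadd_assoc)
qed simp

lemma map_hom_witt:
  assumes "unital_hom h" shows "map h \<in> hom (witt p n) (witt p n)"
proof (rule homI; unfold carrier_witt mult_witt)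
  interpret unital_hom h by fact
  fix a b :: "'a list" assume "length a = n" "length b = n"
  then obtain x y where x: "a = wlist n x" "b = wlist n y" by (metis wlistE)
  have *: "map h (wlist n x) = wlist n (h \<circ> x)" for x by (simp add: wlist_def)
  show "map h (witt_add p a b) = witt_add p (map h a) (map h b)"
    by (simp add: x * witt_add_wlist hom_comp_wadd)
qed simp

lemma take_hom_witt:
  assumes "m \<le> n" shows "take m \<in> hom (witt p n) (witt p m :: 'r::comm_ring_1 list monoid)"
proof (rule homI; unfold carrier_witt mult_witt)
  fix a b :: "'r list" assume "length a = n" "length b = n"
  then obtain x y where x: "a = wlist n x" "b = wlist n y" by (metis wlistE)
  have *: "take m (wlist n x) = wlist m x" for x :: "nat \<Rightarrow> 'r" using assms by (simp add: wlist_def take_map)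
  show "take m (witt_add p a b) = witt_add p (take m a) (take m b)"
    by (simp add: x * witt_add_wlist)
qed (use assms in simp)

lemma Cons_hom_witt: "Cons 0 \<in> hom (witt p n) (witt p (Suc n) :: 'r::comm_ring_1 list monoid)"
proof (rule homI; unfold carrier_witt mult_witt)
  fix a b :: "'r list" assume "length a = n" "length b = n"
  then obtain x y where x: "a = wlist n x" "b = wlist n y" by (metis wlistE)
  have *: "0 # wlist n x = wlist (Suc n) (wshift x)" for x :: "nat \<Rightarrow> 'r"
    unfolding wlist_def by (simp add: wshift_def upt_rec[of 0] map_Suc_upt[symmetric] del: upt_Suc)
  show "0 # witt_add p a b = witt_add p (0 # a) (0 # b)"
    by (simp add: x * witt_add_wlist wshift_wadd)
qed simp

lemma replicate_hom_witt:
  "(@) (replicate m 0) \<in> hom (witt p n) (witt p (m + n) :: 'r::comm_ring_1 list monoid)"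
proof (induction m)
  case (Suc m)
  then show ?case using hom_compose[OF Suc Cons_hom_witt[of "m + n"]] by (simp add: o_def)
qed (simp add: hom_def)

lemma frob_unital_hom: "CHAR('r) = p \<Longrightarrow> unital_hom (\<lambda>x :: 'r::comm_ring_1. x ^ p)"
  by standard (use prime_p in \<open>simp_all add: freshmans_dream power_mult_distrib\<close>)

lemma witt_frob_hom:
  assumes "CHAR('r) = p"
  shows "witt_frob p \<in> hom (witt p n) (witt p n :: 'r::comm_ring_1 list monoid)"
  using map_hom_witt[OF frob_unital_hom[OF assms]] by (simp add: witt_frob_def[abs_def])

lemma witt_wp_eq: "length a = n \<Longrightarrow> witt_wp p a = witt_add p (witt_frob p a) (inv\<^bsub>witt p n\<^esub> a)"
  by (simp add: witt_wp_def)

lemma witt_wp_hom: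
  assumes "CHAR('r) = p"
  shows "witt_wp p \<in> hom (witt p n) (witt p n :: 'r::comm_ring_1 list monoid)"
proof (rule homI)
  let ?W = "witt p n :: 'r list monoid"
  interpret comm_group ?W by (rule comm_group_witt) fact
  interpret F: group_hom ?W ?W "witt_frob p"
    using witt_frob_hom[OF assms] by unfold_locales
  fix a b assume ab: "a \<in> carrier ?W" "b \<in> carrier ?W"
  then have wp: "witt_wp p c = witt_frob p c \<otimes>\<^bsub>?W\<^esub> inv\<^bsub>?W\<^esub> c" if "c \<in> carrier ?W" for c
    using that by (simp add: witt_wp_def)
  show "witt_wp p a \<in> carrier ?W" using ab(1) by (simp only: wp F.hom_closed inv_closed m_closed)
  show "witt_wp p (a \<otimes>\<^bsub>?W\<^esub> b) = witt_wp p a \<otimes>\<^bsub>?W\<^esub> witt_wp p b"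
    using ab by (simp only: wp m_closed F.hom_mult inv_mult F.hom_closed inv_closed m_ac)
qed

text \<open>A single source for the compatibility of \<wp> with truncation, with the iterated
  Verschiebung and with the embedding into the completion.\<close>

lemma hom_witt_wp:
  fixes h :: "'r::comm_ring_1 list \<Rightarrow> 's::comm_ring_1 list"
  assumes "CHAR('r) = p" "CHAR('s) = p" "h \<in> hom (witt p n) (witt p m)"
    and "\<And>a. length a = n \<Longrightarrow> h (witt_frob p a) = witt_frob p (h a)" and "length a = n"
  shows "h (witt_wp p a) = witt_wp p (h a)"
proof -
  interpret R: comm_group "witt p n :: 'r list monoid" by (rule comm_group_witt) fact
  interpret S: comm_group "witt p m :: 's list monoid" by (rule comm_group_witt) fact
  interpret h: group_hom "witt p n :: 'r list monoid" "witt p m :: 's list monoid" h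
    using assms(3) by unfold_locales
  have a: "a \<in> carrier (witt p n)" "witt_frob p a \<in> carrier (witt p n)"
    using assms(5) by (simp_all add: witt_frob_def)
  have "witt_wp p a = witt_frob p a \<otimes>\<^bsub>witt p n\<^esub> inv\<^bsub>witt p n\<^esub> a"
    using assms(5) by (simp add: witt_wp_def)
  then have "h (witt_wp p a) = h (witt_frob p a) \<otimes>\<^bsub>witt p m\<^esub> inv\<^bsub>witt p m\<^esub> h a"
    by (simp only: h.hom_mult R.inv_closed a h.hom_inv)
  also have "\<dots> = witt_wp p (h a)"
    using h.hom_closed[OF a(1)] assms(4,5) by (simp add: witt_wp_def)
  finally show ?thesis .
qed

end

section \<open>Cosets of \<open>\<wp>(W\<^sub>n)\<close>\<close>

context witt_prime
begin

lemma length_witt_add [simp]: "length (witt_add p a b) = length a"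
  by (simp add: witt_add_def)

lemma witt_add_assoc:
  assumes "length a = n" "length b = n" "length c = n"
  shows "witt_add p (witt_add p a b) c = witt_add p a (witt_add p b c)"
proof -
  obtain x y z where "a = wlist n x" "b = wlist n y" "c = wlist n z" using assms by (metis wlistE)
  then show ?thesis by (simp add: witt_add_wlist wadd_assoc)
qed

text \<open>The two summands have disjoint supports, so nothing carries over. It splits a vector
  into its truncation and a Verschiebung.\<close>

lemma witt_add_append:
  "witt_add p (xs @ replicate (length ys) 0) (replicate (length xs) 0 @ ys) = xs @ ys"
proof -
  let ?n = "length xs + length ys"
  let ?x = "\<lambda>i. if i < length xs then xs ! i else 0"
  let ?y = "\<lambda>i. if i < length xs then 0 else ys ! (i - length xs)"
  have 1: "xs @ replicate (length ys) 0 = wlist ?n ?x" "replicate (length xs) 0 @ ys = wlist ?n ?y"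
    by (auto intro!: nth_equalityI simp: nth_append)
  have 2: "xs @ ys = wlist ?n (\<lambda>i. ?x i + ?y i)"
    by (auto intro!: nth_equalityI simp: nth_append)
  show ?thesis unfolding 1 2 witt_add_wlist by (subst wadd_disjoint) auto
qed

lemma witt_pow_p_power:
  fixes a :: "'r::comm_ring_1 list"
  assumes "CHAR('r) = p" "length a = m + i"
  shows "a [^]\<^bsub>witt p (m + i)\<^esub> (p ^ m) = replicate m 0 @ map (\<lambda>x. x ^ (p ^ m)) (take i a)"
proof -
  obtain x where x: "a = wlist (m + i) x" using assms(2) by (rule wlistE)
  have "a [^]\<^bsub>witt p (m + i)\<^esub> (p ^ m) = wlist (m + i) (\<lambda>j. if j < m then 0 else x (j - m) ^ (p ^ m))"
    by (simp add: x pow_wlist wmul_p_power[OF assms(1)])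
  also have "\<dots> = replicate m 0 @ map (\<lambda>x. x ^ (p ^ m)) (take i a)"
    by (auto intro!: nth_equalityI simp: nth_append x)
  finally show ?thesis .
qed

abbreviation wp_img :: "nat \<Rightarrow> 'r::comm_ring_1 list set" where
  "wp_img n \<equiv> witt_wp p ` carrier (witt p n)"

context
  fixes ty :: "'r::comm_ring_1 itself"
  assumes char_r: "CHAR('r) = p"
begin

lemma length_witt_wp: "length (a :: 'r list) = n \<Longrightarrow> length (witt_wp p a) = n"
  using hom_in_carrier[OF witt_wp_hom[OF char_r], of a n] by simp

lemma witt_wp_add:
  "length (a :: 'r list) = n \<Longrightarrow> length b = n \<Longrightarrow>
     witt_wp p (witt_add p a b) = witt_add p (witt_wp p a) (witt_wp p b)"
  using hom_mult[OF witt_wp_hom[OF char_r], of a n b] by simp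

lemma frob_eq_wp:
  assumes "length (a :: 'r list) = n" shows "witt_frob p a = witt_add p (witt_wp p a) a"
proof -
  interpret W: comm_group "witt p n :: 'r list monoid" by (rule comm_group_witt[OF char_r])
  show ?thesis
    using W.inv_solve_right'[of "witt_wp p a" "witt_frob p a" a] assms length_witt_wp[OF assms]
    by (simp add: witt_wp_def witt_frob_def)
qed

lemma wp_img_subgroup: "subgroup (wp_img n) (witt p n :: 'r list monoid)"
proof -
  interpret W: comm_group "witt p n :: 'r list monoid" by (rule comm_group_witt[OF char_r])
  interpret h: group_hom "witt p n :: 'r list monoid" "witt p n :: 'r list monoid" "witt_wp p"
    using witt_wp_hom[OF char_r] by unfold_locales
  show ?thesis by (rule h.img_is_subgroup)
qed

lemma wp_img_normal: "wp_img n \<lhd> (witt p n :: 'r list monoid)"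
proof -
  interpret W: comm_group "witt p n :: 'r list monoid" by (rule comm_group_witt[OF char_r])
  show ?thesis by (rule W.subgroup_imp_normal[OF wp_img_subgroup])
qed

lemma in_wp_coset: "a' \<in> wp_img n #>\<^bsub>witt p n\<^esub> (a :: 'r list) \<longleftrightarrow>
    (\<exists>c. length c = n \<and> a' = witt_add p (witt_wp p c) a)"
  by (auto simp: r_coset_def)

lemma wp_coset_eq:
  assumes "length (a :: 'r list) = n" "a' \<in> wp_img n #>\<^bsub>witt p n\<^esub> a"
  shows "wp_img n #>\<^bsub>witt p n\<^esub> a' = wp_img n #>\<^bsub>witt p n\<^esub> a"
proof -
  interpret W: comm_group "witt p n :: 'r list monoid" by (rule comm_group_witt[OF char_r])
  show ?thesis using W.repr_independence[OF assms(2) _ wp_img_subgroup] assms(1) by simp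
qed

lemma wp_coset_self: "length (a :: 'r list) = n \<Longrightarrow> a \<in> wp_img n #>\<^bsub>witt p n\<^esub> a"
proof -
  interpret W: comm_group "witt p n :: 'r list monoid" by (rule comm_group_witt[OF char_r])
  show "length a = n \<Longrightarrow> ?thesis" using W.rcos_self[OF _ wp_img_subgroup] by simp
qed

lemma hom_wp_replicate:
  "length (a :: 'r list) = i \<Longrightarrow> replicate m 0 @ witt_wp p a = witt_wp p (replicate m 0 @ a)"
  using p_pos by (intro hom_witt_wp[OF char_r char_r replicate_hom_witt, of i m])
    (simp_all add: witt_frob_def power_0_left)

lemma hom_add_replicate:
  "length (a :: 'r list) = i \<Longrightarrow> length b = i \<Longrightarrow>
    replicate m 0 @ witt_add p a b = witt_add p (replicate m 0 @ a) (replicate m 0 @ b)"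
  using hom_mult[OF replicate_hom_witt[of m i], of a b] by simp

lemma take_witt_wp:
  "length (a :: 'r list) = n \<Longrightarrow> m \<le> n \<Longrightarrow> take m (witt_wp p a) = witt_wp p (take m a)"
  by (rule hom_witt_wp[OF char_r char_r take_hom_witt]) (simp_all add: witt_frob_def take_map)

lemma take_witt_add:
  "length (a :: 'r list) = n \<Longrightarrow> length b = n \<Longrightarrow> m \<le> n \<Longrightarrow>
     take m (witt_add p a b) = witt_add p (take m a) (take m b)"
  using hom_mult[OF take_hom_witt[of m n], of a b] by simp

lemma witt_frob_iter_coset:
  "length (a :: 'r list) = n \<Longrightarrow> map (\<lambda>x. x ^ (p ^ m)) a \<in> wp_img n #>\<^bsub>witt p n\<^esub> a"
proof (induction m)
  case 0
  then show ?case using wp_coset_self[of a n] by simp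
next
  case (Suc m)
  let ?b = "map (\<lambda>x. x ^ (p ^ m)) a"
  have "map (\<lambda>x. x ^ (p ^ Suc m)) a = witt_frob p ?b"
    by (simp add: witt_frob_def mult.commute flip: power_mult)
  also have "\<dots> \<in> wp_img n #>\<^bsub>witt p n\<^esub> ?b"
    unfolding in_wp_coset using frob_eq_wp[of ?b n] Suc.prems by (intro exI[of _ ?b]) simp
  also have "wp_img n #>\<^bsub>witt p n\<^esub> ?b = wp_img n #>\<^bsub>witt p n\<^esub> a"
    using Suc by (intro wp_coset_eq) auto
  finally show ?case .
qed

text \<open>
  This is the injectivity of \<open>V\<^sup>m\<close> on \<open>W\<^sub>i / \<wp>(W\<^sub>i)\<close>. The truncation of \<open>c\<close> to the first \<open>m\<close> components
  is fixed by Frobenius, so it may be replaced by \<open>0\<close> without changing \<open>\<wp> c\<close>.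
\<close>

lemma wp_eq_replicate:
  assumes "length (c :: 'r list) = m + i" "witt_wp p c = replicate m 0 @ d"
  shows "d = witt_wp p (drop m c)"
proof -
  interpret W: comm_group "witt p n :: 'r list monoid" for n by (rule comm_group_witt[OF char_r])
  let ?c0 = "take m c @ replicate i 0" and ?c1 = "replicate m 0 @ drop m c"
  have zero: "witt_add p (wlist n (\<lambda>i. 0)) a = a" if "length a = n" for n and a :: "'r list"
    using W.l_one[of a n] that by simp
  have "witt_wp p (take m c) = wlist m (\<lambda>i. 0)"
    using take_witt_wp[of c "m + i" m] assms by (simp add: wlist_def map_replicate_const)
  then have "witt_frob p (take m c) = take m c"
    using frob_eq_wp[of "take m c" m] zero[of "take m c" m] assms(1) by simp
  then have "witt_frob p ?c0 = ?c0" using p_pos by (simp add: witt_frob_def power_0_left)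
  then have wp0: "witt_wp p ?c0 = wlist (m + i) (\<lambda>i. 0)"
    using W.r_inv[of ?c0 "m + i"] assms(1) by (simp add: witt_wp_def)
  have "c = witt_add p ?c0 ?c1"
    using witt_add_append[of "take m c" "drop m c"] assms(1) by simp
  then have "witt_wp p c = witt_add p (witt_wp p ?c0) (witt_wp p ?c1)"
    using witt_wp_add[of ?c0 "m + i" ?c1] assms(1) by simp
  also have "\<dots> = witt_wp p ?c1"
    unfolding wp0 using assms(1) by (intro zero length_witt_wp) simp
  also have "\<dots> = replicate m 0 @ witt_wp p (drop m c)"
    using hom_wp_replicate[of "drop m c" i m] assms(1) by simp
  finally show ?thesis using assms(2) by simp
qed

end

lemma wp_cosetE:
  assumes "\<chi> \<in> carrier (H1 p n)" obtains b :: "'r::field list"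
  where "length b = n" "\<chi> = wp_img n #>\<^bsub>witt p n\<^esub> b"
  using assms by (auto simp: H1_def carrier_FactGroup)

text \<open>Here \<open>p\<^sup>m = V\<^sup>mF\<^sup>m\<close>, Frobenius acts trivially on classes, and \<open>V\<^sup>m\<close> is injective on classes.\<close>

lemma character_truncation:
  fixes b :: "'r::field list"
  assumes char: "CHAR('r) = p" and b: "length b = m + i"
    and i: "\<chi>\<^sub>i \<in> carrier (H1 p i)"
    and incl: "H1_incl p i (m + i) \<chi>\<^sub>i = (wp_img (m + i) #>\<^bsub>witt p (m + i)\<^esub> b) [^]\<^bsub>H1 p (m + i)\<^esub> (p ^ m)"
  shows "\<chi>\<^sub>i = wp_img i #>\<^bsub>witt p i\<^esub> take i b"
proof -
  interpret W: comm_group "witt p n :: 'r list monoid" for n by (rule comm_group_witt[OF char])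
  let ?n = "m + i" and ?V = "\<lambda>a. replicate m (0 :: 'r) @ a" and ?e = "take i b"
  obtain d where d: "length d = i" "\<chi>\<^sub>i = wp_img i #>\<^bsub>witt p i\<^esub> d"
    using wp_cosetE[OF i] by blast
  have le: "length ?e = i" using b by simp
  obtain f where f: "length f = i" "map (\<lambda>x. x ^ (p ^ m)) ?e = witt_add p (witt_wp p f) ?e"
    using witt_frob_iter_coset[OF char le, of m] unfolding in_wp_coset[OF char] by blast
  have "?V d \<in> H1_incl p i ?n \<chi>\<^sub>i"
    using d wp_coset_self[OF char, of d i] wp_coset_self[OF char, of "?V d" ?n]
    by (auto simp: H1_incl_def)
  also have "\<dots> = wp_img ?n #>\<^bsub>witt p ?n\<^esub> (b [^]\<^bsub>witt p ?n\<^esub> (p ^ m))"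
    unfolding incl H1_def using b by (intro normal.FactGroup_pow wp_img_normal[OF char]) simp
  also have "b [^]\<^bsub>witt p ?n\<^esub> (p ^ m) = ?V (witt_add p (witt_wp p f) ?e)"
    unfolding f(2)[symmetric] by (rule witt_pow_p_power[OF char b])
  finally obtain c where c: "length c = ?n"
    "?V d = witt_add p (witt_wp p c) (?V (witt_add p (witt_wp p f) ?e))"
    unfolding in_wp_coset[OF char] by blast
  have lf: "length (witt_wp p f) = i" using length_witt_wp[OF char f(1)] .
  let ?c = "witt_add p c (?V f)"
  have "?V d = witt_add p (witt_wp p c) (witt_add p (witt_wp p (?V f)) (?V ?e))"
    using c hom_add_replicate[OF char lf le] hom_wp_replicate[OF char f(1)] by simp
  also have "\<dots> = witt_add p (witt_wp p ?c) (?V ?e)"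
    using c(1) f(1) le length_witt_wp[OF char, of c ?n] length_witt_wp[OF char, of "?V f" ?n]
    by (simp add: witt_wp_add[OF char, of _ ?n] witt_add_assoc[of _ ?n])
  finally have Vd: "?V d = witt_add p (witt_wp p ?c) (?V ?e)" .
  let ?g = "d \<otimes>\<^bsub>witt p i\<^esub> inv\<^bsub>witt p i\<^esub> ?e"
  have lg: "length ?g = i" using d(1) by simp
  have g: "d = witt_add p ?g ?e"
    using W.inv_solve_right[of ?g i d ?e] d(1) le lg by simp
  have wc: "length (witt_wp p ?c) = ?n" using length_witt_wp[OF char, of ?c ?n] c(1) by simp
  have "witt_add p (?V ?g) (?V ?e) = witt_add p (witt_wp p ?c) (?V ?e)"
    using Vd hom_add_replicate[OF char lg le, of m] g by simp
  then have "witt_wp p ?c = ?V ?g"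
    using W.right_cancel[of "?V ?e" ?n "?V ?g" "witt_wp p ?c"] wc lg le by simp
  then have "?g = witt_wp p (drop m ?c)" using c(1) by (intro wp_eq_replicate[OF char]) simp_all
  then have "d = witt_add p (witt_wp p (drop m ?c)) ?e" using g by simp
  then have "d \<in> wp_img i #>\<^bsub>witt p i\<^esub> ?e"
    unfolding in_wp_coset[OF char] using c(1) by (intro exI[of _ "drop m ?c"]) simp
  then show ?thesis unfolding d(2) by (rule wp_coset_eq[OF char le])
qed

end

section \<open>Valuations and the pole filtration\<close>

lemma val_ge_zero [simp]: "val_ge v 0 s"
  by (simp add: val_ge_def)

lemma val_ge_mono: "val_ge v x t \<Longrightarrow> s \<le> t \<Longrightarrow> val_ge v x s"
  by (auto simp: val_ge_def)

lemma val_posI: "val_ge v x s \<Longrightarrow> s > 0 \<Longrightarrow> val_pos v x"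
  by (auto simp: val_ge_def val_pos_def)

lemma val_pos_imp_ge: "val_pos v x \<Longrightarrow> val_ge v x 0"
  by (auto simp: val_ge_def val_pos_def)

lemma val_ge_all_zero: "(\<And>s. val_ge v x s) \<Longrightarrow> x = 0"
  by (metis gt_ex not_le val_ge_def)

locale valued =
  fixes v :: "'c::field \<Rightarrow> rat"
  assumes valuation: "valuation_on UNIV v"
begin

lemma v_mult: "x \<noteq> 0 \<Longrightarrow> y \<noteq> 0 \<Longrightarrow> v (x * y) = v x + v y"
  and v_add: "x \<noteq> 0 \<Longrightarrow> y \<noteq> 0 \<Longrightarrow> x + y \<noteq> 0 \<Longrightarrow> min (v x) (v y) \<le> v (x + y)"
  using valuation by (auto simp: valuation_on_def)

lemma v_one: "v 1 = 0"
  using v_mult[of 1 1] by simp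

lemma v_minus: "v (- x) = v x"
proof (cases "x = 0")
  case False
  have "v (-1) = 0" using v_mult[of "-1" "-1"] v_one by simp
  then show ?thesis using v_mult[of "-1" x] False by simp
qed simp

lemma v_inverse: "x \<noteq> 0 \<Longrightarrow> v (inverse x) = - v x"
  using v_mult[of x "inverse x"] by (simp add: v_one)

lemma v_power: "x \<noteq> 0 \<Longrightarrow> v (x ^ k) = of_nat k * v x"
  by (induction k) (simp_all add: v_one v_mult algebra_simps)

lemma val_ge_add: "val_ge v x s \<Longrightarrow> val_ge v y s \<Longrightarrow> val_ge v (x + y) s"
  using v_add[of x y] by (cases "x = 0 \<or> y = 0 \<or> x + y = 0") (auto simp: val_ge_def)

lemma val_ge_minus_iff [simp]: "val_ge v (- x) s \<longleftrightarrow> val_ge v x s"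
  by (simp add: val_ge_def v_minus)

lemma val_ge_diff: "val_ge v x s \<Longrightarrow> val_ge v y s \<Longrightarrow> val_ge v (x - y) s"
  using val_ge_add[of x s "- y"] by simp

lemma val_ge_mult: "val_ge v x s \<Longrightarrow> val_ge v y t \<Longrightarrow> val_ge v (x * y) (s + t)"
  using v_mult[of x y] by (cases "x = 0 \<or> y = 0") (auto simp: val_ge_def)

lemma val_ge_one: "val_ge v 1 0"
  by (simp add: val_ge_def v_one)

lemma val_ge_power: "val_ge v x s \<Longrightarrow> val_ge v (x ^ k) (of_nat k * s)"
proof (induction k)
  case (Suc k)
  then show ?case using val_ge_mult[of x s "x ^ k" "of_nat k * s"] by (simp add: algebra_simps)
qed (simp add: val_ge_one)

lemma val_ge_sum: "(\<And>x. x \<in> A \<Longrightarrow> val_ge v (f x) s) \<Longrightarrow> val_ge v (sum f A) s"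
  by (induction A rule: infinite_finite_induct) (simp_all add: val_ge_add)

lemma val_ge_prod:
  "(\<And>x. x \<in> A \<Longrightarrow> val_ge v (f x) (s x)) \<Longrightarrow> val_ge v (prod f A) (sum s A)"
  by (induction A rule: infinite_finite_induct) (simp_all add: val_ge_one val_ge_mult)

lemma val_ge_of_nat: "val_ge v (of_nat k) 0"
  by (induction k) (simp_all add: val_ge_add val_ge_one)

lemma val_ge_of_int: "val_ge v (of_int k) 0"
proof (cases k)
  case (neg n)
  have "val_ge v (- of_nat (Suc n)) 0" by (simp only: val_ge_minus_iff val_ge_of_nat)
  then show ?thesis using neg by simp
qed (simp add: val_ge_of_nat)

lemma val_ge_mult_0: "val_ge v x 0 \<Longrightarrow> val_ge v y s \<Longrightarrow> val_ge v (x * y) s"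
  using val_ge_mult[of x 0 y s] by simp

lemma val_pos_add: "val_pos v x \<Longrightarrow> val_pos v y \<Longrightarrow> val_pos v (x + y)"
  using v_add[of x y] by (cases "x = 0 \<or> y = 0 \<or> x + y = 0") (auto simp: val_pos_def)

lemma val_pos_minus_iff [simp]: "val_pos v (- x) \<longleftrightarrow> val_pos v x"
  by (simp add: val_pos_def v_minus)

lemma val_pos_diff: "val_pos v x \<Longrightarrow> val_pos v y \<Longrightarrow> val_pos v (x - y)"
  using val_pos_add[of x "- y"] by simp

lemma val_pos_mult: "val_ge v x 0 \<Longrightarrow> val_pos v y \<Longrightarrow> val_pos v (x * y)"
  using v_mult[of x y] by (cases "x = 0 \<or> y = 0") (auto simp: val_ge_def val_pos_def)

lemma val_lim_unique: "val_lim v u l \<Longrightarrow> val_lim v u l' \<Longrightarrow> l = l'"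
proof -
  assume l: "val_lim v u l" and l': "val_lim v u l'"
  have "val_ge v (l' - l) s" for s
  proof -
    obtain M M' where "\<forall>n\<ge>M. val_ge v (u n - l) s" "\<forall>n\<ge>M'. val_ge v (u n - l') s"
      using l l' unfolding val_lim_def by metis
    then have "val_ge v (u (max M M') - l) s" "val_ge v (u (max M M') - l') s" by simp_all
    then show ?thesis using val_ge_diff by fastforce
  qed
  then show "l = l'" using val_ge_all_zero[of v "l' - l"] by simp
qed

end

text \<open>The least s >= 0 that bounds the poles. The inserted 0 covers vectors without poles and
  matches the condition s >= 0 in \<open>swan\<close>.\<close>

definition pole_order :: "nat \<Rightarrow> ('c::field \<Rightarrow> rat) \<Rightarrow> nat \<Rightarrow> 'c list \<Rightarrow> rat" where
  "pole_order p v n a =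
     Max (insert 0 ((\<lambda>i. - of_nat (p ^ (n - Suc i)) * v (a ! i)) ` {i. i < n \<and> a ! i \<noteq> 0}))"

lemma pole_bounded_iff:
  "pole_bounded p v n s a \<longleftrightarrow> (\<forall>i<n. a ! i \<noteq> 0 \<longrightarrow> - s \<le> of_nat (p ^ (n - Suc i)) * v (a ! i))"
  unfolding pole_bounded_def
proof (intro iffI allI ballI impI)
  fix i assume "\<forall>i\<in>{1..n}. a ! (i - 1) = 0 \<or> - s \<le> of_nat (p ^ (n - i)) * v (a ! (i - 1))"
    "i < n" "a ! i \<noteq> 0"
  then show "- s \<le> of_nat (p ^ (n - Suc i)) * v (a ! i)" by (auto dest: bspec[of _ _ "Suc i"])
next
  fix i assume "\<forall>i<n. a ! i \<noteq> 0 \<longrightarrow> - s \<le> of_nat (p ^ (n - Suc i)) * v (a ! i)" "i \<in> {1..n}"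
  then show "a ! (i - 1) = 0 \<or> - s \<le> of_nat (p ^ (n - i)) * v (a ! (i - 1))"
    by (auto dest: spec[of _ "i - 1"])
qed

lemma pole_bounded_mono: "pole_bounded p v n s a \<Longrightarrow> s \<le> t \<Longrightarrow> pole_bounded p v n t a"
  by (fastforce simp: pole_bounded_iff)

lemma pole_order_nonneg: "0 \<le> pole_order p v n a"
  by (simp add: pole_order_def)

lemma pole_bounded_iff_order: "0 \<le> s \<Longrightarrow> pole_bounded p v n s a \<longleftrightarrow> pole_order p v n a \<le> s"
  by (auto simp: pole_order_def pole_bounded_iff minus_le_iff)

locale valued_witt = witt_prime p + valued v for p and v :: "'c::field \<Rightarrow> rat" +
  assumes char_p: "CHAR('c) = p"
begin

text \<open>With r = -s/p^(n-1) the bound on the entry of index i reads p^i r, proportional to the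
  weight of the i-th variable in the addition polynomials.\<close>

lemma pole_bounded_iff_weight:
  "pole_bounded p v n s a \<longleftrightarrow> (\<forall>i<n. val_ge v (a ! i) (of_nat (p ^ i) * (- s / of_nat (p ^ (n - 1)))))"
proof -
  have "- s \<le> of_nat (p ^ (n - Suc i)) * r \<longleftrightarrow> of_nat (p ^ i) * (- s / of_nat (p ^ (n - 1))) \<le> r"
    if "i < n" for i r
  proof -
    have "p ^ (n - 1) = p ^ i * p ^ (n - Suc i)" using that by (simp flip: power_add)
    then show ?thesis using p_pos by (simp add: field_simps)
  qed
  then show ?thesis unfolding pole_bounded_iff val_ge_def by blast
qed

text \<open>Isobaricity of the addition polynomials makes the pole filtration a filtration by subgroups.\<close>

lemma wadd_val_ge:
  assumes "\<And>j. j \<le> i \<Longrightarrow> val_ge v (x j) (of_nat (p ^ j) * s)"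
    and "\<And>j. j \<le> i \<Longrightarrow> val_ge v (y j) (of_nat (p ^ j) * s)"
  shows "val_ge v (wadd p x y i) (of_nat (p ^ i) * s)"
  unfolding wadd_def zpoly_eval_def
proof (rule val_ge_sum)
  let ?f = "case_sum x y"
  fix m assume m: "m \<in> Poly_Mapping.keys (witt_sum_poly p i)"
  have f: "val_ge v (?f k) (of_nat (p ^ case_sum id id k) * s)" if "k \<in> Poly_Mapping.keys m" for k
    using witt_sum_poly_index[OF m that] assms by (cases k) auto
  have "val_ge v (\<Prod>k\<in>Poly_Mapping.keys m. ?f k ^ Poly_Mapping.lookup m k)
      (\<Sum>k\<in>Poly_Mapping.keys m. of_nat (Poly_Mapping.lookup m k) * (of_nat (p ^ case_sum id id k) * s))"
    by (intro val_ge_prod val_ge_power f)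
  also have "(\<Sum>k\<in>Poly_Mapping.keys m. of_nat (Poly_Mapping.lookup m k) * (of_nat (p ^ case_sum id id k) * s)) =
      of_nat (witt_weight p m) * s"
    by (simp add: witt_weight_def sum_distrib_right mult.assoc)
  also have "witt_weight p m = p ^ i" using isobaric_witt_sum_poly[of i] m by (simp add: isobaric_def)
  finally show "val_ge v (of_int (Poly_Mapping.lookup (witt_sum_poly p i) m) *
      (\<Prod>k\<in>Poly_Mapping.keys m. ?f k ^ Poly_Mapping.lookup m k)) (of_nat (p ^ i) * s)"
    by (intro val_ge_mult_0 val_ge_of_int)
qed

lemma pole_bounded_add:
  assumes "length a = n" "length b = n" "pole_bounded p v n s a" "pole_bounded p v n s b"
  shows "pole_bounded p v n s (witt_add p a b)"
proof -
  obtain x y where "a = wlist n x" "b = wlist n y" using assms(1,2) by (metis wlistE)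
  moreover define r where "r = - s / of_nat (p ^ (n - 1))"
  ultimately show ?thesis using assms(3,4)
    unfolding pole_bounded_iff_weight r_def[symmetric]
    by (auto simp: witt_add_wlist simp del: of_nat_power intro!: wadd_val_ge)
qed

sublocale W: comm_group "witt p n :: 'c list monoid" for n
  by (rule comm_group_witt) (rule char_p)

lemma pole_bounded_zero: "pole_bounded p v n s (wlist n (\<lambda>i. 0))"
  by (simp add: pole_bounded_iff)

lemma witt_pow_order:
  fixes a :: "'c list" assumes "length a = n" shows "a [^]\<^bsub>witt p n\<^esub> (p ^ n) = wlist n (\<lambda>i. 0)"
proof -
  obtain x where "a = wlist n x" using assms by (rule wlistE)
  then show ?thesis by (simp add: pow_wlist wlist_eq_iff wmul_p_power[OF char_p])
qed

text \<open>The inverse is the (p^n - 1)-fold multiple, so closure under addition suffices.\<close>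

lemma pole_bounded_inv:
  assumes "length a = n" "pole_bounded p v n s a"
  shows "pole_bounded p v n s (inv\<^bsub>witt p n\<^esub> a)"
proof -
  have pow: "pole_bounded p v n s (a [^]\<^bsub>witt p n\<^esub> k) \<and> length (a [^]\<^bsub>witt p n\<^esub> k) = n" for k :: nat
  proof (induction k)
    case (Suc k)
    then show ?case using assms W.m_closed[of "a [^]\<^bsub>witt p n\<^esub> k" n a] by (simp add: pole_bounded_add)
  qed (simp add: pole_bounded_zero)
  have "a [^]\<^bsub>witt p n\<^esub> (p ^ n - 1) \<otimes>\<^bsub>witt p n\<^esub> a = a [^]\<^bsub>witt p n\<^esub> (p ^ n)"
    using p_pos by (metis Suc_diff_1 W.nat_pow_Suc zero_less_power)
  then have "inv\<^bsub>witt p n\<^esub> a = a [^]\<^bsub>witt p n\<^esub> (p ^ n - 1)"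
    using assms(1) pow by (intro W.inv_equality) (simp_all add: witt_pow_order)
  then show ?thesis using pow by simp
qed

lemma pole_bounded_frob:
  "length (a :: 'c list) = n \<Longrightarrow> pole_bounded p v n (of_nat p * s) (witt_frob p a) \<longleftrightarrow> pole_bounded p v n s a"
proof -
  have "- (of_nat p * s) \<le> c * (of_nat p * r) \<longleftrightarrow> - s \<le> c * r" for c r :: rat
  proof -
    have "- s * of_nat p \<le> (c * r) * of_nat p \<longleftrightarrow> - s \<le> c * r"
      using p_pos by (subst mult_le_cancel_right_pos) simp_all
    then show ?thesis by (simp add: mult_ac)
  qed
  then show "length a = n \<Longrightarrow> ?thesis"
    using p_pos by (auto simp: pole_bounded_iff witt_frob_def v_power)
qed

lemma pole_bounded_wp:
  assumes "length a = n" "0 \<le> s" "pole_bounded p v n s a"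
  shows "pole_bounded p v n (of_nat p * s) (witt_wp p a)"
proof -
  have "s \<le> of_nat p * s" using assms(2) p_pos by (simp add: mult_le_cancel_right1)
  then have "pole_bounded p v n (of_nat p * s) (inv\<^bsub>witt p n\<^esub> a)"
    using assms by (intro pole_bounded_mono[OF pole_bounded_inv])
  then show ?thesis
    unfolding witt_wp_eq[OF assms(1)] using assms(1,3) W.inv_closed[of a n]
    by (intro pole_bounded_add) (simp_all add: pole_bounded_frob, simp add: witt_frob_def)
qed

text \<open>If \<open>t\<close> is the pole order of \<open>a\<close>, that of \<open>F a = \<wp> a + a\<close> is \<open>p t\<close>, but also at most \<open>max s t\<close>.\<close>

lemma pole_bounded_wpD:
  assumes "length a = n" "0 \<le> s" "pole_bounded p v n s (witt_wp p a)"
  shows "pole_bounded p v n (s / of_nat p) a"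
proof -
  let ?t = "pole_order p v n a"
  have "pole_bounded p v n (max s ?t) (witt_frob p a)"
    unfolding frob_eq_wp[OF char_p assms(1)]
    using assms pole_order_nonneg[of p v n a]
    by (intro pole_bounded_add length_witt_wp[OF char_p] pole_bounded_mono[OF assms(3)])
      (auto simp: pole_bounded_iff_order)
  then have "pole_bounded p v n (of_nat p * (max s ?t / of_nat p)) (witt_frob p a)"
    using p_pos by simp
  then have "?t \<le> max s ?t / of_nat p"
    unfolding pole_bounded_frob[OF assms(1)]
    using assms(2) by (subst (asm) pole_bounded_iff_order) auto
  then have "of_nat p * ?t \<le> max s ?t" using p_pos by (simp add: field_simps)
  moreover have "?t < of_nat p * ?t" if "s < ?t" using that assms(2) p_gt_1 by simp
  ultimately have "of_nat p * ?t \<le> s" by (cases "s < ?t") auto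
  then have "?t \<le> s / of_nat p" using p_pos by (simp add: field_simps)
  then show ?thesis using assms(2) by (subst pole_bounded_iff_order) auto
qed

end

text \<open>Models d/dX on the completion, which does not lower the Gauss valuation because
  differentiating a polynomial multiplies its coefficients by integers.\<close>

locale valued_derivation = valued_witt p v + derivation D for p v and D :: "'c::field \<Rightarrow> 'c" +
  assumes deriv_val_ge: "val_ge v x s \<Longrightarrow> val_ge v (D x) s"
begin

text \<open>With k = p^(n-1-i) the i-th term is of degree k in the i-th entry and its derivative,
  both of valuation at least -s/k.\<close>

lemma wtheta_val_ge:
  assumes "length a = n" "n \<ge> 1" "pole_bounded p v n s a"
  shows "val_ge v (wtheta p D (n - 1) ((!) a)) (- s)"
  unfolding wtheta_def
proof (rule val_ge_sum)
  fix i assume i: "i \<in> {..n - 1}"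
  define k where "k = p ^ (n - 1 - i)"
  have k: "k \<ge> 1" using p_pos by (simp add: k_def Suc_leI)
  have a: "val_ge v (a ! i) (- s / of_nat k)"
  proof -
    have "a ! i = 0 \<or> - s \<le> of_nat k * v (a ! i)"
      using assms(2,3) i by (cases "a ! i = 0") (auto simp: pole_bounded_iff k_def)
    then show ?thesis
      using k unfolding val_ge_def by (subst pos_divide_le_eq) (simp_all add: mult.commute)
  qed
  have "val_ge v (a ! i ^ (k - 1) * D (a ! i)) (of_nat (k - 1) * (- s / of_nat k) + - s / of_nat k)"
    by (intro val_ge_mult val_ge_power deriv_val_ge a)
  also have "of_nat (k - 1) * (- s / of_nat k) + - s / of_nat k = - s"
    using k by (simp add: of_nat_diff field_simps)
  finally show "val_ge v (a ! i ^ (p ^ (n - 1 - i) - 1) * D (a ! i)) (- s)" by (simp add: k_def)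
qed

lemma deriv_power_p: "D (x ^ p) = 0"
  using of_nat_CHAR[where ?'a = 'c] by (simp add: deriv_power char_p)

lemma wtheta_cong: "(\<And>i. i \<le> n \<Longrightarrow> x i = y i) \<Longrightarrow> wtheta p D n x = wtheta p D n y"
  by (simp add: wtheta_def)

lemma wtheta_witt_add:
  assumes "length a = n" "length b = n" "n \<ge> 1"
  shows "wtheta p D (n - 1) ((!) (witt_add p a b)) =
    wtheta p D (n - 1) ((!) a) + wtheta p D (n - 1) ((!) b)"
proof -
  obtain x y where "a = wlist n x" "b = wlist n y" using assms(1,2) by (metis wlistE)
  moreover have "wtheta p D (n - 1) ((!) (wlist n z)) = wtheta p D (n - 1) z" for z
    using assms(3) by (intro wtheta_cong) auto
  ultimately show ?thesis by (simp add: witt_add_wlist wtheta_wadd[OF derivation_axioms])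
qed

text \<open>The form vanishes on F a because D kills p-th powers, so \<wp> = F - id acts as
  -id.\<close>

lemma wtheta_wp:
  assumes "length a = n" "n \<ge> 1"
  shows "wtheta p D (n - 1) ((!) (witt_wp p a)) = - wtheta p D (n - 1) ((!) a)"
proof -
  have "wtheta p D (n - 1) ((!) (witt_frob p a)) = 0"
    unfolding wtheta_def using assms by (intro sum.neutral) (auto simp: witt_frob_def deriv_power_p)
  then show ?thesis
    using wtheta_witt_add[OF length_witt_wp[OF char_p assms(1)] assms] frob_eq_wp[OF char_p assms(1)]
    by (simp add: eq_neg_iff_add_eq_0)
qed

end

section \<open>The derivation of a rational function field and the Cartier operator\<close>

text \<open>Two fractions for the same element satisfy a d = c b; differentiating this relation
  shows that the quotient rule gives the same result for both.\<close>

lemma fract_deriv_Fract: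
  assumes "b \<noteq> 0"
  shows "fract_deriv (Fract a b) = Fract (pderiv a * b - a * pderiv b) (b * b)"
  unfolding fract_deriv_def
proof (rule the_equality)
  fix r assume "\<exists>c d. d \<noteq> 0 \<and> Fract a b = Fract c d \<and> r = Fract (pderiv c * d - c * pderiv d) (d * d)"
  then obtain c d where cd: "d \<noteq> 0" "Fract a b = Fract c d"
    and r: "r = Fract (pderiv c * d - c * pderiv d) (d * d)" by blast
  have eq: "a * d = c * b" using cd assms by (simp add: eq_fract)
  then have "pderiv (a * d) = pderiv (c * b)" by simp
  then have "pderiv a * d + a * pderiv d = pderiv c * b + c * pderiv b"
    by (simp add: pderiv_mult algebra_simps)
  then have d: "pderiv a * d = pderiv c * b + c * pderiv b - a * pderiv d"
    by (simp add: algebra_simps)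
  have "(pderiv c * d - c * pderiv d) * (b * b) = (pderiv a * b - a * pderiv b) * (d * d)"
  proof -
    have "(pderiv a * b - a * pderiv b) * (d * d) = b * d * (pderiv a * d) - d * pderiv b * (a * d)"
      by (simp add: algebra_simps)
    also have "\<dots> = b * d * (pderiv c * b + c * pderiv b) - b * pderiv d * (a * d) - d * pderiv b * (a * d)"
      unfolding d by (simp add: algebra_simps)
    also have "\<dots> = (pderiv c * d - c * pderiv d) * (b * b)"
      unfolding eq by (simp add: algebra_simps)
    finally show ?thesis by simp
  qed
  then show "r = Fract (pderiv a * b - a * pderiv b) (b * b)"
    using assms cd by (simp add: r eq_fract)
qed (use assms in blast)

lemma derivation_fract_deriv: "derivation (fract_deriv :: 'a::field poly fract \<Rightarrow> _)"
proof
  fix f g :: "'a poly fract"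
  obtain a b where f: "f = Fract a b" "b \<noteq> 0" by (cases f) auto
  obtain c d where g: "g = Fract c d" "d \<noteq> 0" by (cases g) auto
  show "fract_deriv (f + g) = fract_deriv f + fract_deriv g"
    using f g by (simp add: fract_deriv_Fract eq_fract pderiv_mult pderiv_add algebra_simps)
  show "fract_deriv (f * g) = f * fract_deriv g + fract_deriv f * g"
    using f g by (simp add: fract_deriv_Fract eq_fract pderiv_mult algebra_simps)
qed

global_interpretation fract_deriv: derivation fract_deriv
  by (rule derivation_fract_deriv)

lemma fract_deriv_to_fract: "fract_deriv (to_fract a) = to_fract (pderiv a)"
  by (simp add: to_fract_def fract_deriv_Fract)

lemma to_fract_power: "to_fract (a ^ k) = to_fract a ^ k"
  by (induction k) simp_all

lemma of_nat_to_fract: "(of_nat k :: 'a::idom fract) = to_fract (of_nat k)"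
  by (simp add: to_fract_def Fract_of_nat_eq)

lemma CHAR_poly_fract: "CHAR('a::field poly fract) = CHAR('a)"
  by (rule CHAR_eqI) (simp_all add: of_nat_to_fract of_nat_eq_0_iff_char_dvd)

locale cartier_field =
  fixes p :: nat and ty :: "'k::alg_closed_field itself"
  assumes prime_p: "Factorial_Ring.prime p" and char_k: "CHAR('k) = p"
begin

abbreviation xvar :: "'k poly fract" where "xvar \<equiv> to_fract [:0, 1:]"

text \<open>A relation, because \<open>cartier\<close> is a definite description. The calculus below
  produces pairs, and uniqueness turns a pair into a value of \<open>cartier\<close>.\<close>

definition Car :: "'k poly fract \<Rightarrow> 'k poly fract \<Rightarrow> bool" where
  "Car \<omega> g \<longleftrightarrow> (\<exists>f. \<omega> = (\<Sum>j<p. f j ^ p * xvar ^ j) \<and> g = f (p - 1))"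

lemma p_pos: "p > 0"
  using prime_p by (rule prime_gt_0_nat)

lemma char_fract: "CHAR('k poly fract) = p"
  by (simp add: CHAR_poly_fract char_k)

lemma of_nat_eq_0: "(of_nat k :: 'k poly fract) = 0 \<longleftrightarrow> p dvd k"
  by (simp add: of_nat_eq_0_iff_char_dvd char_fract)

sublocale frob: unital_hom "\<lambda>x :: 'k poly fract. x ^ p"
  by standard (use prime_p in \<open>simp_all add: freshmans_dream char_fract power_mult_distrib\<close>)

lemma frob_inj: "(x :: 'k poly fract) ^ p = y ^ p \<Longrightarrow> x = y"
  using frob.hom_diff[of x y] p_pos by simp

lemma fract_deriv_power_p: "fract_deriv ((f :: 'k poly fract) ^ p) = 0"
  using of_nat_eq_0[of p] by (simp add: fract_deriv.deriv_power)

lemma fract_deriv_power_p_mult: "fract_deriv ((f :: 'k poly fract) ^ p * g) = f ^ p * fract_deriv g"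
  by (simp add: fract_deriv.deriv_mult fract_deriv_power_p)

lemma fract_deriv_xvar: "fract_deriv xvar = 1"
  by (simp add: fract_deriv_to_fract pderiv_pCons one_pCons flip: to_fract_1)

text \<open>For m > j the product contains the factor j - j = 0, so the truncated exponent does no
  harm.\<close>

lemma iterated_deriv_power_xvar:
  "(fract_deriv ^^ m) (xvar ^ j) = of_nat (\<Prod>i<m. j - i) * xvar ^ (j - m)"
proof (induction m)
  case (Suc m)
  have "(fract_deriv ^^ Suc m) (xvar ^ j) = of_nat (\<Prod>i<m. j - i) * fract_deriv (xvar ^ (j - m))"
    by (simp add: Suc fract_deriv.deriv_of_nat_mult del: of_nat_prod)
  also have "\<dots> = of_nat (\<Prod>i<Suc m. j - i) * xvar ^ (j - Suc m)"
    by (simp add: fract_deriv.deriv_power fract_deriv_xvar mult.assoc)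
  finally show ?case .
qed simp

text \<open>Apply the \<open>(p-1)\<close>-st power of \<open>d/dx\<close>, which is linear over \<open>p\<close>-th powers and kills
  \<open>x\<^sup>j\<close> for \<open>j < p - 1\<close> but not for \<open>j = p - 1\<close>.\<close>

lemma Car_unique:
  assumes "Car \<omega> g" "Car \<omega> h" shows "g = h"
proof -
  define N where "N = (\<Prod>i<p - 1. p - 1 - i)"
  have key: "(fract_deriv ^^ (p - 1)) \<omega> = g ^ p * of_nat N" if c: "Car \<omega> g" for g
  proof -
    obtain f where f: "\<omega> = (\<Sum>j<p. f j ^ p * xvar ^ j)" "g = f (p - 1)" using c unfolding Car_def by blast
    have lin: "(fract_deriv ^^ m) (\<Sum>j<p. f j ^ p * xvar ^ j) = (\<Sum>j<p. f j ^ p * (fract_deriv ^^ m) (xvar ^ j))" for m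
      by (induction m) (simp_all add: fract_deriv.deriv_sum fract_deriv_power_p_mult)
    have z: "f j ^ p * (fract_deriv ^^ (p - 1)) (xvar ^ j) = 0" if "j \<in> {..<p - 1}" for j
    proof -
      have "(\<Prod>i<p - 1. j - i) = 0" using that by auto
      then show ?thesis by (simp only: iterated_deriv_power_xvar) simp
    qed
    then have "(\<Sum>j<p - 1. f j ^ p * (fract_deriv ^^ (p - 1)) (xvar ^ j)) = 0" by (intro sum.neutral) blast
    moreover have "{..<p} = insert (p - 1) {..<p - 1}" using p_pos by auto
    ultimately have "(fract_deriv ^^ (p - 1)) \<omega> = f (p - 1) ^ p * (fract_deriv ^^ (p - 1)) (xvar ^ (p - 1))"
      unfolding f(1) lin by simp
    also have "\<dots> = g ^ p * of_nat N" unfolding iterated_deriv_power_xvar N_def f(2) by simp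
    finally show ?thesis .
  qed
  have "\<not> p dvd N"
    unfolding N_def using prime_p by (auto simp: prime_dvd_prod_iff dest!: dvd_imp_le)
  moreover have "g ^ p * of_nat N = h ^ p * of_nat N" using key[OF assms(1)] key[OF assms(2)] by simp
  ultimately have "g ^ p = h ^ p" using of_nat_eq_0[of N] by simp
  then show ?thesis by (rule frob_inj)
qed

lemma cartier_eqI: assumes "Car \<omega> g" shows "cartier p \<omega> = g"
  unfolding cartier_def Car_def[symmetric] by (rule the_equality[where P = "Car \<omega>"]) (use assms Car_unique in blast)+

lemma Car_add: "Car \<omega> g \<Longrightarrow> Car \<omega>' g' \<Longrightarrow> Car (\<omega> + \<omega>') (g + g')"
proof -
  assume "Car \<omega> g" "Car \<omega>' g'"
  then obtain f f' where "\<omega> = (\<Sum>j<p. f j ^ p * xvar ^ j)" "g = f (p - 1)"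
    "\<omega>' = (\<Sum>j<p. f' j ^ p * xvar ^ j)" "g' = f' (p - 1)" unfolding Car_def by blast
  then show ?thesis
    unfolding Car_def by (intro exI[of _ "\<lambda>j. f j + f' j"])
      (simp add: frob.hom_add algebra_simps sum.distrib)
qed

lemma Car_power_p_mult: "Car \<omega> g \<Longrightarrow> Car (h ^ p * \<omega>) (h * g)"
  unfolding Car_def
proof (elim exE conjE)
  fix f assume "\<omega> = (\<Sum>j<p. f j ^ p * xvar ^ j)" "g = f (p - 1)"
  then show "\<exists>f. h ^ p * \<omega> = (\<Sum>j<p. f j ^ p * xvar ^ j) \<and> h * g = f (p - 1)"
    by (intro exI[of _ "\<lambda>j. h * f j"]) (simp add: power_mult_distrib sum_distrib_left mult.assoc)
qed

lemma Car_zero: "Car 0 0"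
  using p_pos by (auto simp: Car_def power_0_left intro!: exI[of _ "\<lambda>_. 0"])

lemma Car_minus: "Car \<omega> g \<Longrightarrow> Car (- \<omega>) (- g)"
  using Car_power_p_mult[of \<omega> g "-1"] frob.hom_minus[of 1] by simp

lemma Car_of_nat_mult: "Car \<omega> 0 \<Longrightarrow> Car (of_nat k * \<omega>) 0"
proof (induction k)
  case (Suc k)
  then show ?case using Car_add[of \<omega> 0 "of_nat k * \<omega>" 0] by (simp add: algebra_simps)
qed (simp add: Car_zero)

lemma Car_sum: "(\<And>x. x \<in> A \<Longrightarrow> Car (f x) (g x)) \<Longrightarrow> Car (sum f A) (sum g A)"
  by (induction A rule: infinite_finite_induct) (simp_all add: Car_zero Car_add)

lemma Car_power_xvar:
  assumes "j < p" shows "Car (xvar ^ j) (if j = p - 1 then 1 else 0)"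
proof -
  have "(\<Sum>i<p. (if i = j then 1 else 0) ^ p * xvar ^ i) = (\<Sum>i<p. if i = j then xvar ^ i else 0)"
    by (intro sum.cong) (use p_pos in \<open>auto simp: power_0_left\<close>)
  also have "\<dots> = xvar ^ j" using assms by simp
  finally show ?thesis
    unfolding Car_def by (intro exI[of _ "\<lambda>i. if i = j then 1 else 0"]) auto
qed

lemma const_power_p: obtains d :: 'k where "d ^ p = c"
  using nth_root_exists[of p c] p_pos by blast

text \<open>Multiplying by the p-th power of the denominator reduces u to a polynomial. As constants
  are p-th powers, each monomial is a p-th power times x^r with r < p, and r x^(r-1) never reaches
  the exponent p - 1.\<close>

lemma Car_deriv: "Car (fract_deriv u) 0"
proof -
  have xv: "Car (fract_deriv (xvar ^ r)) 0" if "r < p" for r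
    using Car_of_nat_mult[OF Car_power_xvar[of "r - 1", THEN back_subst[where P = "Car _"]], of r] that
    by (cases "r = 0") (auto simp: fract_deriv.deriv_power fract_deriv_xvar fract_deriv.deriv_one Car_zero)
  have mono: "Car (fract_deriv (to_fract (monom c i))) 0" for c :: 'k and i
  proof -
    obtain d where d: "d ^ p = c" by (rule const_power_p)
    have "monom c i = [:d ^ p:] * [:0, 1:] ^ i" by (simp add: monom_altdef d)
    then have "monom c i = ([:d:] * [:0, 1:] ^ (i div p)) ^ p * [:0, 1:] ^ (i mod p)"
      by (simp only: power_mult_distrib poly_const_pow power_mult[symmetric] mult.assoc
          power_add[symmetric] div_mult_mod_eq)
    then have "to_fract (monom c i) = to_fract ([:d:] * [:0, 1:] ^ (i div p)) ^ p * xvar ^ (i mod p)"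
      by (simp only: to_fract_mult to_fract_power)
    then show ?thesis using Car_power_p_mult[OF xv[of "i mod p"]] p_pos
      by (simp add: fract_deriv_power_p_mult)
  qed
  have poly: "Car (fract_deriv (to_fract a)) 0" for a :: "'k poly"
  proof -
    have "fract_deriv (to_fract a) =
        (\<Sum>i\<le>Polynomial.degree a. fract_deriv (to_fract (monom (poly.coeff a i) i)))"
      by (subst poly_as_sum_of_monoms[symmetric]) (simp add: fract_deriv.deriv_sum)
    then show ?thesis using Car_sum[of "{..Polynomial.degree a}" _ "\<lambda>_. 0", OF mono] by simp
  qed
  obtain a b where u: "u = Fract a b" "b \<noteq> 0" by (cases u) auto
  have "u = inverse (to_fract b) ^ p * to_fract (a * b ^ (p - 1))"
    using u p_pos by (cases p) (simp_all add: Fract_conv_to_fract to_fract_power field_simps)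
  then show ?thesis using Car_power_p_mult[OF poly[of "a * b ^ (p - 1)"], of "inverse (to_fract b)"]
    by (simp add: fract_deriv_power_p_mult)
qed

text \<open>Fixedness of du/u under the Cartier operator. Through u^(p-1) du = u^p (du/u) it yields
  the value du on u^(p-1) du.\<close>

definition log_fixed :: "'k poly fract \<Rightarrow> bool" where
  "log_fixed u \<longleftrightarrow> Car (fract_deriv u / u) (fract_deriv u / u)"

lemma log_fixed_mult:
  assumes "log_fixed u" "log_fixed w" "u \<noteq> 0" "w \<noteq> 0" shows "log_fixed (u * w)"
proof -
  have "fract_deriv (u * w) / (u * w) = fract_deriv u / u + fract_deriv w / w"
    using assms by (simp add: fract_deriv.deriv_mult field_simps)
  then show ?thesis using assms Car_add by (simp add: log_fixed_def)
qed

lemma log_fixed_inverse: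
  assumes "log_fixed u" "u \<noteq> 0" shows "log_fixed (inverse u)"
proof -
  have "0 = fract_deriv (u * inverse u)" using assms by (simp add: fract_deriv.deriv_one)
  then have "u * fract_deriv (inverse u) = - (fract_deriv u / u)"
    unfolding fract_deriv.deriv_mult by (simp add: divide_inverse eq_neg_iff_add_eq_0)
  then have "fract_deriv (inverse u) / inverse u = - (fract_deriv u / u)"
    by (simp add: divide_inverse mult.commute)
  then show ?thesis using assms Car_minus by (simp add: log_fixed_def)
qed

lemma log_fixed_const: "log_fixed (to_fract [:c:])"
  by (simp add: log_fixed_def fract_deriv_to_fract pderiv_pCons Car_zero)

text \<open>For t = x - c one has 1/t = t^(-p) t^(p-1). In the binomial expansion of t^(p-1) all
  coefficients are p-th powers and the top one is 1, so its Cartier image is 1. The p-th root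
  \<open>d q\<close> of 1 is itself 1 because Frobenius is injective.\<close>

lemma log_fixed_linear: "log_fixed (to_fract [:- c, 1:])"
proof -
  let ?t = "to_fract [:- c, 1:]"
  define q where "q = p - 1"
  have p: "p = Suc q" using p_pos by (simp add: q_def)
  have t0: "?t \<noteq> 0" by simp
  have "Car (?t ^ q) 1"
  proof -
    have "\<exists>d. d ^ p = of_nat (q choose k) * (- c) ^ (q - k)" for k by (metis const_power_p)
    then obtain d where d: "\<And>k. d k ^ p = of_nat (q choose k) * (- c) ^ (q - k)" by metis
    have "[:- c, 1:] ^ q = ([:0, 1:] + [:- c:]) ^ q" by simp
    also have "\<dots> = (\<Sum>k\<le>q. [:d k:] ^ p * [:0, 1:] ^ k)"
      unfolding binomial_ring
      by (intro sum.cong refl) (simp add: poly_const_pow d of_nat_poly mult_ac)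
    finally have "?t ^ q = (\<Sum>k<p. to_fract [:d k:] ^ p * xvar ^ k)"
      by (simp add: p lessThan_Suc_atMost flip: to_fract_power to_fract_mult to_fract_sum)
    then have "Car (?t ^ q) (to_fract [:d q:])" by (auto simp: Car_def q_def)
    moreover have "to_fract [:d q:] ^ p = 1 ^ p"
      using d[of q] by (simp add: poly_const_pow one_pCons flip: to_fract_power to_fract_1)
    ultimately show ?thesis by (metis frob_inj)
  qed
  then have "Car (inverse ?t ^ p * ?t ^ q) (inverse ?t * 1)" by (rule Car_power_p_mult)
  moreover have "inverse ?t ^ p * ?t ^ q = inverse ?t" using t0 by (simp add: p field_simps)
  moreover have "fract_deriv ?t = 1"
    by (simp add: fract_deriv_to_fract pderiv_pCons one_pCons flip: to_fract_1)
  ultimately show ?thesis by (simp add: log_fixed_def divide_inverse)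
qed

text \<open>Over an algebraically closed field a rational function is a constant times linear
  factors and inverses of such, and du/u is additive along products.\<close>

lemma log_fixed_nonzero: assumes "u \<noteq> 0" shows "log_fixed u"
proof -
  have poly: "log_fixed (to_fract a)" if "a \<noteq> 0" for a :: "'k poly"
  proof -
    obtain A where A: "a = Polynomial.smult (Polynomial.lead_coeff a) (\<Prod>x\<in>#A. [:- x, 1:])"
      using alg_closed_imp_factorization[OF \<open>a \<noteq> 0\<close>] by blast
    have "log_fixed (to_fract (\<Prod>x\<in>#A. [:- x, 1:])) \<and> (\<Prod>x\<in>#A. [:- x, 1:]) \<noteq> 0"
    proof (induction A)
      case empty
      show ?case using log_fixed_const[of 1] by (simp add: one_pCons)
    next
      case (add x A)
      let ?q = "\<Prod>x\<in>#A. [:- x, 1:]"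
      have "log_fixed (to_fract [:- x, 1:] * to_fract ?q)"
        using add by (intro log_fixed_mult log_fixed_linear) (simp_all only: to_fract_eq_0_iff, simp_all)
      moreover have "[:- x, 1:] * ?q \<noteq> 0" using add by (simp only: mult_eq_0_iff) simp
      ultimately show ?case by (simp only: to_fract_mult[symmetric] image_mset_add_mset prod_mset.add_mset not_False_eq_True simp_thms)
    qed
    moreover have "to_fract a = to_fract [:Polynomial.lead_coeff a:] * to_fract (\<Prod>x\<in>#A. [:- x, 1:])"
      by (subst A) (simp flip: to_fract_mult)
    ultimately show ?thesis using that
      by (metis log_fixed_const log_fixed_mult mult_eq_0_iff to_fract_eq_0_iff)
  qed
  obtain a b where u: "u = Fract a b" "b \<noteq> 0" by (cases u) auto
  with assms have "a \<noteq> 0" by (auto simp: fract_collapse)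
  then have "log_fixed (to_fract a * inverse (to_fract b))"
    using u by (intro log_fixed_mult log_fixed_inverse poly) auto
  then show ?thesis by (simp add: u Fract_conv_to_fract divide_inverse)
qed

lemma Car_power_deriv: "Car (u ^ (p - 1) * fract_deriv u) (fract_deriv u)"
proof (cases "u = 0")
  case False
  have "u ^ p * (fract_deriv u / u) = u ^ (p - 1) * fract_deriv u"
    using False p_pos by (cases p) simp_all
  then show ?thesis
    using Car_power_p_mult[of "fract_deriv u / u" "fract_deriv u / u" u] log_fixed_nonzero[OF False] False
    by (simp add: log_fixed_def)
qed (simp add: fract_deriv.deriv_zero Car_zero)

text \<open>p^(m+1) - 1 = p (p^m - 1) + (p - 1) splits off a p-th power, which the Cartier operator
  lets through as its p-th root.\<close>

lemma Car_power_p_power_deriv: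
  "Car (u ^ (p ^ Suc m - 1) * fract_deriv u) (u ^ (p ^ m - 1) * fract_deriv u)"
proof -
  have "p * (p ^ m - 1) + (p - 1) = p ^ Suc m - 1"
    using p_pos by (simp add: diff_mult_distrib2)
  then have "u ^ (p ^ Suc m - 1) = (u ^ (p ^ m - 1)) ^ p * u ^ (p - 1)"
    by (metis power_add power_mult mult.commute)
  then show ?thesis using Car_power_p_mult[OF Car_power_deriv[of u], of "u ^ (p ^ m - 1)"]
    by (simp add: mult.assoc)
qed

end

section \<open>The Gauss valuation, its completion and its residue field\<close>

locale residue_setting = K: valued \<nu> for \<nu> :: "'a::field \<Rightarrow> rat" +
  fixes red :: "'a \<Rightarrow> 'k::field" and pw :: "rat \<Rightarrow> 'a"
  assumes residue: "residue_map \<nu> red" and powers: "compatible_powers \<nu> pw"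
begin

lemma red_one: "red 1 = 1"
  and red_add: "val_ge \<nu> x 0 \<Longrightarrow> val_ge \<nu> y 0 \<Longrightarrow> red (x + y) = red x + red y"
  and red_mult: "val_ge \<nu> x 0 \<Longrightarrow> val_ge \<nu> y 0 \<Longrightarrow> red (x * y) = red x * red y"
  and red_eq_0_iff: "val_ge \<nu> x 0 \<Longrightarrow> red x = 0 \<longleftrightarrow> val_pos \<nu> x"
  using residue by (auto simp: residue_map_def)

lemma red_zero: "red 0 = 0"
  by (simp add: red_eq_0_iff val_pos_def)

lemma red_sum: "(\<And>x. x \<in> A \<Longrightarrow> val_ge \<nu> (f x) 0) \<Longrightarrow> red (sum f A) = (\<Sum>x\<in>A. red (f x))"
  by (induction A rule: infinite_finite_induct) (simp_all add: red_zero red_add K.val_ge_sum)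

lemma red_minus: "val_ge \<nu> x 0 \<Longrightarrow> red (- x) = - red x"
  using red_add[of x "- x"] by (simp add: red_zero eq_neg_iff_add_eq_0 add.commute)

lemma red_of_nat: "red (of_nat k) = of_nat k"
  by (induction k) (simp_all add: red_zero red_one red_add K.val_ge_of_nat K.val_ge_one)

section \<open>The value group, and the Gauss valuation of polynomials\<close>

abbreviation "VG \<equiv> value_group \<nu>"

lemma VG_val: "x \<noteq> 0 \<Longrightarrow> \<nu> x \<in> VG"
  by (simp add: value_group_def)

lemma VG_zero: "0 \<in> VG"
  using VG_val[of 1] by (simp add: K.v_one)

lemma VG_add: "s \<in> VG \<Longrightarrow> t \<in> VG \<Longrightarrow> s + t \<in> VG"
  by (auto simp: value_group_def K.v_mult[symmetric])

lemma VG_minus: "s \<in> VG \<Longrightarrow> - s \<in> VG"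
  by (auto simp: value_group_def K.v_inverse[symmetric])

lemma VG_diff: "s \<in> VG \<Longrightarrow> t \<in> VG \<Longrightarrow> s - t \<in> VG"
  using VG_add[of s "- t"] VG_minus[of t] by simp

lemma VG_of_nat_mult: "s \<in> VG \<Longrightarrow> of_nat k * s \<in> VG"
  by (induction k) (simp_all add: VG_zero VG_add distrib_right)

lemma pw_nonzero: "s \<in> VG \<Longrightarrow> pw s \<noteq> 0"
  and val_pw: "s \<in> VG \<Longrightarrow> \<nu> (pw s) = s"
  and pw_add: "s \<in> VG \<Longrightarrow> t \<in> VG \<Longrightarrow> pw (s + t) = pw s * pw t"
  using powers by (auto simp: compatible_powers_def)

lemma pw_zero: "pw 0 = 1"
  using pw_add[of 0 0] pw_nonzero[of 0] VG_zero by simp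

lemma pw_of_nat_mult: "s \<in> VG \<Longrightarrow> pw (of_nat k * s) = pw s ^ k"
  by (induction k) (simp_all add: pw_zero distrib_right pw_add VG_of_nat_mult)

text \<open>Unlike \<open>gauss_poly\<close>, this is meaningful for the zero polynomial, so sums
  and differences need no case distinction.\<close>

definition poly_ge :: "'a poly \<Rightarrow> rat \<Rightarrow> bool" where
  "poly_ge f s \<longleftrightarrow> (\<forall>i. val_ge \<nu> (poly.coeff f i) s)"

abbreviation "redp \<equiv> map_poly red"

lemma coeff_redp: "poly.coeff (redp f) i = red (poly.coeff f i)"
  by (simp add: coeff_map_poly red_zero)

lemma poly_ge_zero [simp]: "poly_ge 0 s"
  by (simp add: poly_ge_def)

lemma poly_ge_add: "poly_ge f s \<Longrightarrow> poly_ge g s \<Longrightarrow> poly_ge (f + g) s"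
  by (simp add: poly_ge_def K.val_ge_add)

lemma poly_ge_diff: "poly_ge f s \<Longrightarrow> poly_ge g s \<Longrightarrow> poly_ge (f - g) s"
  by (simp add: poly_ge_def K.val_ge_diff)

lemma poly_ge_mult: "poly_ge f s \<Longrightarrow> poly_ge g t \<Longrightarrow> poly_ge (f * g) (s + t)"
  by (auto simp: poly_ge_def coeff_mult intro!: K.val_ge_sum K.val_ge_mult)

lemma poly_ge_mult_0: "poly_ge f 0 \<Longrightarrow> poly_ge g 0 \<Longrightarrow> poly_ge (f * g) 0"
  using poly_ge_mult[of f 0 g 0] by simp

lemma poly_ge_pderiv: "poly_ge f s \<Longrightarrow> poly_ge (pderiv f) s"
  unfolding poly_ge_def coeff_pderiv using K.val_ge_mult_0 K.val_ge_of_nat by blast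

lemma redp_add: "poly_ge f 0 \<Longrightarrow> poly_ge g 0 \<Longrightarrow> redp (f + g) = redp f + redp g"
  by (rule poly_eqI) (simp add: coeff_redp red_add poly_ge_def)

lemma redp_minus: "poly_ge f 0 \<Longrightarrow> redp (- f) = - redp f"
  by (rule poly_eqI) (simp add: coeff_redp red_minus poly_ge_def)

lemma redp_diff: "poly_ge f 0 \<Longrightarrow> poly_ge g 0 \<Longrightarrow> redp (f - g) = redp f - redp g"
  using redp_add[of f "- g"] redp_minus[of g] by (simp add: poly_ge_def)

lemma redp_mult: "poly_ge f 0 \<Longrightarrow> poly_ge g 0 \<Longrightarrow> redp (f * g) = redp f * redp g"
proof (rule poly_eqI)
  fix n assume fg: "poly_ge f 0" "poly_ge g 0"
  then have "val_ge \<nu> (poly.coeff f i * poly.coeff g (n - i)) 0" for i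
    unfolding poly_ge_def using K.val_ge_mult_0 by blast
  then show "poly.coeff (redp (f * g)) n = poly.coeff (redp f * redp g) n"
    using fg by (simp add: coeff_redp coeff_mult red_sum red_mult poly_ge_def)
qed

lemma redp_pderiv: "poly_ge f 0 \<Longrightarrow> redp (pderiv f) = pderiv (redp f)"
proof (rule poly_eqI)
  fix n assume "poly_ge f 0"
  then have "red (of_nat (Suc n) * poly.coeff f (Suc n)) = red (of_nat (Suc n)) * red (poly.coeff f (Suc n))"
    by (intro red_mult K.val_ge_of_nat) (simp add: poly_ge_def)
  then show "poly.coeff (redp (pderiv f)) n = poly.coeff (pderiv (redp f)) n"
    unfolding coeff_redp coeff_pderiv red_of_nat .
qed

lemma gauss_poly_ge_iff:
  assumes "f \<noteq> 0" shows "s \<le> gauss_poly \<nu> f \<longleftrightarrow> poly_ge f s"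
proof -
  have *: "set (Polynomial.coeffs f) - {0} = range (poly.coeff f) - {0}"
    using range_coeff[of f] by auto
  have "Polynomial.lead_coeff f \<in> set (Polynomial.coeffs f) - {0}" using assms unfolding * by simp
  then have "\<nu> ` (set (Polynomial.coeffs f) - {0}) \<noteq> {}" by blast
  then have "s \<le> gauss_poly \<nu> f \<longleftrightarrow> (\<forall>r\<in>\<nu> ` (set (Polynomial.coeffs f) - {0}). s \<le> r)"
    unfolding gauss_poly_def by (intro Min_ge_iff) auto
  then show ?thesis unfolding * poly_ge_def val_ge_def by auto
qed

lemma gauss_poly_attained:
  assumes "f \<noteq> 0" obtains i where "poly.coeff f i \<noteq> 0" "gauss_poly \<nu> f = \<nu> (poly.coeff f i)"
proof -
  have *: "set (Polynomial.coeffs f) - {0} = range (poly.coeff f) - {0}"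
    using range_coeff[of f] by auto
  have "Polynomial.lead_coeff f \<in> set (Polynomial.coeffs f) - {0}" using assms unfolding * by simp
  then have "gauss_poly \<nu> f \<in> \<nu> ` (set (Polynomial.coeffs f) - {0})"
    unfolding gauss_poly_def by (intro Min_in) auto
  then show ?thesis using that unfolding * by auto
qed

lemma gauss_poly_VG: "f \<noteq> 0 \<Longrightarrow> gauss_poly \<nu> f \<in> VG"
  by (metis gauss_poly_attained VG_val)

lemma gauss_poly_const: "c \<noteq> 0 \<Longrightarrow> gauss_poly \<nu> [:c:] = \<nu> c"
  by (simp add: gauss_poly_def)

lemma gauss_poly_smult:
  assumes "c \<noteq> 0" "f \<noteq> 0"
  shows "gauss_poly \<nu> (Polynomial.smult c f) = \<nu> c + gauss_poly \<nu> f"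
proof -
  have "s \<le> gauss_poly \<nu> (Polynomial.smult c f) \<longleftrightarrow> s \<le> \<nu> c + gauss_poly \<nu> f" for s
  proof -
    have "s \<le> gauss_poly \<nu> (Polynomial.smult c f) \<longleftrightarrow> poly_ge f (s - \<nu> c)"
      using assms by (simp add: gauss_poly_ge_iff poly_ge_def val_ge_def diff_le_eq)
        (metis K.v_mult add.commute)
    also have "\<dots> \<longleftrightarrow> s \<le> \<nu> c + gauss_poly \<nu> f"
      unfolding gauss_poly_ge_iff[OF assms(2), symmetric] by (simp add: algebra_simps)
    finally show ?thesis .
  qed
  then show ?thesis by (meson order_antisym order_refl)
qed

lemma redp_eq_0_iff:
  assumes "poly_ge f 0" "f \<noteq> 0" shows "redp f = 0 \<longleftrightarrow> gauss_poly \<nu> f \<noteq> 0"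
proof -
  have "redp f = 0 \<longleftrightarrow> (\<forall>i. val_pos \<nu> (poly.coeff f i))"
    using assms(1) by (simp add: poly_eq_iff coeff_redp red_eq_0_iff poly_ge_def)
  also have "\<dots> \<longleftrightarrow> gauss_poly \<nu> f > 0"
  proof
    assume "\<forall>i. val_pos \<nu> (poly.coeff f i)"
    then show "gauss_poly \<nu> f > 0" by (metis gauss_poly_attained[OF assms(2)] val_pos_def)
  next
    assume "gauss_poly \<nu> f > 0"
    moreover have "poly_ge f (gauss_poly \<nu> f)" using gauss_poly_ge_iff[OF assms(2)] by blast
    ultimately show "\<forall>i. val_pos \<nu> (poly.coeff f i)" unfolding poly_ge_def using val_posI by blast
  qed
  also have "\<dots> \<longleftrightarrow> gauss_poly \<nu> f \<noteq> 0"
    using assms gauss_poly_ge_iff[of f 0] by auto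
  finally show ?thesis .
qed

text \<open>The minimum is attained at a coefficient and therefore lies in \<open>VG\<close>, so
  there is a power of pi by which f can be divided.\<close>

lemma gauss_normalize:
  assumes "f \<noteq> 0"
  obtains c g where "c \<noteq> 0" "\<nu> c = gauss_poly \<nu> f" "f = Polynomial.smult c g" "g \<noteq> 0"
    "gauss_poly \<nu> g = 0" "poly_ge g 0" "redp g \<noteq> 0"
proof -
  define c where "c = pw (gauss_poly \<nu> f)"
  define g where "g = Polynomial.smult (inverse c) f"
  have c: "c \<noteq> 0" "\<nu> c = gauss_poly \<nu> f"
    using gauss_poly_VG[OF assms] by (simp_all add: c_def pw_nonzero val_pw)
  have g: "f = Polynomial.smult c g" "g \<noteq> 0" using c assms by (simp_all add: g_def)
  then have g0: "gauss_poly \<nu> g = 0" using gauss_poly_smult[of c g] c by simp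
  then have "poly_ge g 0" using gauss_poly_ge_iff[of g 0] g by simp
  then show ?thesis using that c g g0 redp_eq_0_iff by blast
qed

text \<open>After scaling, the reductions of the factors are nonzero, hence so is that of the product.\<close>

lemma gauss_poly_mult:
  assumes "f \<noteq> 0" "g \<noteq> 0"
  shows "gauss_poly \<nu> (f * g) = gauss_poly \<nu> f + gauss_poly \<nu> g"
proof -
  obtain c f' where f: "c \<noteq> 0" "\<nu> c = gauss_poly \<nu> f" "f = Polynomial.smult c f'" "f' \<noteq> 0"
    "poly_ge f' 0" "redp f' \<noteq> 0" using gauss_normalize[OF assms(1)] by metis
  obtain d g' where g: "d \<noteq> 0" "\<nu> d = gauss_poly \<nu> g" "g = Polynomial.smult d g'" "g' \<noteq> 0"
    "poly_ge g' 0" "redp g' \<noteq> 0" using gauss_normalize[OF assms(2)] by metis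
  have "redp (f' * g') \<noteq> 0" using f g by (simp add: redp_mult)
  then have "gauss_poly \<nu> (f' * g') = 0" using redp_eq_0_iff[of "f' * g'"] f g poly_ge_mult_0 by simp
  moreover have "f * g = Polynomial.smult (c * d) (f' * g')" using f(3) g(3) by (simp add: mult.commute)
  ultimately have "gauss_poly \<nu> (f * g) = \<nu> (c * d)"
    using gauss_poly_smult[of "c * d" "f' * g'"] f g by simp
  then show ?thesis using K.v_mult f(1,2) g(1,2) by simp
qed

lemma gauss_val_Fract:
  assumes "a \<noteq> 0" "b \<noteq> 0"
  shows "gauss_val \<nu> (Fract a b) = gauss_poly \<nu> a - gauss_poly \<nu> b"
  unfolding gauss_val_def
proof (rule the_equality)
  fix r assume "\<exists>c d. c \<noteq> 0 \<and> d \<noteq> 0 \<and> Fract a b = Fract c d \<and> r = gauss_poly \<nu> c - gauss_poly \<nu> d"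
  then obtain c d where cd: "c \<noteq> 0" "d \<noteq> 0" "Fract a b = Fract c d"
    "r = gauss_poly \<nu> c - gauss_poly \<nu> d" by blast
  then have "a * d = c * b" using assms by (simp add: eq_fract)
  then have "gauss_poly \<nu> a + gauss_poly \<nu> d = gauss_poly \<nu> c + gauss_poly \<nu> b"
    using gauss_poly_mult assms cd by metis
  then show "r = gauss_poly \<nu> a - gauss_poly \<nu> b" using cd by (simp add: algebra_simps)
qed (use assms in blast)

end

locale gauss_setting = residue_setting \<nu> red pw + valued v
  for \<nu> :: "'a::field \<Rightarrow> rat" and red :: "'a \<Rightarrow> 'k::field" and pw and v :: "'c::field \<Rightarrow> rat" +
  fixes \<iota> :: "'a poly fract \<Rightarrow> 'c"
  assumes completion: "gauss_completion \<nu> \<iota> v"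
begin

sublocale \<iota>: unital_hom \<iota>
  using completion by unfold_locales (simp_all add: gauss_completion_def)

lemma v_embed: "f \<noteq> 0 \<Longrightarrow> v (\<iota> f) = gauss_val \<nu> f"
  and complete: "val_complete v"
  and dense: "\<exists>f. val_ge v (x - \<iota> f) s"
  using completion by (simp_all add: gauss_completion_def)

lemma embed_eq_0_iff: "\<iota> f = 0 \<longleftrightarrow> f = 0"
proof
  assume "\<iota> f = 0"
  then have "\<iota> (f * inverse f) = 0" by (simp add: \<iota>.hom_mult)
  then show "f = 0" by (cases "f = 0") (simp_all add: \<iota>.hom_one)
qed (simp add: \<iota>.hom_zero)

lemma val_ge_embed:
  assumes "a \<noteq> 0" "b \<noteq> 0"
  shows "val_ge v (\<iota> (Fract a b)) s \<longleftrightarrow> s \<le> gauss_poly \<nu> a - gauss_poly \<nu> b"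
proof -
  have "Fract a b \<noteq> 0" using assms by (simp add: Zero_fract_def eq_fract)
  then show ?thesis using assms by (simp add: val_ge_def embed_eq_0_iff v_embed gauss_val_Fract)
qed

text \<open>The numerator of the quotient rule has valuation at least that of a plus that of b, and
  the denominator twice that of b. Zero numerators are set apart because \<open>gauss_poly\<close>
  says nothing about them.\<close>

lemma embed_deriv_val_ge:
  assumes "val_ge v (\<iota> f) s" shows "val_ge v (\<iota> (fract_deriv f)) s"
proof -
  obtain a b where f: "f = Fract a b" "b \<noteq> 0" by (cases f) auto
  show ?thesis
  proof (cases "a = 0 \<or> pderiv a * b - a * pderiv b = 0")
    case True
    then have "fract_deriv f = 0" using f by (auto simp: fract_deriv_Fract fract_collapse)
    then show ?thesis by (simp add: \<iota>.hom_zero)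
  next
    case False
    let ?N = "pderiv a * b - a * pderiv b"
    have a: "poly_ge a (gauss_poly \<nu> a)" and b: "poly_ge b (gauss_poly \<nu> b)"
      using False f gauss_poly_ge_iff by blast+
    have "poly_ge ?N (gauss_poly \<nu> a + gauss_poly \<nu> b)"
      by (intro poly_ge_diff poly_ge_mult poly_ge_pderiv a b)
    then have "gauss_poly \<nu> a + gauss_poly \<nu> b \<le> gauss_poly \<nu> ?N"
      using gauss_poly_ge_iff False by blast
    then show ?thesis
      using assms False f by (simp add: fract_deriv_Fract val_ge_embed gauss_poly_mult)
  qed
qed

section \<open>The continuous extension of d/dX to the completion\<close>

abbreviation "D \<equiv> compl_deriv \<iota> v"

lemma approximation: obtains u where "val_lim v (\<lambda>n. \<iota> (u n)) x"
proof -
  have "\<exists>u. \<forall>n. val_ge v (x - \<iota> (u n)) (of_nat n)" by (intro choice allI dense)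
  then obtain u where u: "\<And>n. val_ge v (x - \<iota> (u n)) (of_nat n)" by blast
  have "\<exists>M. \<forall>n\<ge>M. val_ge v (\<iota> (u n) - x) s" for s
  proof -
    obtain M :: nat where M: "s \<le> of_nat M" using real_arch_simple by blast
    have "val_ge v (\<iota> (u n) - x) s" if "n \<ge> M" for n
    proof -
      have "s \<le> of_nat n" using M that by (meson of_nat_le_iff order_trans)
      then have "val_ge v (- (x - \<iota> (u n))) s" using val_ge_mono[OF u] by (simp only: val_ge_minus_iff)
      then show ?thesis by simp
    qed
    then show ?thesis by blast
  qed
  then show ?thesis using that by (auto simp: val_lim_def)
qed

lemma val_lim_deriv_indep:
  assumes "val_lim v (\<lambda>n. \<iota> (u n)) x" "val_lim v (\<lambda>n. \<iota> (w n)) x"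
    and "val_lim v (\<lambda>n. \<iota> (fract_deriv (u n))) l"
  shows "val_lim v (\<lambda>n. \<iota> (fract_deriv (w n))) l"
  unfolding val_lim_def
proof
  fix s
  obtain M1 M2 M3 where M: "\<forall>n\<ge>M1. val_ge v (\<iota> (u n) - x) s" "\<forall>n\<ge>M2. val_ge v (\<iota> (w n) - x) s"
    "\<forall>n\<ge>M3. val_ge v (\<iota> (fract_deriv (u n)) - l) s"
    using assms unfolding val_lim_def by metis
  have "val_ge v (\<iota> (fract_deriv (w n)) - l) s" if n: "n \<ge> max M1 (max M2 M3)" for n
  proof -
    have "val_ge v ((\<iota> (w n) - x) - (\<iota> (u n) - x)) s" by (rule val_ge_diff) (use M n in \<open>auto\<close>)
    then have "val_ge v (\<iota> (w n - u n)) s" by (simp add: \<iota>.hom_diff)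
    then have "val_ge v (\<iota> (fract_deriv (w n - u n))) s" by (rule embed_deriv_val_ge)
    moreover have "val_ge v (\<iota> (fract_deriv (u n)) - l) s" using M n by simp
    ultimately have "val_ge v (\<iota> (fract_deriv (w n - u n)) + (\<iota> (fract_deriv (u n)) - l)) s"
      by (rule val_ge_add)
    then show ?thesis by (simp add: fract_deriv.deriv_diff \<iota>.hom_diff)
  qed
  then show "\<exists>M. \<forall>n\<ge>M. val_ge v (\<iota> (fract_deriv (w n)) - l) s" by blast
qed

text \<open>As differentiation does not lower valuations, it preserves Cauchy sequences, and the
  limit does not depend on the approximating sequence. This settles the definite
  description.\<close>

lemma compl_deriv_lim:
  assumes "val_lim v (\<lambda>n. \<iota> (u n)) x"
  shows "val_lim v (\<lambda>n. \<iota> (fract_deriv (u n))) (D x)"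
proof -
  have "val_Cauchy v (\<lambda>n. \<iota> (fract_deriv (u n)))"
    unfolding val_Cauchy_def
  proof
    fix s
    obtain M where M: "\<forall>n\<ge>M. val_ge v (\<iota> (u n) - x) s" using assms unfolding val_lim_def by metis
    have "val_ge v (\<iota> (fract_deriv (u m)) - \<iota> (fract_deriv (u n))) s" if "m \<ge> M" "n \<ge> M" for m n
    proof -
      have "val_ge v ((\<iota> (u m) - x) - (\<iota> (u n) - x)) s" by (rule val_ge_diff) (use M that in \<open>auto\<close>)
      then have "val_ge v (\<iota> (u m - u n)) s" by (simp add: \<iota>.hom_diff)
      then have "val_ge v (\<iota> (fract_deriv (u m - u n))) s" by (rule embed_deriv_val_ge)
      then show ?thesis by (simp add: fract_deriv.deriv_diff \<iota>.hom_diff)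
    qed
    then show "\<exists>M. \<forall>m\<ge>M. \<forall>n\<ge>M. val_ge v (\<iota> (fract_deriv (u m)) - \<iota> (fract_deriv (u n))) s" by blast
  qed
  then obtain l where l: "val_lim v (\<lambda>n. \<iota> (fract_deriv (u n))) l"
    using complete unfolding val_complete_def by blast
  have "D x = l"
    unfolding compl_deriv_def
  proof (rule the_equality)
    fix l' assume "\<forall>u. val_lim v (\<lambda>n. \<iota> (u n)) x \<longrightarrow> val_lim v (\<lambda>n. \<iota> (fract_deriv (u n))) l'"
    then show "l' = l" using assms l val_lim_unique by blast
  qed (use val_lim_deriv_indep[OF assms _ l] in blast)
  then show ?thesis using l by simp
qed

text \<open>The same precision s on both sides: identities for \<open>D\<close> can be checked on
  one approximation instead of a sequence.\<close>

lemma compl_deriv_approx: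
  assumes "val_ge v (x - \<iota> f) s" shows "val_ge v (D x - \<iota> (fract_deriv f)) s"
proof -
  obtain u where u: "val_lim v (\<lambda>n. \<iota> (u n)) x" by (rule approximation)
  obtain M1 M2 where M: "\<forall>n\<ge>M1. val_ge v (\<iota> (u n) - x) s"
    "\<forall>n\<ge>M2. val_ge v (\<iota> (fract_deriv (u n)) - D x) s"
    using u compl_deriv_lim[OF u] unfolding val_lim_def by metis
  define n where "n = max M1 M2"
  have "val_ge v ((\<iota> (u n) - x) + (x - \<iota> f)) s" by (rule val_ge_add) (use M assms in \<open>auto simp: n_def\<close>)
  then have "val_ge v (\<iota> (u n - f)) s" by (simp add: \<iota>.hom_diff)
  then have "val_ge v (\<iota> (fract_deriv (u n - f))) s" by (rule embed_deriv_val_ge)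
  then have "val_ge v (\<iota> (fract_deriv (u n - f)) - (\<iota> (fract_deriv (u n)) - D x)) s"
    by (rule val_ge_diff) (use M in \<open>auto simp: n_def\<close>)
  then show ?thesis by (simp add: fract_deriv.deriv_diff \<iota>.hom_diff)
qed

lemma compl_deriv_embed: "D (\<iota> f) = \<iota> (fract_deriv f)"
  using val_ge_all_zero[of v "D (\<iota> f) - \<iota> (fract_deriv f)"] compl_deriv_approx[of "\<iota> f" f] by simp

lemma compl_deriv_val_ge: assumes "val_ge v x s" shows "val_ge v (D x) s"
proof -
  obtain f where f: "val_ge v (x - \<iota> f) s" using dense by blast
  have "val_ge v (x - (x - \<iota> f)) s" using assms f by (rule val_ge_diff)
  then have "val_ge v (\<iota> (fract_deriv f)) s" by (intro embed_deriv_val_ge) simp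
  then have "val_ge v ((D x - \<iota> (fract_deriv f)) + \<iota> (fract_deriv f)) s"
    using compl_deriv_approx[OF f] by (intro val_ge_add)
  then show ?thesis by simp
qed

lemma derivation_compl_deriv: "derivation D"
proof
  fix x y
  show "D (x + y) = D x + D y"
  proof -
    have "val_ge v (D (x + y) - (D x + D y)) s" for s
    proof -
      obtain f g where fg: "val_ge v (x - \<iota> f) s" "val_ge v (y - \<iota> g) s" using dense by metis
      then have "val_ge v ((x - \<iota> f) + (y - \<iota> g)) s" by (rule val_ge_add)
      then have "val_ge v ((x + y) - \<iota> (f + g)) s" by (simp add: \<iota>.hom_add algebra_simps)
      then have "val_ge v ((D (x + y) - \<iota> (fract_deriv (f + g))) -
          ((D x - \<iota> (fract_deriv f)) + (D y - \<iota> (fract_deriv g)))) s"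
        by (rule val_ge_diff[OF compl_deriv_approx val_ge_add[OF compl_deriv_approx compl_deriv_approx]])
          (fact fg)+
      then show ?thesis by (simp add: fract_deriv.deriv_add \<iota>.hom_add algebra_simps)
    qed
    then show ?thesis using val_ge_all_zero[of v "D (x + y) - (D x + D y)"] by simp
  qed
  show "D (x * y) = x * D y + D x * y"
  proof -
    \<comment> \<open>A common lower bound for the valuations of x, y and their derivatives. The cap
      at 0 gives r <= s - r for s >= 0, so approximations of precision s - r obey it as well and
      products are accurate to precision s.\<close>
    define r where "r = min 0 (min (v x) (v y))"
    have r: "r \<le> 0" "val_ge v x r" "val_ge v y r" by (auto simp: r_def val_ge_def)
    have Dr: "val_ge v (D x) r" "val_ge v (D y) r" using r by (simp_all add: compl_deriv_val_ge)
    have *: "val_ge v (D (x * y) - (x * D y + D x * y)) s" if s: "s \<ge> 0" for s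
    proof -
      have mul: "val_ge v (a * b) s" if "val_ge v a r" "val_ge v b (s - r)" for a b
        using val_ge_mult[OF that] by simp
      obtain f g where fg: "val_ge v (x - \<iota> f) (s - r)" "val_ge v (y - \<iota> g) (s - r)" using dense by metis
      moreover have "r \<le> s - r" using r s by simp
      ultimately have "val_ge v (x - (x - \<iota> f)) r" "val_ge v (y - (y - \<iota> g)) r"
        using r val_ge_diff val_ge_mono by blast+
      then have fgr: "val_ge v (\<iota> f) r" "val_ge v (\<iota> g) r" by simp_all
      have "val_ge v (x * (y - \<iota> g) + \<iota> g * (x - \<iota> f)) s"
        by (intro val_ge_add mul r fgr fg)
      then have "val_ge v (x * y - \<iota> (f * g)) s" by (simp add: \<iota>.hom_mult algebra_simps)
      then have "val_ge v ((D (x * y) - \<iota> (fract_deriv (f * g)))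
          - (\<iota> f * (D y - \<iota> (fract_deriv g)) + D y * (x - \<iota> f)
            + (\<iota> g * (D x - \<iota> (fract_deriv f)) + D x * (y - \<iota> g)))) s"
        by (rule val_ge_diff[OF compl_deriv_approx val_ge_add[OF val_ge_add[OF mul mul] val_ge_add[OF mul mul]]])
          (fact fg fgr Dr | rule compl_deriv_approx)+
      then show ?thesis
        by (simp add: fract_deriv.deriv_mult \<iota>.hom_add \<iota>.hom_mult algebra_simps)
    qed
    have "val_ge v (D (x * y) - (x * D y + D x * y)) s" for s
      by (rule val_ge_mono[OF *[of "max s 0"]]) simp_all
    then show ?thesis using val_ge_all_zero[of v "D (x * y) - (x * D y + D x * y)"] by simp
  qed
qed

text \<open>An approximation of x to a precision better than v x has the same valuation, so
  completing does not enlarge the value group.\<close>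

lemma val_VG: assumes "x \<noteq> 0" shows "v x \<in> VG"
proof -
  obtain f where f: "val_ge v (x - \<iota> f) (v x + 1)" using dense by blast
  have "\<iota> f \<noteq> 0" using f assms by (auto simp: val_ge_def)
  moreover have "v (\<iota> f) = v x"
  proof (rule order_antisym)
    have "val_ge v (x - (x - \<iota> f)) (v x)"
      by (rule val_ge_diff[OF _ val_ge_mono[OF f]]) (simp_all add: val_ge_def)
    then show "v x \<le> v (\<iota> f)" using \<open>\<iota> f \<noteq> 0\<close> by (simp add: val_ge_def)
    show "v (\<iota> f) \<le> v x"
    proof (rule ccontr)
      assume less: "\<not> v (\<iota> f) \<le> v x"
      have "val_ge v ((x - \<iota> f) + \<iota> f) (min (v x + 1) (v (\<iota> f)))"
        by (rule val_ge_add[OF val_ge_mono[OF f]]) (simp_all add: val_ge_def)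
      then show False using assms less by (simp add: val_ge_def)
    qed
  qed
  moreover obtain a b where ab: "f = Fract a b" "b \<noteq> 0" by (cases f) auto
  moreover have "f \<noteq> 0" using \<open>\<iota> f \<noteq> 0\<close> embed_eq_0_iff by blast
  moreover from this have "a \<noteq> 0" using ab(1) by (auto simp: fract_collapse)
  ultimately show ?thesis
    using VG_diff[OF gauss_poly_VG[of a] gauss_poly_VG[of b]] by (simp add: v_embed gauss_val_Fract)
qed

text \<open>Relational form of \<open>gauss_red\<close>: sums, products and derivatives can be
  reduced without unfolding a definite description each time.\<close>

definition reduces :: "'c \<Rightarrow> 'k poly fract \<Rightarrow> bool" where
  "reduces f r \<longleftrightarrow> (\<exists>a b. poly_ge a 0 \<and> poly_ge b 0 \<and> redp b \<noteq> 0 \<and>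
     val_pos v (f - \<iota> (Fract a b)) \<and> r = Fract (redp a) (redp b))"

lemma redp_nonzero: "redp b \<noteq> 0 \<Longrightarrow> b \<noteq> 0"
  by auto

lemma integral_Fract:
  assumes "poly_ge a 0" "poly_ge b 0" "redp b \<noteq> 0" shows "val_ge v (\<iota> (Fract a b)) 0"
proof (cases "a = 0")
  case False
  then have "0 \<le> gauss_poly \<nu> a" using assms(1) gauss_poly_ge_iff by blast
  moreover have "b \<noteq> 0" using assms(3) by (rule redp_nonzero)
  moreover from this have "gauss_poly \<nu> b = 0" using assms(2,3) redp_eq_0_iff by blast
  ultimately show ?thesis using False by (simp add: val_ge_embed)
qed (simp add: fract_collapse \<iota>.hom_zero)

lemma reduces_val_ge: "reduces f r \<Longrightarrow> val_ge v f 0"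
  unfolding reduces_def
proof (elim exE conjE)
  fix a b assume "poly_ge a 0" "poly_ge b 0" "redp b \<noteq> 0" "val_pos v (f - \<iota> (Fract a b))"
  then have "val_ge v ((f - \<iota> (Fract a b)) + \<iota> (Fract a b)) 0"
    by (intro val_ge_add[OF val_pos_imp_ge integral_Fract])
  then show ?thesis by simp
qed

text \<open>Any positive precision would do for the approximation. Once the denominator is scaled to
  Gauss valuation 0, integrality of f forces the numerator to be integral.\<close>

lemma reduces_exists: assumes "val_ge v f 0" shows "\<exists>r. reduces f r"
proof -
  obtain g where g: "val_ge v (f - \<iota> g) 1" using dense by blast
  obtain a b where ab: "g = Fract a b" "b \<noteq> 0" by (cases g) auto
  obtain c b' where b': "c \<noteq> 0" "\<nu> c = gauss_poly \<nu> b" "b = Polynomial.smult c b'" "b' \<noteq> 0"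
    "gauss_poly \<nu> b' = 0" "poly_ge b' 0" "redp b' \<noteq> 0" by (rule gauss_normalize[OF ab(2)])
  define a' where "a' = Polynomial.smult (inverse c) a"
  have g': "g = Fract a' b'" using b'(1,4) by (simp add: ab(1) b'(3) eq_fract a'_def)
  have "val_ge v (f - (f - \<iota> g)) 0" by (rule val_ge_diff[OF assms val_ge_mono[OF g]]) simp
  then have "val_ge v (\<iota> g) 0" by simp
  then have "poly_ge a' 0"
    using b'(4,5) gauss_poly_ge_iff[of a' 0] by (cases "a' = 0") (simp_all add: g' val_ge_embed)
  moreover have "val_pos v (f - \<iota> (Fract a' b'))" using val_posI[OF g] by (simp add: g')
  ultimately show ?thesis using b'(6,7) unfolding reduces_def by blast
qed

text \<open>The common denominator b d has Gauss valuation 0, so the positive valuation of the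
  difference falls on a d - c b, whose reduction then vanishes.\<close>

lemma reduces_unique: assumes "reduces f r" "reduces f r'" shows "r = r'"
proof -
  obtain a b where 1: "poly_ge a 0" "poly_ge b 0" "redp b \<noteq> 0" "val_pos v (f - \<iota> (Fract a b))"
    "r = Fract (redp a) (redp b)" using assms(1) unfolding reduces_def by blast
  obtain c d where 2: "poly_ge c 0" "poly_ge d 0" "redp d \<noteq> 0" "val_pos v (f - \<iota> (Fract c d))"
    "r' = Fract (redp c) (redp d)" using assms(2) unfolding reduces_def by blast
  let ?N = "a * d - c * b"
  have nz: "b \<noteq> 0" "d \<noteq> 0" using 1 2 redp_nonzero by auto
  have bd: "poly_ge (b * d) 0" "redp (b * d) \<noteq> 0" using 1 2 by (simp_all add: poly_ge_mult_0 redp_mult)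
  then have g0: "gauss_poly \<nu> (b * d) = 0" using redp_eq_0_iff[of "b * d"] nz by simp
  have N: "poly_ge ?N 0" "redp ?N = redp a * redp d - redp c * redp b"
    using 1 2 by (simp_all add: poly_ge_diff poly_ge_mult_0 redp_diff redp_mult)
  have "val_pos v ((f - \<iota> (Fract c d)) - (f - \<iota> (Fract a b)))" by (rule val_pos_diff) (use 1 2 in simp_all)
  then have pos: "val_pos v (\<iota> (Fract ?N (b * d)))" using nz by (simp flip: \<iota>.hom_diff)
  have "redp ?N = 0"
  proof (cases "?N = 0")
    case False
    have bd0: "b * d \<noteq> 0" using nz by simp
    have F0: "Fract ?N (b * d) \<noteq> 0" unfolding Zero_fract_def using False bd0 by (subst eq_fract) simp_all
    have "v (\<iota> (Fract ?N (b * d))) = gauss_poly \<nu> ?N"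
      by (simp only: v_embed[OF F0] gauss_val_Fract[OF False bd0] g0 diff_zero)
    moreover have "\<iota> (Fract ?N (b * d)) \<noteq> 0" using F0 embed_eq_0_iff by blast
    ultimately have "gauss_poly \<nu> ?N > 0" using pos unfolding val_pos_def by metis
    then show ?thesis using redp_eq_0_iff[OF N(1) False] by simp
  qed simp
  then show ?thesis using 1 2 N by (simp add: eq_fract)
qed

lemma gauss_red_eqI: assumes "reduces f r" shows "gauss_red \<nu> red \<iota> v f = r"
proof -
  have "gauss_red \<nu> red \<iota> v f = (THE r. reduces f r)"
    by (simp only: gauss_red_def reduces_def poly_ge_def)
  then show ?thesis using the_equality[of "reduces f", OF assms reduces_unique[OF _ assms]] by simp
qed

lemma reduces_add:
  assumes "reduces f r" "reduces g s" shows "reduces (f + g) (r + s)"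
proof -
  obtain a b where 1: "poly_ge a 0" "poly_ge b 0" "redp b \<noteq> 0" "val_pos v (f - \<iota> (Fract a b))"
    "r = Fract (redp a) (redp b)" using assms(1) unfolding reduces_def by blast
  obtain c d where 2: "poly_ge c 0" "poly_ge d 0" "redp d \<noteq> 0" "val_pos v (g - \<iota> (Fract c d))"
    "s = Fract (redp c) (redp d)" using assms(2) unfolding reduces_def by blast
  have nz: "b \<noteq> 0" "d \<noteq> 0" using 1 2 redp_nonzero by auto
  have "val_pos v ((f - \<iota> (Fract a b)) + (g - \<iota> (Fract c d)))" by (rule val_pos_add) (use 1 2 in simp_all)
  then have "val_pos v (f + g - \<iota> (Fract a b + Fract c d))" by (simp add: \<iota>.hom_add algebra_simps)
  then show ?thesis unfolding reduces_def
    by (intro exI[of _ "a * d + c * b"] exI[of _ "b * d"])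
      (use 1 2 nz in \<open>simp add: poly_ge_add poly_ge_mult_0 redp_add redp_mult\<close>)
qed

lemma reduces_mult:
  assumes "reduces f r" "reduces g s" shows "reduces (f * g) (r * s)"
proof -
  obtain a b where 1: "poly_ge a 0" "poly_ge b 0" "redp b \<noteq> 0" "val_pos v (f - \<iota> (Fract a b))"
    "r = Fract (redp a) (redp b)" using assms(1) unfolding reduces_def by blast
  obtain c d where 2: "poly_ge c 0" "poly_ge d 0" "redp d \<noteq> 0" "val_pos v (g - \<iota> (Fract c d))"
    "s = Fract (redp c) (redp d)" using assms(2) unfolding reduces_def by blast
  have "val_pos v (f * (g - \<iota> (Fract c d)) + \<iota> (Fract c d) * (f - \<iota> (Fract a b)))"
    by (rule val_pos_add[OF val_pos_mult[OF reduces_val_ge[OF assms(1)]] val_pos_mult[OF integral_Fract]])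
      (use 1 2 in simp_all)
  moreover have "f * (g - \<iota> (Fract c d)) + \<iota> (Fract c d) * (f - \<iota> (Fract a b)) =
      f * g - \<iota> (Fract a b * Fract c d)"
    unfolding \<iota>.hom_mult by (simp add: algebra_simps)
  ultimately have "val_pos v (f * g - \<iota> (Fract a b * Fract c d))" by (simp only:)
  then show ?thesis unfolding reduces_def
    by (intro exI[of _ "a * c"] exI[of _ "b * d"])
      (use 1 2 in \<open>simp add: poly_ge_mult_0 redp_mult\<close>)
qed

lemma val_pos_deriv: "val_pos v x \<Longrightarrow> val_pos v (D x)"
  using compl_deriv_val_ge[of x "v x"] compl_deriv_val_ge[of 0 1]
  by (cases "x = 0") (auto simp: val_pos_def val_ge_def derivation.deriv_zero[OF derivation_compl_deriv])

text \<open>The error term keeps positive valuation under \<open>D\<close>, and reduction of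
  coefficients commutes with the quotient rule.\<close>

lemma reduces_deriv:
  assumes "reduces f r" shows "reduces (D f) (fract_deriv r)"
proof -
  obtain a b where 1: "poly_ge a 0" "poly_ge b 0" "redp b \<noteq> 0" "val_pos v (f - \<iota> (Fract a b))"
    "r = Fract (redp a) (redp b)" using assms(1) unfolding reduces_def by blast
  have "val_pos v (D (f - \<iota> (Fract a b)))" using 1 by (intro val_pos_deriv)
  then have "val_pos v (D f - \<iota> (fract_deriv (Fract a b)))"
    by (simp add: derivation.deriv_diff[OF derivation_compl_deriv] compl_deriv_embed)
  then show ?thesis unfolding reduces_def
    by (intro exI[of _ "pderiv a * b - a * pderiv b"] exI[of _ "b * b"])
      (use 1 redp_nonzero in \<open>simp add: poly_ge_mult_0 poly_ge_diff poly_ge_pderiv redp_mult redp_diff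
        redp_pderiv fract_deriv_Fract\<close>)
qed

lemma reduces_pos: "val_pos v f \<Longrightarrow> reduces f 0"
  unfolding reduces_def by (rule exI[of _ 0], rule exI[of _ 1])
    (auto simp: poly_ge_def K.val_ge_one map_poly_1 red_one fract_collapse \<iota>.hom_zero)

lemma reduces_one: "reduces 1 1"
  unfolding reduces_def by (rule exI[of _ 1], rule exI[of _ 1])
    (auto simp: poly_ge_def K.val_ge_one map_poly_1 red_one fract_collapse \<iota>.hom_one val_pos_def simp flip: one_pCons)

lemma reduces_power: "reduces f r \<Longrightarrow> reduces (f ^ k) (r ^ k)"
  by (induction k) (simp_all add: reduces_one reduces_mult)

lemma reduces_sum: "(\<And>x. x \<in> A \<Longrightarrow> reduces (f x) (g x)) \<Longrightarrow> reduces (sum f A) (sum g A)"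
  by (induction A rule: infinite_finite_induct) (simp_all add: reduces_add reduces_pos val_pos_def)

text \<open>The power pi^s inside the completion. Being a constant, it can be moved through
  \<open>D\<close>.\<close>

definition cpw :: "rat \<Rightarrow> 'c" where "cpw s = \<iota> (to_fract [:pw s:])"

lemma cpw_of_nat_mult: "s \<in> VG \<Longrightarrow> cpw (of_nat k * s) = cpw s ^ k"
  by (simp add: cpw_def pw_of_nat_mult poly_const_pow flip: \<iota>.hom_power to_fract_power)

lemma cpw_nonzero: "s \<in> VG \<Longrightarrow> cpw s \<noteq> 0"
  by (simp add: cpw_def embed_eq_0_iff pw_nonzero)

lemma val_cpw: "s \<in> VG \<Longrightarrow> v (cpw s) = s"
  using gauss_poly_const[of 1] by (simp add: cpw_def v_embed pw_nonzero to_fract_def gauss_val_Fract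
      gauss_poly_const val_pw K.v_one Zero_fract_def eq_fract flip: one_pCons)

lemma deriv_cpw: "D (cpw s) = 0"
  by (simp add: cpw_def compl_deriv_embed fract_deriv_to_fract pderiv_pCons \<iota>.hom_zero)

end

section \<open>Swan and differential conductors\<close>

locale character_setting = gauss_setting \<nu> red pw v \<iota> + witt_prime p
  for p :: nat and \<nu> :: "'a::field \<Rightarrow> rat" and red :: "'a \<Rightarrow> 'k::alg_closed_field" and pw
    and v :: "'c::field \<Rightarrow> rat" and \<iota> :: "'a poly fract \<Rightarrow> 'c" +
  assumes char_a: "CHAR('a) = p" and dvf: "complete_dvf \<nu>"
begin

lemma char_af: "CHAR('a poly fract) = p"
  by (simp add: CHAR_poly_fract char_a)

lemma char_c: "CHAR('c) = p"
proof (rule CHAR_eqI)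
  have *: "(of_nat k :: 'c) = 0 \<longleftrightarrow> p dvd k" for k
    using embed_eq_0_iff[of "of_nat k"] of_nat_eq_0_iff_char_dvd[of k, where ?'a = "'a poly fract"]
    by (simp add: \<iota>.hom_of_nat char_af)
  show "of_nat p = (0 :: 'c)" and "\<And>n. of_nat n = (0 :: 'c) \<Longrightarrow> p dvd n" by (simp_all add: *)
qed

lemma char_k: "CHAR('k) = p"
proof -
  have "of_nat p = (0 :: 'k)"
    using red_of_nat[of p] of_nat_CHAR[where ?'a = 'a] by (simp add: char_a red_zero)
  then have "CHAR('k) dvd p" by (simp add: of_nat_eq_0_iff_char_dvd)
  moreover have "CHAR('k) \<noteq> 1" by simp
  ultimately show ?thesis using prime_p by (metis prime_nat_iff)
qed

sublocale valued_witt p v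
  by unfold_locales (rule char_c)

sublocale valued_derivation p v D
proof -
  interpret derivation D by (rule derivation_compl_deriv)
  show "valued_derivation p v D" by unfold_locales (rule compl_deriv_val_ge)
qed

sublocale \<kappa>: cartier_field p "TYPE('k)"
  by unfold_locales (rule prime_p, rule char_k)

abbreviation "sw \<equiv> swan p \<iota> v"
abbreviation "rep \<equiv> represents p \<iota>"
abbreviation "best \<equiv> best_rep p \<iota> v"
abbreviation "pb \<equiv> pole_bounded p v"
abbreviation "\<Theta> n a \<equiv> wtheta p D (n - 1) ((!) a)"

text \<open>\<open>represents\<close> lets b range over the whole class. Changing b by \<wp> e
  changes its image by \<wp> of the image of e, so one fixed b describes all
  representatives.\<close>

lemma rep_iff:
  assumes "length b = n"
  shows "rep n a (wp_img n #>\<^bsub>witt p n\<^esub> b) \<longleftrightarrow> a \<in> wp_img n #>\<^bsub>witt p n\<^esub> map \<iota> b"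
proof
  assume "rep n a (wp_img n #>\<^bsub>witt p n\<^esub> b)"
  then obtain b' where b': "b' \<in> wp_img n #>\<^bsub>witt p n\<^esub> b" "a \<in> wp_img n #>\<^bsub>witt p n\<^esub> map \<iota> b'"
    unfolding represents_def by blast
  then obtain e where e: "length e = n" "b' = witt_add p (witt_wp p e) b"
    unfolding in_wp_coset[OF char_af] by blast
  have "map \<iota> b' = witt_add p (map \<iota> (witt_wp p e)) (map \<iota> b)"
    using hom_mult[OF map_hom_witt[OF \<iota>.unital_hom_axioms, of n], of "witt_wp p e" b] e assms
      length_witt_wp[OF char_af e(1)] by simp
  also have "map \<iota> (witt_wp p e) = witt_wp p (map \<iota> e)"
    using e(1) by (intro hom_witt_wp[OF char_af char_c map_hom_witt[OF \<iota>.unital_hom_axioms], of n])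
      (simp_all add: witt_frob_def \<iota>.hom_power)
  finally have "map \<iota> b' \<in> wp_img n #>\<^bsub>witt p n\<^esub> map \<iota> b"
    unfolding in_wp_coset[OF char_c] using e(1) by (intro exI[of _ "map \<iota> e"]) simp
  then have "wp_img n #>\<^bsub>witt p n\<^esub> map \<iota> b' = wp_img n #>\<^bsub>witt p n\<^esub> map \<iota> b"
    using assms by (intro wp_coset_eq[OF char_c]) simp_all
  then show "a \<in> wp_img n #>\<^bsub>witt p n\<^esub> map \<iota> b" using b' by simp
next
  assume "a \<in> wp_img n #>\<^bsub>witt p n\<^esub> map \<iota> b"
  then show "rep n a (wp_img n #>\<^bsub>witt p n\<^esub> b)"
    unfolding represents_def using wp_coset_self[OF char_af assms] by blast
qed

lemma rep_length: "\<chi> \<in> carrier (H1 p n) \<Longrightarrow> rep n a \<chi> \<Longrightarrow> length a = n"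
  by (erule wp_cosetE) (auto simp: rep_iff in_wp_coset[OF char_c] length_witt_wp[OF char_c])

lemma rep_exists: assumes "\<chi> \<in> carrier (H1 p n)" shows "\<exists>a. rep n a \<chi>"
proof -
  obtain b where "length b = n" "\<chi> = wp_img n #>\<^bsub>witt p n\<^esub> b" using wp_cosetE[OF assms] .
  then have "rep n (map \<iota> b) \<chi>" using wp_coset_self[OF char_c, of "map \<iota> b" n] by (simp add: rep_iff)
  then show ?thesis ..
qed

lemma of_nat_power_diff: "j < m \<Longrightarrow> (of_nat (p ^ (m - j)) :: rat) = of_nat (p ^ (m - Suc j)) * of_nat p"
  by (simp add: Suc_diff_Suc[symmetric] mult.commute)

lemma rep_coset:
  assumes "\<chi> \<in> carrier (H1 p n)" "rep n a \<chi>"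
  shows "rep n a' \<chi> \<longleftrightarrow> (\<exists>c. length c = n \<and> a' = witt_add p (witt_wp p c) a)"
proof -
  obtain b where b: "length b = n" "\<chi> = wp_img n #>\<^bsub>witt p n\<^esub> b" using wp_cosetE[OF assms(1)] .
  then have "wp_img n #>\<^bsub>witt p n\<^esub> a = wp_img n #>\<^bsub>witt p n\<^esub> map \<iota> b"
    using assms(2) by (intro wp_coset_eq[OF char_c]) (simp_all add: rep_iff)
  then show ?thesis using b by (simp add: rep_iff flip: in_wp_coset[OF char_c])
qed

lemma pole_order_VG: "pole_order p v n a \<in> VG"
proof -
  let ?A = "insert 0 ((\<lambda>i. - of_nat (p ^ (n - Suc i)) * v (a ! i)) ` {i. i < n \<and> a ! i \<noteq> 0})"
  have "pole_order p v n a \<in> ?A" unfolding pole_order_def by (intro Max_in) simp_all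
  moreover have "?A \<subseteq> VG"
    using VG_zero VG_minus[OF VG_of_nat_mult[OF val_VG]] by (auto simp del: of_nat_power)
  ultimately show ?thesis by blast
qed

text \<open>Pole orders lie in the discrete set \<open>(1/e)\<nat>\<close>, so the infimum defining \<open>sw\<close> is attained.\<close>

lemma swan_attained:
  assumes "\<chi> \<in> carrier (H1 p n)"
  obtains a where "rep n a \<chi>" "sw n \<chi> = pole_order p v n a"
    "\<And>b. rep n b \<chi> \<Longrightarrow> sw n \<chi> \<le> pole_order p v n b"
proof -
  obtain e :: nat where e: "0 < e" "VG = {of_int m / of_nat e | m :: int. True}"
    using dvf unfolding complete_dvf_def by blast
  define f where "f a = nat \<lfloor>of_nat e * pole_order p v n a\<rfloor>" for a
  have f: "of_nat (f a) = of_nat e * pole_order p v n a" for a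
  proof -
    obtain m :: int where m: "pole_order p v n a = of_int m / of_nat e"
      using pole_order_VG[of n a] unfolding e(2) by blast
    then have "of_nat e * pole_order p v n a = of_int m" using e(1) by simp
    moreover from this have "0 \<le> m"
      using pole_order_nonneg[of p v n a] e(1) m by (simp add: zero_le_divide_iff)
    ultimately show ?thesis by (simp add: f_def)
  qed
  obtain a where a: "rep n a \<chi>" "\<And>b. rep n b \<chi> \<Longrightarrow> f a \<le> f b"
    using ex_has_least_nat[of "\<lambda>a. rep n a \<chi>" _ f] rep_exists[OF assms] by blast
  have le: "pole_order p v n a \<le> pole_order p v n b" if "rep n b \<chi>" for b
  proof -
    have "(of_nat (f a) :: rat) \<le> of_nat (f b)" using a(2)[OF that] by simp
    then show ?thesis using e(1) by (simp add: f)
  qed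
  have "sw n \<chi> = pole_order p v n a"
    unfolding swan_def
  proof (rule Least_equality)
    show "0 \<le> pole_order p v n a \<and> (\<exists>b. rep n b \<chi> \<and> pb n (pole_order p v n a) b)"
      using a(1) pole_order_nonneg[of p v n a] pole_bounded_iff_order[of "pole_order p v n a" p v n a] by blast
    fix s assume "0 \<le> s \<and> (\<exists>b. rep n b \<chi> \<and> pb n s b)"
    then obtain b where "0 \<le> s" "rep n b \<chi>" "pb n s b" by blast
    then show "pole_order p v n a \<le> s" using le[of b] pole_bounded_iff_order[of s p v n b] by simp
  qed
  then show ?thesis using that a(1) le by metis
qed

lemma swan_VG: "\<chi> \<in> carrier (H1 p n) \<Longrightarrow> sw n \<chi> \<in> VG"
  by (metis swan_attained pole_order_VG)

lemma swan_nonneg: "\<chi> \<in> carrier (H1 p n) \<Longrightarrow> 0 \<le> sw n \<chi>"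
  by (metis swan_attained pole_order_nonneg)

lemma swan_le: "\<chi> \<in> carrier (H1 p n) \<Longrightarrow> rep n a \<chi> \<Longrightarrow> 0 \<le> s \<Longrightarrow> pb n s a \<Longrightarrow> sw n \<chi> \<le> s"
  using swan_attained[of \<chi> n] pole_bounded_iff_order[of s p v n a] order_trans by metis

lemma best_exists: assumes "\<chi> \<in> carrier (H1 p n)" obtains a where "best n a \<chi>"
proof -
  obtain a where a: "rep n a \<chi>" "sw n \<chi> = pole_order p v n a" using swan_attained[OF assms] .
  then have "pb n (sw n \<chi>) a" using pole_bounded_iff_order[OF swan_nonneg[OF assms], of p v n a] by simp
  then show ?thesis using that a by (simp add: best_rep_def)
qed

text \<open>The form attached to a best representative depends on it only up to
  \<open>\<Theta> (\<wp> c) = - \<Theta> c\<close>, where \<open>\<wp> c\<close> has pole order at most \<open>s\<close>, hence \<open>c\<close> at most \<open>s / p < s\<close>.\<close>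

lemma diff_conductor_eqI:
  assumes \<chi>: "\<chi> \<in> carrier (H1 p n)" and n: "n \<ge> 1" and pos: "sw n \<chi> > 0"
    and a: "best n a \<chi>" and r: "reduces (cpw (sw n \<chi>) * \<Theta> n a) r"
  shows "diff_conductor p \<nu> red pw \<iota> v n \<chi> = r"
proof -
  define s where "s = sw n \<chi>"
  have sum: "(\<Sum>i = 1..n. b ! (i - 1) ^ (p ^ (n - i) - 1) * D (b ! (i - 1))) = \<Theta> n b" for b
    unfolding wtheta_def
    by (rule sum.reindex_bij_witness[of _ Suc "\<lambda>i. i - 1"]) (use n in auto)
  have red: "gauss_red \<nu> red \<iota> v (cpw s * \<Theta> n b) = r" if b: "best n b \<chi>" for b
  proof -
    have la: "length a = n" "length b = n" and pa: "pb n s a" "pb n s b"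
      using a b rep_length[OF \<chi>] by (auto simp: best_rep_def s_def)
    obtain c where c: "length c = n" "b = witt_add p (witt_wp p c) a"
      using rep_coset[OF \<chi>] a b unfolding best_rep_def by metis
    have lw: "length (witt_wp p c) = n" by (rule length_witt_wp[OF char_c c(1)])
    have "witt_wp p c = witt_add p b (inv\<^bsub>witt p n\<^esub> a)"
      using W.inv_solve_right[of "witt_wp p c" n b a] c(2) lw la by simp
    then have "pb n s (witt_wp p c)"
      using la pa W.inv_closed[of a n] by (auto intro!: pole_bounded_add pole_bounded_inv)
    then have "pb n (s / of_nat p) c" using c(1) pos by (intro pole_bounded_wpD) (simp_all add: s_def)
    then have c_ge: "val_ge v (\<Theta> n c) (- (s / of_nat p))" using c(1) n by (intro wtheta_val_ge) simp_all
    have "s / of_nat p < s" using pos p_gt_1 by (simp add: s_def divide_less_eq)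
    moreover have "val_ge v (cpw s) s"
      using val_cpw[OF swan_VG[OF \<chi>]] by (simp add: val_ge_def s_def)
    ultimately have "val_pos v (cpw s * \<Theta> n c)"
      using val_ge_mult[OF _ c_ge] by (intro val_posI[of v _ "s + - (s / of_nat p)"]) simp_all
    then have "reduces (cpw s * \<Theta> n a + - (cpw s * \<Theta> n c)) (r + 0)"
      using r by (intro reduces_add reduces_pos) (simp_all add: s_def)
    moreover have "cpw s * \<Theta> n a + - (cpw s * \<Theta> n c) = cpw s * \<Theta> n b"
      unfolding c(2) wtheta_witt_add[OF lw la(1) n] wtheta_wp[OF c(1) n] by (simp add: algebra_simps)
    ultimately show ?thesis by (intro gauss_red_eqI) simp
  qed
  show ?thesis
    unfolding diff_conductor_def cpw_def[symmetric] sum s_def[symmetric]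
    by (rule the_equality) (use a red in blast)+
qed

text \<open>The scaled term has valuation at least s + p^k v(x) > 0.\<close>

lemma term_small:
  assumes s: "s \<in> VG" and x: "x = 0 \<or> - s < of_nat (p ^ k) * v x"
  shows "reduces (cpw s * (x ^ (p ^ k - 1) * D x)) 0"
proof (cases "x = 0")
  case True
  then show ?thesis by (intro reduces_pos) (simp add: deriv_zero val_pos_def)
next
  case False
  have "val_ge v (cpw s * (x ^ (p ^ k - 1) * D x)) (s + (of_nat (p ^ k - 1) * v x + v x))"
    using val_cpw[OF s] by (intro val_ge_mult val_ge_power deriv_val_ge) (simp_all add: val_ge_def)
  moreover have "of_nat (p ^ k - 1) * v x + v x = of_nat (p ^ k) * v x"
    using p_pos by (simp add: of_nat_diff Suc_leI algebra_simps)
  moreover have "0 < s + of_nat (p ^ k) * v x" using x False by simp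
  ultimately show ?thesis by (intro reduces_pos val_posI) simp_all
qed

text \<open>Scaling x to u of valuation 0 by a constant turns the term into u^(p^k-1) D u. That r is
  the same for all k matters: the terms for k + 1 and k are compared through one residue.\<close>

lemma term_unit:
  assumes "x \<noteq> 0"
  obtains r where "\<And>k. reduces (cpw (of_nat (p ^ k) * - v x) * (x ^ (p ^ k - 1) * D x))
    (r ^ (p ^ k - 1) * fract_deriv r)"
proof -
  have VG: "- v x \<in> VG" using val_VG[OF assms] by (rule VG_minus)
  define u where "u = cpw (- v x) * x"
  have "v u = 0" unfolding u_def using assms VG by (simp add: v_mult cpw_nonzero val_cpw)
  then obtain r where r: "reduces u r" using reduces_exists[of u] by (auto simp: val_ge_def)
  have "cpw (of_nat (p ^ k) * - v x) * (x ^ (p ^ k - 1) * D x) = u ^ (p ^ k - 1) * D u" for k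
  proof -
    have "cpw (of_nat (p ^ k) * - v x) = cpw (- v x) ^ (p ^ k - 1) * cpw (- v x)"
      unfolding cpw_of_nat_mult[OF VG] using p_pos by (subst power_minus_mult) simp_all
    then show ?thesis by (simp add: u_def deriv_mult deriv_cpw power_mult_distrib mult_ac)
  qed
  then show ?thesis
    using that[of r] reduces_mult[OF reduces_power[OF r] reduces_deriv[OF r]] by metis
qed

text \<open>A component below the maximal pole for s is also below it for s/p, and both terms reduce
  to 0. At the maximal pole both come from the same residue r.\<close>

lemma term_Cartier:
  assumes s: "s \<in> VG" "s / of_nat p \<in> VG" and x: "x = 0 \<or> - s \<le> of_nat (p ^ Suc k) * v x"
  shows "\<exists>g h. reduces (cpw s * (x ^ (p ^ Suc k - 1) * D x)) g \<and>
    reduces (cpw (s / of_nat p) * (x ^ (p ^ k - 1) * D x)) h \<and> \<kappa>.Car g h"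
proof (cases "x = 0 \<or> - s < of_nat (p ^ Suc k) * v x")
  case True
  have "x = 0 \<or> - (s / of_nat p) < of_nat (p ^ k) * v x"
  proof -
    have "- (s / of_nat p) < of_nat (p ^ k) * v x" if "- s < of_nat (p ^ Suc k) * v x"
    proof -
      have "- s / of_nat p < of_nat (p ^ k) * v x"
        using that p_pos by (subst pos_divide_less_eq) (simp_all add: mult_ac)
      then show ?thesis by simp
    qed
    then show ?thesis using True by blast
  qed
  then show ?thesis using term_small[OF s(1) True] term_small[OF s(2)] \<kappa>.Car_zero by blast
next
  case False
  then have "x \<noteq> 0" and s_eq: "s = of_nat (p ^ Suc k) * - v x" using x by auto
  moreover have "s / of_nat p = of_nat (p ^ k) * - v x" using p_pos by (simp add: s_eq)
  ultimately show ?thesis using term_unit[of x] \<kappa>.Car_power_p_power_deriv by metis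
qed

text \<open>pi^s x is integral and pi^s is a constant, so the term is the derivative of an integral
  element and reduces to an exact form.\<close>

lemma term_exact:
  assumes s: "s \<in> VG" and x: "x = 0 \<or> - s \<le> v x"
  shows "\<exists>g. reduces (cpw s * D x) g \<and> \<kappa>.Car g 0"
proof -
  have "val_ge v (cpw s * x) 0"
    using x val_cpw[OF s] cpw_nonzero[OF s] by (cases "x = 0") (simp_all add: val_ge_def v_mult)
  then obtain r where "reduces (cpw s * x) r" using reduces_exists by blast
  from reduces_deriv[OF this] show ?thesis using \<kappa>.Car_deriv by (auto simp: deriv_mult deriv_cpw)
qed

lemma theta_split: "cpw s * \<Theta> (Suc m) a =
    (\<Sum>j<m. cpw s * (a ! j ^ (p ^ (m - j) - 1) * D (a ! j))) + cpw s * D (a ! m)"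
  by (simp add: wtheta_def sum_distrib_left distrib_left flip: lessThan_Suc_atMost)

lemma pole_boundedD:
  "pb (Suc m) s a \<Longrightarrow> j \<le> m \<Longrightarrow> a ! j = 0 \<or> - s \<le> of_nat (p ^ (m - j)) * v (a ! j)"
  unfolding pole_bounded_iff by (metis diff_Suc_Suc le_imp_less_Suc)

text \<open>Used twice: for m = 0, where \<open>small\<close> is vacuous, it gives (i); for the
  lifted representative it gives (b).\<close>

lemma conductor_last:
  assumes \<chi>: "\<chi> \<in> carrier (H1 p (Suc m))" and pos: "sw (Suc m) \<chi> > 0" and a: "best (Suc m) a \<chi>"
    and small: "\<And>j. j < m \<Longrightarrow> a ! j = 0 \<or> - sw (Suc m) \<chi> < of_nat (p ^ (m - j)) * v (a ! j)"
  shows "cartier p (diff_conductor p \<nu> red pw \<iota> v (Suc m) \<chi>) = 0"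
proof -
  let ?s = "sw (Suc m) \<chi>"
  have s: "?s \<in> VG" by (rule swan_VG[OF \<chi>])
  have "a ! m = 0 \<or> - ?s \<le> v (a ! m)" using a pole_boundedD[of m ?s a m] by (simp add: best_rep_def)
  then obtain g where g: "reduces (cpw ?s * D (a ! m)) g" "\<kappa>.Car g 0" using term_exact[OF s] by blast
  have "reduces (\<Sum>j<m. cpw ?s * (a ! j ^ (p ^ (m - j) - 1) * D (a ! j))) (\<Sum>j<m. 0)"
    by (intro reduces_sum term_small s small) simp
  then have "reduces (cpw ?s * \<Theta> (Suc m) a) (0 + g)"
    unfolding theta_split using g(1) by (intro reduces_add) simp_all
  then have "diff_conductor p \<nu> red pw \<iota> v (Suc m) \<chi> = g"
    using diff_conductor_eqI[OF \<chi> _ pos a] by simp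
  then show ?thesis using \<kappa>.cartier_eqI[OF g(2)] by simp
qed

lemma conductor_one:
  assumes "\<chi> \<in> carrier (H1 p 1)" "sw 1 \<chi> > 0"
  shows "cartier p (diff_conductor p \<nu> red pw \<iota> v 1 \<chi>) = 0"
proof -
  obtain a where "best 1 a \<chi>" using best_exists[OF assms(1)] .
  then show ?thesis using conductor_last[of \<chi> 0 a] assms by simp
qed

text \<open>Two neighbouring characters, of lengths m + 1 and m. Their relation enters only through
  \<open>trunc\<close>.\<close>

context
  fixes m :: nat and \<chi> \<chi>' :: "'a poly fract list set"
  assumes m: "m \<ge> 1" and \<chi>: "\<chi> \<in> carrier (H1 p (Suc m))" and \<chi>': "\<chi>' \<in> carrier (H1 p m)"
    and trunc: "\<And>a. rep (Suc m) a \<chi> \<Longrightarrow> rep m (take m a) \<chi>'"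
    and pos: "sw (Suc m) \<chi> > 0" and pos': "sw m \<chi>' > 0"
begin

text \<open>Each remaining entry has weight p^(m-i) in length m + 1 but p^(m-1-i) in length m, when
  counted from i = 0.\<close>

lemma take_pole_bounded: "pb (Suc m) s a \<Longrightarrow> pb m (s / of_nat p) (take m a)"
  unfolding pole_bounded_iff
proof (intro allI impI)
  fix i assume *: "\<forall>i<Suc m. a ! i \<noteq> 0 \<longrightarrow> - s \<le> of_nat (p ^ (Suc m - Suc i)) * v (a ! i)"
    "i < m" "take m a ! i \<noteq> 0"
  then have "- s \<le> of_nat (p ^ (Suc m - Suc i)) * v (a ! i)" by simp
  then have "- s \<le> of_nat (p ^ (m - Suc i)) * v (a ! i) * of_nat p"
    unfolding diff_Suc_Suc of_nat_power_diff[OF *(2)] by (simp only: mult_ac)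
  then have "- s / of_nat p \<le> of_nat (p ^ (m - Suc i)) * v (a ! i)"
    using p_pos by (subst pos_divide_le_eq) simp_all
  then show "- (s / of_nat p) \<le> of_nat (p ^ (m - Suc i)) * v (take m a ! i)" using *(2) by simp
qed

lemma swan_truncation: "sw m \<chi>' \<le> sw (Suc m) \<chi> / of_nat p"
proof -
  obtain a where a: "best (Suc m) a \<chi>" using best_exists[OF \<chi>] .
  show ?thesis
    by (rule swan_le[OF \<chi>' trunc[of a]]) (use a pos take_pole_bounded in \<open>auto simp: best_rep_def\<close>)
qed

lemma conductor_eq:
  assumes eq: "sw (Suc m) \<chi> = of_nat p * sw m \<chi>'"
  shows "cartier p (diff_conductor p \<nu> red pw \<iota> v (Suc m) \<chi>) = diff_conductor p \<nu> red pw \<iota> v m \<chi>'"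
proof -
  let ?s = "sw (Suc m) \<chi>" and ?s' = "sw m \<chi>'"
  obtain a where a: "best (Suc m) a \<chi>" using best_exists[OF \<chi>] .
  have s': "?s' = ?s / of_nat p" using eq p_pos by simp
  have VG: "?s \<in> VG" "?s / of_nat p \<in> VG" using swan_VG[OF \<chi>] swan_VG[OF \<chi>'] s' by simp_all
  have pa: "rep (Suc m) a \<chi>" "pb (Suc m) ?s a" using a by (simp_all add: best_rep_def)
  have best': "best m (take m a) \<chi>'"
    using trunc[OF pa(1)] take_pole_bounded[OF pa(2)] by (simp add: best_rep_def s')
  \<comment> \<open>Both forms use the same entries of \<open>a\<close>, the exponent dropping from
    p^(m-j) - 1 to p^(m-1-j) - 1. The entry \<open>a ! m\<close> has no counterpart and is treated
    apart as an exact term.\<close>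
  let ?t = "\<lambda>j. cpw ?s * (a ! j ^ (p ^ (m - j) - 1) * D (a ! j))"
    and ?t' = "\<lambda>j. cpw ?s' * (a ! j ^ (p ^ (m - 1 - j) - 1) * D (a ! j))"
  have "\<exists>g h. reduces (?t j) g \<and> reduces (?t' j) h \<and> \<kappa>.Car g h" if "j < m" for j
  proof -
    have "m - j = Suc (m - 1 - j)" using that by simp
    then show ?thesis
      using term_Cartier[OF VG, of "a ! j" "m - 1 - j"] pole_boundedD[OF pa(2), of j] that
      by (simp only: s' less_imp_le)
  qed
  then obtain G H where GH: "\<And>j. j < m \<Longrightarrow> reduces (?t j) (G j)" "\<And>j. j < m \<Longrightarrow> reduces (?t' j) (H j)"
    "\<And>j. j < m \<Longrightarrow> \<kappa>.Car (G j) (H j)" by metis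
  obtain g where g: "reduces (cpw ?s * D (a ! m)) g" "\<kappa>.Car g 0"
    using term_exact[OF VG(1)] pole_boundedD[OF pa(2), of m] by auto
  have "reduces (cpw ?s * \<Theta> (Suc m) a) ((\<Sum>j<m. G j) + g)"
    unfolding theta_split using GH g by (intro reduces_add reduces_sum) auto
  then have 1: "diff_conductor p \<nu> red pw \<iota> v (Suc m) \<chi> = (\<Sum>j<m. G j) + g"
    using diff_conductor_eqI[OF \<chi> _ pos a] by simp
  have "cpw ?s' * \<Theta> m (take m a) = (\<Sum>j<m. ?t' j)"
    unfolding wtheta_def sum_distrib_left using m by (intro sum.cong) auto
  moreover have "reduces (\<Sum>j<m. ?t' j) (\<Sum>j<m. H j)" using GH by (intro reduces_sum) auto
  ultimately have 2: "diff_conductor p \<nu> red pw \<iota> v m \<chi>' = (\<Sum>j<m. H j)"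
    using diff_conductor_eqI[OF \<chi>' m pos' best'] by simp
  have "\<kappa>.Car ((\<Sum>j<m. G j) + g) ((\<Sum>j<m. H j) + 0)"
    using GH g by (intro \<kappa>.Car_add \<kappa>.Car_sum) auto
  from \<kappa>.cartier_eqI[OF this] show ?thesis unfolding 1 2 by simp
qed

text \<open>
  A best representative of \<open>\<chi>'\<close> lifts to a best representative of \<open>\<chi>\<close>, whose components but the
  last are too small to contribute.
\<close>

lemma conductor_gt:
  assumes gt: "sw (Suc m) \<chi> > of_nat p * sw m \<chi>'"
  shows "cartier p (diff_conductor p \<nu> red pw \<iota> v (Suc m) \<chi>) = 0"
proof -
  let ?s = "sw (Suc m) \<chi>" and ?s' = "sw m \<chi>'"
  obtain a where a: "rep (Suc m) a \<chi>" "pb (Suc m) ?s a"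
    using best_exists[OF \<chi>] unfolding best_rep_def by blast
  obtain b where b: "rep m b \<chi>'" "pb m ?s' b"
    using best_exists[OF \<chi>'] unfolding best_rep_def by blast
  let ?a = "take m a"
  have la: "length a = Suc m" "length ?a = m" and lb: "length b = m"
    using rep_length[OF \<chi> a(1)] rep_length[OF \<chi>' b(1)] by simp_all
  obtain c where c: "length c = m" "b = witt_add p (witt_wp p c) ?a"
    using rep_coset[OF \<chi>' trunc[OF a(1)]] b(1) by blast
  have lw: "length (witt_wp p c) = m" by (rule length_witt_wp[OF char_c c(1)])
  have "?s' \<le> ?s / of_nat p" by (rule swan_truncation)
  then have "pb m (?s / of_nat p) b" using pole_bounded_mono[OF b(2)] by blast
  moreover have "witt_wp p c = witt_add p b (inv\<^bsub>witt p m\<^esub> ?a)"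
    using W.inv_solve_right[of "witt_wp p c" m b ?a] c(2) lw la lb by simp
  ultimately have "pb m (?s / of_nat p) (witt_wp p c)"
    using la lb take_pole_bounded[OF a(2)] W.inv_closed[of ?a m]
    by (auto intro!: pole_bounded_add pole_bounded_inv)
  then have pc: "pb m (?s / of_nat p / of_nat p) c" using pole_bounded_wpD[OF c(1), of "?s / of_nat p"] pos by simp
  \<comment> \<open>In length m + 1 every weight has one more factor p, so the bound s/p^2 on
    \<open>c\<close> becomes s/p on \<open>?c\<close>, and \<wp> brings it to s. Thus
    \<open>a\<close> may be changed by \<wp> of \<open>?c\<close> without exceeding the pole bound
    s.\<close>
  let ?c = "c @ [0]"
  have lc: "length ?c = Suc m" using c(1) by simp
  have "pb (Suc m) (?s / of_nat p) ?c"
    unfolding pole_bounded_iff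
  proof (intro allI impI)
    fix i assume "i < Suc m" "?c ! i \<noteq> 0"
    then have i: "i < m" "?c ! i = c ! i" using c(1) by (auto simp: nth_append less_Suc_eq)
    then have "- (?s / of_nat p / of_nat p) \<le> of_nat (p ^ (m - Suc i)) * v (c ! i)"
      using pc \<open>?c ! i \<noteq> 0\<close> unfolding pole_bounded_iff by metis
    then have "- (?s / of_nat p / of_nat p) * of_nat p \<le> of_nat (p ^ (m - Suc i)) * v (c ! i) * of_nat p"
      using p_pos by (intro mult_right_mono) simp_all
    moreover have "- (?s / of_nat p / of_nat p) * of_nat p = - (?s / of_nat p)" using p_pos by simp
    ultimately show "- (?s / of_nat p) \<le> of_nat (p ^ (Suc m - Suc i)) * v (?c ! i)"
      unfolding diff_Suc_Suc of_nat_power_diff[OF i(1)] i(2) by (simp only: mult_ac)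
  qed
  then have "pb (Suc m) (of_nat p * (?s / of_nat p)) (witt_wp p ?c)"
    using pos by (intro pole_bounded_wp[OF lc]) simp_all
  then have pw: "pb (Suc m) ?s (witt_wp p ?c)" using p_pos by simp
  let ?b = "witt_add p (witt_wp p ?c) a"
  have lwc: "length (witt_wp p ?c) = Suc m" by (rule length_witt_wp[OF char_c lc])
  have "pb (Suc m) ?s ?b" by (rule pole_bounded_add[OF lwc la(1) pw a(2)])
  moreover have "rep (Suc m) ?b \<chi>" using rep_coset[OF \<chi> a(1)] lc by blast
  ultimately have best: "best (Suc m) ?b \<chi>" by (simp add: best_rep_def)
  have "take m ?b = witt_add p (witt_wp p (take m ?c)) ?a"
    using take_witt_add[OF char_c lwc la(1), of m] take_witt_wp[OF char_c lc, of m] by simp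
  then have take_b: "take m ?b = b" using c by simp
  show ?thesis
  proof (rule conductor_last[OF \<chi> pos best])
    fix j assume j: "j < m"
    have "?b ! j = b ! j" using j by (metis take_b nth_take)
    \<comment> \<open>The bound s' for \<open>b\<close> reads p s' in length m + 1. Strictness comes
      from p s' < s.\<close>
    moreover have "b ! j = 0 \<or> - ?s < of_nat (p ^ (m - j)) * v (b ! j)"
    proof (cases "b ! j = 0")
      case False
      then have "- ?s' \<le> of_nat (p ^ (m - Suc j)) * v (b ! j)"
        using b(2) j unfolding pole_bounded_iff by blast
      then have "- ?s' * of_nat p \<le> of_nat (p ^ (m - Suc j)) * v (b ! j) * of_nat p"
        using p_pos by (intro mult_right_mono) simp_all
      then have "- (of_nat p * ?s') \<le> of_nat (p ^ (m - j)) * v (b ! j)"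
        unfolding of_nat_power_diff[OF j] by (simp only: mult_ac mult_minus_left mult_minus_right)
      then show ?thesis using gt by simp
    qed simp
    ultimately show "?b ! j = 0 \<or> - ?s < of_nat (p ^ (m - j)) * v (?b ! j)" by simp
  qed
qed

end

text \<open>Supplies \<open>trunc\<close>: both characters are classes of truncations of one vector
  b representing \<open>\<chi> n\<close>, and truncation commutes with \<wp>, addition and the
  embedding.\<close>

lemma rep_truncation:
  assumes n: "Suc m \<le> n" and \<chi>n: "\<chi> n \<in> carrier (H1 p n)"
    and car: "\<And>i. i \<in> {m, Suc m} \<Longrightarrow> \<chi> i \<in> carrier (H1 p i)"
    and incl: "\<And>i. i \<in> {m, Suc m} \<Longrightarrow> H1_incl p i n (\<chi> i) = \<chi> n [^]\<^bsub>H1 p n\<^esub> (p ^ (n - i))"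
    and a: "rep (Suc m) a (\<chi> (Suc m))"
  shows "rep m (take m a) (\<chi> m)"
proof -
  obtain b where b: "length b = n" "\<chi> n = wp_img n #>\<^bsub>witt p n\<^esub> b" using wp_cosetE[OF \<chi>n] .
  have \<chi>: "\<chi> i = wp_img i #>\<^bsub>witt p i\<^esub> take i b" if i: "i \<in> {m, Suc m}" for i
  proof -
    have "n - i + i = n" using i n by auto
    then show ?thesis
      using character_truncation[OF char_af, of b "n - i" i "\<chi> i"] b car[OF i] incl[OF i] by simp
  qed
  have lb: "length (take (Suc m) b) = Suc m" "length (take m b) = m" using b n by simp_all
  obtain c where c: "length c = Suc m" "a = witt_add p (witt_wp p c) (map \<iota> (take (Suc m) b))"
    using a rep_iff[OF lb(1)] \<chi>[of "Suc m"] unfolding in_wp_coset[OF char_c] by auto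
  have "take m a = witt_add p (witt_wp p (take m c)) (map \<iota> (take m b))"
    unfolding c(2)
    using take_witt_add[OF char_c length_witt_wp[OF char_c c(1)], of "map \<iota> (take (Suc m) b)" m]
      take_witt_wp[OF char_c c(1), of m] lb by (simp add: take_map)
  then have "take m a \<in> wp_img m #>\<^bsub>witt p m\<^esub> map \<iota> (take m b)"
    unfolding in_wp_coset[OF char_c] using c(1) by (intro exI[of _ "take m c"]) simp
  then show ?thesis using rep_iff[OF lb(2)] \<chi>[of m] by simp
qed

end

theorem theorem3p42:
  fixes p n :: nat
    and \<nu> :: "'a::field \<Rightarrow> rat"
    and red :: "'a \<Rightarrow> 'k::alg_closed_field"
    and pw :: "rat \<Rightarrow> 'a"
    and \<iota> :: "'a poly fract \<Rightarrow> 'c::field"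
    and v :: "'c \<Rightarrow> rat"
    and \<chi> :: "nat \<Rightarrow> 'a poly fract list set"
    and \<delta> :: "nat \<Rightarrow> rat"
    and \<omega> :: "nat \<Rightarrow> 'k poly fract"
  defines "\<delta> \<equiv> \<lambda>i. depth p \<iota> v i (\<chi> i)"
    and "\<omega> \<equiv> \<lambda>i. diff_conductor p \<nu> red pw \<iota> v i (\<chi> i)"
  assumes "Factorial_Ring.prime p" and "CHAR('a) = p"
    and "complete_dvf \<nu>"
    and "residue_map \<nu> red"
    and "compatible_powers \<nu> pw"
    and "gauss_completion \<nu> \<iota> v"
    and "1 \<le> n"
    and "\<chi> n \<in> carrier (H1 p n)"
    and "group.ord (H1 p n) (\<chi> n) = p ^ n"
    and "\<And>i. i \<in> {1..n} \<Longrightarrow> \<chi> i \<in> carrier (H1 p i)"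
    and "\<And>i. i \<in> {1..n} \<Longrightarrow> H1_incl p i n (\<chi> i) = \<chi> n [^]\<^bsub>H1 p n\<^esub> (p ^ (n - i))"
    and "\<And>i. i \<in> {1..n} \<Longrightarrow> weakly_unramified p \<nu> i (\<chi> i)"
    and "\<And>i. i \<in> {1..n} \<Longrightarrow> is_radical p \<iota> v i (\<chi> i)"
  shows "cartier p (\<omega> 1) = 0 \<and>
    (\<forall>i. 1 < i \<and> i \<le> n \<longrightarrow>
       \<delta> i \<ge> of_nat p * \<delta> (i - 1) \<and>
       (\<delta> i = of_nat p * \<delta> (i - 1) \<longrightarrow> cartier p (\<omega> i) = \<omega> (i - 1)) \<and>
       (\<delta> i > of_nat p * \<delta> (i - 1) \<longrightarrow> cartier p (\<omega> i) = 0))"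
proof -
  interpret character_setting p \<nu> red pw v \<iota>
    using assms(3-8) by unfold_locales (auto simp: complete_dvf_def gauss_completion_def)
  have \<chi>: "\<chi> i \<in> carrier (H1 p i)" and pos: "sw i (\<chi> i) > 0" if "i \<in> {1..n}" for i
    using assms(12,15)[OF that] p_pos by (simp_all add: is_radical_def depth_def zero_less_divide_iff)
  have "cartier p (\<omega> 1) = 0"
    unfolding assms(2) using \<chi>[of 1] pos[of 1] \<open>1 \<le> n\<close> by (intro conductor_one) simp_all
  moreover have "\<delta> i \<ge> of_nat p * \<delta> (i - 1) \<and>
       (\<delta> i = of_nat p * \<delta> (i - 1) \<longrightarrow> cartier p (\<omega> i) = \<omega> (i - 1)) \<and>
       (\<delta> i > of_nat p * \<delta> (i - 1) \<longrightarrow> cartier p (\<omega> i) = 0)" if i: "1 < i" "i \<le> n" for i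
  proof -
    define m where "m = i - 1"
    have im: "i = Suc m" "m \<ge> 1" "m \<in> {1..n}" "Suc m \<in> {1..n}" using i by (auto simp: m_def)
    have tr: "rep m (take m a) (\<chi> m)" if "rep (Suc m) a (\<chi> (Suc m))" for a
      using im assms(10,12,13) that by (intro rep_truncation[of m n \<chi>]) auto
    note ctx = im(2) \<chi>[OF im(4)] \<chi>[OF im(3)] tr pos[OF im(4)]
    have p: "(0 :: rat) < of_nat p" using p_pos by simp
    have \<delta>: "\<delta> j = sw j (\<chi> j) / of_nat p" for j by (simp add: assms(1) depth_def)
    have "\<delta> i \<ge> of_nat p * \<delta> (i - 1)"
      using swan_truncation[OF ctx pos[OF im(3)]] p unfolding \<delta> im(1) by simp
    moreover have "cartier p (\<omega> i) = \<omega> (i - 1)" if "\<delta> i = of_nat p * \<delta> (i - 1)"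
      using conductor_eq[OF ctx pos[OF im(3)]] that p unfolding \<delta> im(1) assms(2) by (simp add: field_simps)
    moreover have "cartier p (\<omega> i) = 0" if "\<delta> i > of_nat p * \<delta> (i - 1)"
      using conductor_gt[OF ctx pos[OF im(3)]] that p unfolding \<delta> im(1) assms(2) by (simp add: field_simps)
    ultimately show ?thesis by blast
  qed
  ultimately show ?thesis by blast
qed

end
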